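(* Fix $1<p<\infty$ and put $q=p/(p-1)$. There are constants $c_p,C_p>0$ depending only on $p$ such that the following holds for all integers $d,L\ge 2$, with $n=L^d$, where $G=[L]^d$ is the nearest-neighbor box. (i) For every $0<\epsilon\le 1$ and every $f_0\in[-1,1]^{[L]^d}$, $$\mathbb{E}\,\tau_p(\epsilon;f_0)\le C_p\begin{cases} n\,d^{1/(p-1)}L^{p/(p-1)}\log(n/\epsilon),&1<p<2,\\ n\,d\,L^2\log(n/\epsilon),&p\ge 2.\end{cases}$$ (ii) For the worst initial profile, $$\sup_{f_0\in[-1,1]^{[L]^d}}\mathbb{E}\,\tau_p(1/2;f_0)\ge c_p\,n\begin{cases}\max\{d^{1/(p-1)-1}L^{q},\ d\log L\},&1<p<2,\\ dL^2,&p=2,\\ \max\{d\log L,\ L^2\},&p>2.\end{cases}$$ (The terms inside a maximum may be realized by different profiles.)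
   Context: The box: $[L]^d=\{0,\ldots,L-1\}^d$ is the vertex set of a graph in which two vertices are adjacent iff they differ by $\pm e_i$ for some standard basis vector $e_i$ (nearest-neighbor edges). Dynamics on a finite connected simple graph $G=(V,E)$ with $n=|V|\ge2$ and $1<p<\infty$: a profile is a function $f:V\to\mathbb{R}$. For a nonempty vector $y=(y_1,\dots,y_k)$ let $m_p(y)$ be the unique minimizer over $x\in\mathbb{R}$ of $\sum_{i=1}^k|x-y_i|^p$. For $u\in V$, $f^{\#u}$ is the profile equal to $m_p((f(v))_{v\sim u})$ at $u$ and equal to $f$ at every other vertex. Let $U_1,U_2,\ldots$ be independent uniformly distributed vertices of $V$; starting from a deterministic profile $f_0$ set $f_t=f_{t-1}^{\#U_t}$ for $t\ge1$. Let $\operatorname{osc}(f)=\max_V f-\min_V f$ and $\tau_p(\epsilon;f_0)=\min\{t\ge0:\operatorname{osc}(f_t)\le\epsilon\}$ (equal to $\infty$ if the set is empty). $\mathbb{E}$ is expectation over $(U_t)$. Logarithms are natural. *)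

theory Defs
  imports "HOL-Probability.Probability"
begin

definition lattice_box :: "nat \<Rightarrow> nat \<Rightarrow> (nat \<Rightarrow> nat) set" where
  "lattice_box d L = {..<d} \<rightarrow>\<^sub>E {..<L}"

definition box_adj :: "nat \<Rightarrow> (nat \<Rightarrow> nat) \<Rightarrow> (nat \<Rightarrow> nat) \<Rightarrow> bool" where
  "box_adj d x y \<longleftrightarrow> (\<exists>i<d. y = x(i := x i + 1) \<or> x = y(i := y i + 1))"

text \<open>The minimizer of the p-energy of a finite nonempty family of reals
  \<open>(y i)\<close>, \<open>i \<in> I\<close>; it exists and is unique for \<open>1 < p\<close>.\<close>

definition p_mean :: "real \<Rightarrow> 'i set \<Rightarrow> ('i \<Rightarrow> real) \<Rightarrow> real" where
  "p_mean p I y = (THE x. is_arg_min (\<lambda>x. \<Sum>i\<in>I. \<bar>x - y i\<bar> powr p) (\<lambda>_. True) x)"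

text \<open>A graph is given by its vertex set \<open>V\<close> and its adjacency relation \<open>adj\<close>.\<close>

definition p_update ::
  "real \<Rightarrow> 'a set \<Rightarrow> ('a \<Rightarrow> 'a \<Rightarrow> bool) \<Rightarrow> ('a \<Rightarrow> real) \<Rightarrow> 'a \<Rightarrow> ('a \<Rightarrow> real)" where
  "p_update p V adj f u = f(u := p_mean p {v \<in> V. adj u v} f)"

text \<open>Sequences are indexed from 0, so \<open>U t\<close> is the vertex updated at time \<open>t + 1\<close>.\<close>

primrec p_dynamics ::
  "real \<Rightarrow> 'a set \<Rightarrow> ('a \<Rightarrow> 'a \<Rightarrow> bool) \<Rightarrow> ('a \<Rightarrow> real) \<Rightarrow> (nat \<Rightarrow> 'a) \<Rightarrow> nat \<Rightarrow> ('a \<Rightarrow> real)" where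
  "p_dynamics p V adj f0 U 0 = f0"
| "p_dynamics p V adj f0 U (Suc t) = p_update p V adj (p_dynamics p V adj f0 U t) (U t)"

definition osc :: "'a set \<Rightarrow> ('a \<Rightarrow> real) \<Rightarrow> real" where
  "osc V f = Max (f ` V) - Min (f ` V)"

text \<open>The infimum of the empty set in \<^typ>\<open>enat\<close> is \<open>\<infinity>\<close>.\<close>

definition consensus_time ::
  "real \<Rightarrow> 'a set \<Rightarrow> ('a \<Rightarrow> 'a \<Rightarrow> bool) \<Rightarrow> real \<Rightarrow> ('a \<Rightarrow> real) \<Rightarrow> (nat \<Rightarrow> 'a) \<Rightarrow> enat" where
  "consensus_time p V adj \<epsilon> f0 U = Inf (enat ` {t. osc V (p_dynamics p V adj f0 U t) \<le> \<epsilon>})"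

text \<open>The canonical space of sequences of independent uniformly distributed vertices.\<close>

definition uniform_seq :: "'a set \<Rightarrow> (nat \<Rightarrow> 'a) measure" where
  "uniform_seq V = Pi\<^sub>M UNIV (\<lambda>_. uniform_count_measure V)"

definition expected_consensus_time ::
  "real \<Rightarrow> 'a set \<Rightarrow> ('a \<Rightarrow> 'a \<Rightarrow> bool) \<Rightarrow> real \<Rightarrow> ('a \<Rightarrow> real) \<Rightarrow> ennreal" where
  "expected_consensus_time p V adj \<epsilon> f0 =
     (\<integral>\<^sup>+ U. ennreal_of_enat (consensus_time p V adj \<epsilon> f0 U) \<partial>uniform_seq V)"

end

theory Submission
  imports Defs
begin

text \<open>
  Write \<open>E f\<close> for the \<open>p\<close>-energy, the sum of \<open>\<bar>f u - f v\<bar>\<^sup>p\<close> over directed edges, and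
  \<open>J a = sgn a * \<bar>a\<bar> powr (p - 1)\<close>, so that \<open>p * J\<close> is the derivative of \<open>\<bar>_\<bar> powr p\<close>. The
  \<open>p\<close>-mean of a family is the unique zero of the increasing function \<open>x \<mapsto> \<Sum>i. J (x - y i)\<close>; this
  makes it an energy minimizer, which gives the upper bounds, and gives it a comparison principle,
  which gives the lower bounds.

  Upper bound. An update at \<open>u\<close> lowers the energy at least as much as moving \<open>f u\<close> by an arbitrary
  displacement. The displacement \<open>k * (f u - m)\<close>, proportional to the distance from a centre \<open>m\<close>, has
  a linear gain that sums to \<open>p * k * E f\<close> by summation by parts, and a remainder that a
  Poincare inequality \<open>\<Sum>u. deg u * \<bar>f u - m\<bar> powr p \<le> X powr p * E f\<close> absorbs for \<open>k\<close> of order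
  \<open>X powr (- p / (p - 1))\<close> if \<open>p \<le> 2\<close> and \<open>1 / X\<^sup>2\<close> if \<open>p \<ge> 2\<close>
  (\<open>energy_contraction_le_2\<close>, \<open>energy_contraction_ge_2\<close>). Hence the energy contracts in mean by a
  factor \<open>1 - c * k / n\<close>, and Markov's inequality bounds the tail of the consensus time. On the box
  the Poincare inequality comes from the Efron--Stein inequality applied to the signed power \<open>p / 2\<close>
  of \<open>f - m\<close>, together with one-dimensional estimates along the axes: \<open>X\<close> is of order
  \<open>d powr (1 / p) * L\<close> for \<open>p \<le> 2\<close> and \<open>sqrt d * L\<close> for \<open>p \<ge> 2\<close>
  (\<open>poincare_box_le_2\<close>, \<open>poincare_box_ge_2\<close>).

  Lower bound. The term \<open>n * d * ln L\<close> is the coupon collector's: from a profile that is \<open>1\<close> on half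
  of the vertices and \<open>-1\<close> on the others, all vertices of one of the halves have to be selected
  (\<open>coupon_collector_lower\<close>). The other terms come from barriers, profiles \<open>\<phi>\<close> with range \<open>[-1, 1]\<close>
  which a single update moves by at most \<open>h\<close>. By the comparison principle, an update gives the
  selected vertex a deviation from \<open>\<phi>\<close> that exceeds the largest one among its neighbors by at most
  \<open>h\<close>. A deviation of size \<open>1/2\<close> therefore needs a chain of \<open>1 / (2 * h)\<close> successive updates at
  adjacent vertices, and with degrees of order \<open>d\<close> such a chain takes time of order \<open>n / (d * h)\<close>
  (\<open>barrier_consensus_lower\<close>). For \<open>p = 2\<close> the update is linear, expectations obey the comparison
  principle themselves, and the time is of order \<open>n / h\<close> (\<open>barrier_consensus_lower_2\<close>). For \<open>p \<ge> 2\<close> the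
  barrier is an average over all axes of a profile with bounded second differences, with \<open>h\<close> of
  order \<open>1 / (d * L\<^sup>2)\<close>; for \<open>p < 2\<close> it depends on one coordinate only, and the \<open>d - 1\<close> transverse
  directions, flat for \<open>\<phi>\<close>, hold a moving vertex back, so that \<open>h\<close> is of order
  \<open>d powr (- 1 / (p - 1)) * L powr (- p / (p - 1))\<close>.
\<close>

section \<open>Signed powers and p-means\<close>

text \<open>Up to the factor \<open>p\<close>, the case \<open>s = p - 1\<close> is the derivative of \<open>\<bar>_\<bar> powr p\<close>; the case
  \<open>s = p / 2\<close> is the odd change of variables that turns \<open>p\<close>-th powers into squares.\<close>

definition signed_powr :: "real \<Rightarrow> real \<Rightarrow> real" where
  "signed_powr s x = sgn x * \<bar>x\<bar> powr s"

lemma signed_powr_zero [simp]: "signed_powr s 0 = 0"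
  by (simp add: signed_powr_def)

lemma signed_powr_minus [simp]: "signed_powr s (- x) = - signed_powr s x"
  by (simp add: signed_powr_def sgn_minus)

lemma signed_powr_nonneg_eq: "0 \<le> x \<Longrightarrow> signed_powr s x = x powr s"
  by (simp add: signed_powr_def sgn_if)

lemma abs_signed_powr [simp]: "\<bar>signed_powr s x\<bar> = \<bar>x\<bar> powr s"
  by (simp add: signed_powr_def abs_mult sgn_if)

lemma signed_powr_mult_self: "signed_powr (p - 1) x * x = \<bar>x\<bar> powr p"
proof (cases "x = 0")
  case False
  have "signed_powr (p - 1) x * x = \<bar>x\<bar> powr (p - 1) * \<bar>x\<bar>"
    by (simp add: signed_powr_def sgn_if)
  also have "\<dots> = \<bar>x\<bar> powr p"
    using False by (simp add: powr_diff)
  finally show ?thesis .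
qed simp

lemma signed_powr_strict_mono:
  assumes "0 < s" "x < y"
  shows "signed_powr s x < signed_powr s y"
proof -
  consider "0 \<le> x" | "x < 0" "0 \<le> y" | "y < 0" by linarith
  then show ?thesis
  proof cases
    case 1
    then show ?thesis using assms by (simp add: signed_powr_nonneg_eq powr_less_mono2)
  next
    case 2
    have "signed_powr s x < 0" using 2 by (simp add: signed_powr_def)
    moreover have "0 \<le> signed_powr s y" using 2 by (simp add: signed_powr_nonneg_eq)
    ultimately show ?thesis by simp
  next
    case 3
    have "(- y) powr s < (- x) powr s" using 3 assms by (intro powr_less_mono2) auto
    then show ?thesis using 3 assms by (simp add: signed_powr_def)
  qed
qed

lemma signed_powr_mono: "0 < s \<Longrightarrow> x \<le> y \<Longrightarrow> signed_powr s x \<le> signed_powr s y"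
  using signed_powr_strict_mono[of s x y] by (cases "x = y") auto

lemma powr_add_le:
  fixes a b s :: real
  assumes "0 < s" "s \<le> 1" "0 \<le> a" "0 \<le> b"
  shows "(a + b) powr s \<le> a powr s + b powr s"
proof (cases "a = 0 \<or> b = 0")
  case True
  then show ?thesis using assms by auto
next
  case False
  then have ab: "0 < a" "0 < b" using assms by auto
  define c where "c = a + b"
  have c: "0 < c" using ab by (simp add: c_def)
  have "x / c \<le> (x / c) powr s" if "0 < x" "x \<le> c" for x
    using powr_mono'[of s 1 "x / c"] that c assms by simp
  from this[of a] this[of b] have "a / c + b / c \<le> (a / c) powr s + (b / c) powr s"
    using ab by (simp add: c_def)
  moreover have "a / c + b / c = 1" using c by (simp add: c_def flip: add_divide_distrib)
  ultimately have "1 \<le> (a powr s + b powr s) / c powr s"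
    using ab c by (simp add: powr_divide add_divide_distrib)
  then show ?thesis using c by (simp add: c_def[symmetric] field_simps)
qed

text \<open>Subadditivity of \<open>x powr s\<close> gives the constant \<open>1\<close> for arguments of equal sign; for opposite
  signs the two powers add up, each being at most \<open>\<bar>a - b\<bar> powr s\<close>.\<close>

lemma signed_powr_holder:
  assumes "0 < s" "s \<le> 1"
  shows "\<bar>signed_powr s a - signed_powr s b\<bar> \<le> 2 * \<bar>a - b\<bar> powr s"
proof -
  have pos: "\<bar>signed_powr s a - signed_powr s b\<bar> \<le> 2 * \<bar>a - b\<bar> powr s" if "b \<le> a" "0 \<le> a" for a b
  proof (cases "0 \<le> b")
    case True
    have "a powr s \<le> b powr s + (a - b) powr s"
      using powr_add_le[of s b "a - b"] assms True that by simp
    moreover have "b powr s \<le> a powr s" using True that assms by (intro powr_mono2) auto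
    moreover have "0 \<le> (a - b) powr s" by simp
    ultimately have "\<bar>a powr s - b powr s\<bar> \<le> 2 * (a - b) powr s" by linarith
    then show ?thesis using True that by (simp add: signed_powr_nonneg_eq)
  next
    case False
    have "a powr s \<le> (a - b) powr s" "(- b) powr s \<le> (a - b) powr s"
      using False that assms by (auto intro!: powr_mono2)
    moreover have "signed_powr s a - signed_powr s b = a powr s + (- b) powr s"
      using False that by (simp add: signed_powr_def sgn_if)
    ultimately show ?thesis using that by simp
  qed
  have pos': "\<bar>signed_powr s a - signed_powr s b\<bar> \<le> 2 * \<bar>a - b\<bar> powr s" if "b \<le> a" for a b
  proof (cases "0 \<le> a")
    case True
    then show ?thesis using pos[OF that] by simp
  next
    case False
    then show ?thesis using pos[of "- a" "- b"] that by (simp add: abs_minus_commute)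
  qed
  show ?thesis using pos'[of b a] pos'[of a b] by (cases "b \<le> a") (auto simp: abs_minus_commute)
qed

lemma continuous_signed_powr: "0 < s \<Longrightarrow> continuous_on UNIV (signed_powr s)"
proof (rule continuous_on_eq_continuous_within[THEN iffD2], safe)
  fix a :: real assume s: "0 < s"
  show "isCont (signed_powr s) a"
  proof (cases "a = 0")
    case True
    have "((\<lambda>x::real. \<bar>x\<bar> powr s) \<longlongrightarrow> 0) (at 0)"
      using s by (intro tendsto_eq_intros tendsto_powr') (auto intro!: tendsto_eq_intros)
    then have "((\<lambda>x. signed_powr s x) \<longlongrightarrow> 0) (at 0)"
      using tendsto_rabs_zero_iff[of "signed_powr s" "at 0"] by simp
    then show ?thesis using True by (simp add: isCont_def)
  next
    case False
    then show ?thesis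
      unfolding signed_powr_def by (intro continuous_intros) auto
  qed
qed

lemma DERIV_abs_powr:
  assumes "1 < p"
  shows "((\<lambda>x. \<bar>x\<bar> powr p) has_real_derivative p * signed_powr (p - 1) x) (at x)"
proof -
  consider "0 < x" | "x < 0" | "x = 0" by linarith
  then show ?thesis
  proof cases
    case 1
    have "((\<lambda>x. x powr p) has_real_derivative p * x powr (p - 1)) (at x)"
      using 1 by (auto intro!: derivative_eq_intros)
    then have "((\<lambda>x. \<bar>x\<bar> powr p) has_real_derivative p * x powr (p - 1)) (at x)"
      by (rule has_field_derivative_transform_within_open[of _ _ _ "{0<..}"]) (use 1 in auto)
    then show ?thesis using 1 by (simp add: signed_powr_nonneg_eq)
  next
    case 2
    have "((\<lambda>x. (- x) powr p) has_real_derivative - (p * (- x) powr (p - 1))) (at x)"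
      using 2 by (auto intro!: derivative_eq_intros)
    then have "((\<lambda>x. \<bar>x\<bar> powr p) has_real_derivative - (p * (- x) powr (p - 1))) (at x)"
      by (rule has_field_derivative_transform_within_open[of _ _ _ "{..<0}"]) (use 2 in auto)
    then show ?thesis using 2 by (simp add: signed_powr_def)
  next
    case 3
    have "((\<lambda>h. signed_powr (p - 1) h) \<longlongrightarrow> signed_powr (p - 1) 0) (at 0)"
      using continuous_signed_powr[of "p - 1"] assms continuous_on_eq_continuous_at[of UNIV]
      by (metis UNIV_I isCont_def continuous_on_eq_continuous_at open_UNIV diff_gt_0_iff_gt)
    moreover have "signed_powr (p - 1) h = \<bar>h\<bar> powr p / h" if "h \<noteq> 0" for h
      using signed_powr_mult_self[of p h] that by (simp add: field_simps)
    ultimately have "((\<lambda>h. \<bar>h\<bar> powr p / h) \<longlongrightarrow> 0) (at 0)"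
      by (subst tendsto_cong[where g = "signed_powr (p - 1)"]) (auto simp: eventually_at_filter)
    then show ?thesis using 3 by (simp add: DERIV_def)
  qed
qed

lemma abs_powr_MVT:
  assumes "1 < p" "a \<noteq> b"
  obtains z where "min a b < z" "z < max a b"
    "\<bar>b\<bar> powr p - \<bar>a\<bar> powr p = (b - a) * (p * signed_powr (p - 1) z)"
proof (cases "a < b")
  case True
  then obtain z where "a < z" "z < b"
    "\<bar>b\<bar> powr p - \<bar>a\<bar> powr p = (b - a) * (p * signed_powr (p - 1) z)"
    using MVT2[OF True DERIV_abs_powr[OF assms(1)]] by blast
  then show ?thesis using True that by simp
next
  case False
  then have "b < a" using assms by simp
  then obtain z where "b < z" "z < a"
    "\<bar>a\<bar> powr p - \<bar>b\<bar> powr p = (a - b) * (p * signed_powr (p - 1) z)"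
    using MVT2[OF \<open>b < a\<close> DERIV_abs_powr[OF assms(1)]] by blast
  then show ?thesis using \<open>b < a\<close> that by (simp add: algebra_simps)
qed

text \<open>Strict convexity in the form that identifies the zero of the derivative of a \<open>p\<close>-energy as its
  only minimizer.\<close>

lemma abs_powr_tangent_strict:
  assumes "1 < p" "a \<noteq> b"
  shows "\<bar>a\<bar> powr p + p * signed_powr (p - 1) a * (b - a) < \<bar>b\<bar> powr p"
proof -
  obtain z where z: "min a b < z" "z < max a b"
    "\<bar>b\<bar> powr p - \<bar>a\<bar> powr p = (b - a) * (p * signed_powr (p - 1) z)"
    using abs_powr_MVT[OF assms] .
  have "0 < (b - a) * (signed_powr (p - 1) z - signed_powr (p - 1) a)"
  proof (cases "a < b")
    case True
    then show ?thesis using z signed_powr_strict_mono[of "p - 1" a z] assms by simp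
  next
    case False
    then show ?thesis using z signed_powr_strict_mono[of "p - 1" z a] assms
      by (intro mult_neg_neg) auto
  qed
  then have "0 < p * ((b - a) * (signed_powr (p - 1) z - signed_powr (p - 1) a))" using assms by simp
  then show ?thesis using z(3) by (simp add: algebra_simps)
qed

lemma abs_powr_tangent:
  assumes "1 < p"
  shows "\<bar>a\<bar> powr p + p * signed_powr (p - 1) a * (b - a) \<le> \<bar>b\<bar> powr p"
  using abs_powr_tangent_strict[OF assms, of a b] by (cases "a = b") auto

text \<open>The derivative is at most \<open>s * c powr (s - 1)\<close> on \<open>[-c, c]\<close>. The value \<open>c = 0\<close>, where
  \<open>0 powr 0 = 0\<close> would spoil the constant for \<open>s = 1\<close>, is harmless because it forces \<open>a = b\<close>.\<close>

lemma signed_powr_lipschitz: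
  assumes "1 \<le> s" "\<bar>a\<bar> \<le> c" "\<bar>b\<bar> \<le> c"
  shows "\<bar>signed_powr s a - signed_powr s b\<bar> \<le> s * c powr (s - 1) * \<bar>a - b\<bar>"
proof (cases "s = 1")
  case True
  then show ?thesis using assms by (cases "c = 0") (auto simp: signed_powr_def mult_sgn_abs)
next
  case False
  then have s: "1 < s" using assms by simp
  have same: "\<bar>signed_powr s a - signed_powr s b\<bar> \<le> s * c powr (s - 1) * \<bar>a - b\<bar>"
    if "0 \<le> b" "b \<le> a" "a \<le> c" for a b
  proof -
    have "a powr s + s * a powr (s - 1) * (b - a) \<le> b powr s"
      using abs_powr_tangent[OF s, of a b] that by (simp add: signed_powr_nonneg_eq)
    moreover have "b powr s \<le> a powr s" using that s by (intro powr_mono2) auto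
    moreover have "a powr (s - 1) * (a - b) \<le> c powr (s - 1) * (a - b)"
      using that s by (intro mult_right_mono powr_mono2) auto
    then have "s * (a powr (s - 1) * (a - b)) \<le> s * (c powr (s - 1) * (a - b))"
      using s by (intro mult_left_mono) auto
    ultimately have "\<bar>a powr s - b powr s\<bar> \<le> s * c powr (s - 1) * (a - b)"
      by (simp add: algebra_simps)
    then show ?thesis using that by (simp add: signed_powr_nonneg_eq)
  qed
  have opp: "\<bar>signed_powr s a - signed_powr s b\<bar> \<le> s * c powr (s - 1) * \<bar>a - b\<bar>"
    if "b \<le> 0" "0 \<le> a" "a \<le> c" "- b \<le> c" for a b
  proof -
    have *: "x powr s \<le> c powr (s - 1) * x" if "0 \<le> x" "x \<le> c" for x
    proof -
      have "x powr s = x powr (s - 1) * x"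
        using that by (cases "x = 0") (auto simp: powr_diff)
      also have "\<dots> \<le> c powr (s - 1) * x"
        using that s by (intro mult_right_mono powr_mono2) auto
      finally show ?thesis .
    qed
    have "\<bar>signed_powr s a - signed_powr s b\<bar> = a powr s + (- b) powr s"
      using that by (cases "b = 0") (auto simp: signed_powr_def sgn_if)
    also have "\<dots> \<le> 1 * (c powr (s - 1) * (a - b))"
      using *[of a] *[of "- b"] that by (simp add: algebra_simps)
    also have "\<dots> \<le> s * (c powr (s - 1) * (a - b))"
      using that s by (intro mult_right_mono) auto
    finally show ?thesis using that by simp
  qed
  have pos: "\<bar>signed_powr s a - signed_powr s b\<bar> \<le> s * c powr (s - 1) * \<bar>a - b\<bar>"
    if "\<bar>a\<bar> \<le> c" "\<bar>b\<bar> \<le> c" "b \<le> a" for a b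
  proof -
    consider "0 \<le> b" | "b \<le> 0" "0 \<le> a" | "a \<le> 0" using that by linarith
    then show ?thesis
    proof cases
      case 1 then show ?thesis using same[of b a] that by simp
    next
      case 2 then show ?thesis using opp[of b a] that by simp
    next
      case 3 then show ?thesis using same[of "- a" "- b"] that by (simp add: abs_minus_commute)
    qed
  qed
  show ?thesis using pos[of a b] pos[of b a] assms
    by (cases "b \<le> a") (auto simp: abs_minus_commute)
qed

text \<open>The tangent lines at the mean of the \<open>y i\<close> sum up to this form of Jensen's inequality.\<close>

lemma power_mean_le:
  fixes y :: "'i \<Rightarrow> real"
  assumes "1 < p" "finite I"
  shows "\<bar>\<Sum>i\<in>I. y i\<bar> powr p \<le> real (card I) powr (p - 1) * (\<Sum>i\<in>I. \<bar>y i\<bar> powr p)"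
proof (cases "I = {}")
  case False
  define k where "k = real (card I)"
  have k: "0 < k" using False assms by (simp add: k_def card_gt_0_iff)
  define a where "a = (\<Sum>i\<in>I. y i) / k"
  have "(\<Sum>i\<in>I. \<bar>a\<bar> powr p + p * signed_powr (p - 1) a * (y i - a)) \<le> (\<Sum>i\<in>I. \<bar>y i\<bar> powr p)"
    by (intro sum_mono abs_powr_tangent assms)
  also have "(\<Sum>i\<in>I. \<bar>a\<bar> powr p + p * signed_powr (p - 1) a * (y i - a))
      = k * \<bar>a\<bar> powr p + p * signed_powr (p - 1) a * ((\<Sum>i\<in>I. y i) - k * a)"
    by (simp add: sum.distrib k_def sum_distrib_left[symmetric] sum_subtractf)
  also have "\<dots> = k * \<bar>a\<bar> powr p" using k by (simp add: a_def)
  finally have "k powr (p - 1) * (k * \<bar>a\<bar> powr p) \<le> k powr (p - 1) * (\<Sum>i\<in>I. \<bar>y i\<bar> powr p)"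
    by (intro mult_left_mono) auto
  also have "k powr (p - 1) * (k * \<bar>a\<bar> powr p) = (k * \<bar>a\<bar>) powr p"
    using k by (simp add: powr_mult powr_diff)
  also have "k * \<bar>a\<bar> = \<bar>\<Sum>i\<in>I. y i\<bar>" using k by (simp add: a_def)
  finally show ?thesis by (simp add: k_def)
qed simp

lemma mult_le_abs_mult:
  fixes x y z :: real
  shows "\<bar>y\<bar> \<le> z \<Longrightarrow> x * y \<le> \<bar>x\<bar> * z"
  using mult_left_mono[of "\<bar>y\<bar>" z "\<bar>x\<bar>"] abs_ge_self[of "x * y"] by (simp add: abs_mult)

text \<open>The remainder of the first-order expansion is governed by the modulus of continuity of the
  derivative, which is \<open>p - 1\<close>-Hoelder for \<open>p \<le> 2\<close> and locally Lipschitz for \<open>p \<ge> 2\<close>. The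
  difference between these two remainders is the difference between the two upper rates.\<close>

lemma abs_powr_diff_upper_le_2:
  assumes "1 < p" "p \<le> 2"
  shows "\<bar>a - h\<bar> powr p \<le> \<bar>a\<bar> powr p - p * signed_powr (p - 1) a * h + 2 * p * \<bar>h\<bar> powr p"
proof (cases "h = 0")
  case False
  then obtain z where z: "min a (a - h) < z" "z < max a (a - h)"
    "\<bar>a - h\<bar> powr p - \<bar>a\<bar> powr p = (a - h - a) * (p * signed_powr (p - 1) z)"
    using abs_powr_MVT[of p a "a - h"] assms by auto
  have "\<bar>signed_powr (p - 1) a - signed_powr (p - 1) z\<bar> \<le> 2 * \<bar>a - z\<bar> powr (p - 1)"
    using signed_powr_holder[of "p - 1" a z] assms by simp
  also have "\<dots> \<le> 2 * \<bar>h\<bar> powr (p - 1)"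
    using z assms by (intro mult_left_mono powr_mono2) auto
  finally have "h * (signed_powr (p - 1) a - signed_powr (p - 1) z) \<le> \<bar>h\<bar> * (2 * \<bar>h\<bar> powr (p - 1))"
    by (rule mult_le_abs_mult)
  also have "\<bar>h\<bar> * (2 * \<bar>h\<bar> powr (p - 1)) = 2 * \<bar>h\<bar> powr p"
    using False by (simp add: powr_diff)
  finally have "p * (h * (signed_powr (p - 1) a - signed_powr (p - 1) z)) \<le> p * (2 * \<bar>h\<bar> powr p)"
    using assms by (intro mult_left_mono) auto
  then show ?thesis using z(3) by (simp add: algebra_simps)
qed simp

lemma powr_add_le_const:
  fixes a b s :: real
  assumes "0 \<le> s" "0 \<le> a" "0 \<le> b"
  shows "(a + b) powr s \<le> 2 powr s * (a powr s + b powr s)"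
proof -
  have "(a + b) powr s \<le> (2 * max a b) powr s" using assms by (intro powr_mono2) auto
  also have "\<dots> = 2 powr s * (max a b) powr s" using assms by (simp add: powr_mult)
  also have "\<dots> \<le> 2 powr s * (a powr s + b powr s)"
    by (intro mult_left_mono) (auto simp: max_def)
  finally show ?thesis .
qed

lemma abs_powr_diff_upper_ge_2:
  assumes "2 \<le> p"
  shows "\<bar>a - h\<bar> powr p \<le> \<bar>a\<bar> powr p - p * signed_powr (p - 1) a * h
    + p * (p - 1) * 2 powr (p - 2) * (\<bar>a\<bar> powr (p - 2) * h\<^sup>2 + \<bar>h\<bar> powr p)"
proof (cases "h = 0")
  case False
  then obtain z where z: "min a (a - h) < z" "z < max a (a - h)"
    "\<bar>a - h\<bar> powr p - \<bar>a\<bar> powr p = (a - h - a) * (p * signed_powr (p - 1) z)"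
    using abs_powr_MVT[of p a "a - h"] assms by auto
  have "\<bar>signed_powr (p - 1) a - signed_powr (p - 1) z\<bar> \<le> (p - 1) * (\<bar>a\<bar> + \<bar>h\<bar>) powr (p - 1 - 1) * \<bar>a - z\<bar>"
    using z assms by (intro signed_powr_lipschitz) auto
  also have "\<dots> \<le> (p - 1) * (\<bar>a\<bar> + \<bar>h\<bar>) powr (p - 1 - 1) * \<bar>h\<bar>"
    using z assms by (intro mult_left_mono mult_nonneg_nonneg) auto
  also have "\<dots> = (p - 1) * ((\<bar>a\<bar> + \<bar>h\<bar>) powr (p - 2) * \<bar>h\<bar>)" by (simp add: algebra_simps)
  also have "\<dots> \<le> (p - 1) * (2 powr (p - 2) * (\<bar>a\<bar> powr (p - 2) + \<bar>h\<bar> powr (p - 2)) * \<bar>h\<bar>)"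
    using assms by (intro mult_left_mono mult_right_mono powr_add_le_const) auto
  finally have "h * (signed_powr (p - 1) a - signed_powr (p - 1) z) \<le>
      \<bar>h\<bar> * ((p - 1) * (2 powr (p - 2) * (\<bar>a\<bar> powr (p - 2) + \<bar>h\<bar> powr (p - 2)) * \<bar>h\<bar>))"
    by (rule mult_le_abs_mult)
  also have "\<dots> = (p - 1) * 2 powr (p - 2) * (\<bar>a\<bar> powr (p - 2) * \<bar>h\<bar>\<^sup>2 + \<bar>h\<bar> powr (p - 2) * \<bar>h\<bar>\<^sup>2)"
    unfolding power2_eq_square by (simp only: algebra_simps)
  also have "\<bar>h\<bar> powr (p - 2) * \<bar>h\<bar>\<^sup>2 = \<bar>h\<bar> powr p"
    using False by (simp add: powr_diff)
  finally have "p * (h * (signed_powr (p - 1) a - signed_powr (p - 1) z)) \<le>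
     p * ((p - 1) * 2 powr (p - 2) * (\<bar>a\<bar> powr (p - 2) * \<bar>h\<bar>\<^sup>2 + \<bar>h\<bar> powr p))"
    using assms by (intro mult_left_mono) auto
  then show ?thesis using z(3) by (simp add: algebra_simps)
qed simp

lemma powr_square_young:
  fixes p x y :: real
  assumes "2 \<le> p" "0 \<le> x" "0 \<le> y"
  shows "x powr (p - 2) * y\<^sup>2 \<le> x powr p + y powr p"
proof -
  have sq: "z powr (p - 2) * z\<^sup>2 = z powr p" if "0 \<le> z" for z :: real
    using that by (cases "z = 0") (auto simp: powr_diff)
  show ?thesis
  proof (cases "x \<le> y")
    case True
    have "x powr (p - 2) * y\<^sup>2 \<le> y powr (p - 2) * y\<^sup>2"
      using True assms by (intro mult_right_mono powr_mono2) auto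
    then show ?thesis using sq[of y] assms by (simp add: add_increasing)
  next
    case False
    have "x powr (p - 2) * y\<^sup>2 \<le> x powr (p - 2) * x\<^sup>2"
      using False assms by (intro mult_left_mono power_mono) auto
    then show ?thesis using sq[of x] assms by (simp add: add_increasing2)
  qed
qed

text \<open>Young's inequality with a free scale \<open>l\<close>. It separates the mixed products that occur for
  \<open>p \<ge> 2\<close>; the scale is later set to the Poincare length or its inverse.\<close>

lemma scaled_young:
  fixes p l x y :: real
  assumes "2 \<le> p" "0 < l"
  shows "\<bar>x\<bar> powr (p - 2) * y\<^sup>2 \<le> (\<bar>x\<bar> powr p + l powr p * \<bar>y\<bar> powr p) / l\<^sup>2"
proof -
  have "\<bar>x\<bar> powr (p - 2) * (l * \<bar>y\<bar>)\<^sup>2 \<le> \<bar>x\<bar> powr p + (l * \<bar>y\<bar>) powr p"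
    using assms by (intro powr_square_young) auto
  then show ?thesis using assms by (simp add: powr_mult power_mult_distrib field_simps)
qed

text \<open>The function \<open>x \<mapsto> \<Sum>i\<in>I. signed_powr (p - 1) (x - y i)\<close> changes sign between the least and the
  largest \<open>y i\<close>, so it has a zero, and by the strict tangent inequality a zero is strictly better
  than every other point. This removes the definite description from all later arguments.\<close>

lemma p_mean_root_and_minimizer:
  fixes y :: "'i \<Rightarrow> real"
  assumes p: "1 < p" and fin: "finite I" and ne: "I \<noteq> {}"
  shows sum_signed_powr_p_mean: "(\<Sum>i\<in>I. signed_powr (p - 1) (p_mean p I y - y i)) = 0"
    and p_mean_minimal: "(\<Sum>i\<in>I. \<bar>p_mean p I y - y i\<bar> powr p) \<le> (\<Sum>i\<in>I. \<bar>x - y i\<bar> powr p)"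
proof -
  define J where "J x = (\<Sum>i\<in>I. signed_powr (p - 1) (x - y i))" for x
  define F where "F x = (\<Sum>i\<in>I. \<bar>x - y i\<bar> powr p)" for x
  have contJ: "continuous_on UNIV J"
    unfolding J_def using p
    by (intro continuous_on_sum continuous_on_compose2[OF continuous_signed_powr[of "p - 1"]] continuous_intros) auto
  define lo hi where "lo = Min (y ` I)" and "hi = Max (y ` I)"
  have "lo \<le> hi"
    using fin ne by (auto simp: lo_def hi_def intro: order.trans[OF Min.coboundedI Max.coboundedI])
  moreover have "J lo \<le> 0" unfolding J_def
  proof (rule sum_nonpos)
    fix i assume "i \<in> I"
    then have "lo - y i \<le> 0" using fin by (simp add: lo_def)
    from signed_powr_mono[OF _ this, of "p - 1"] p show "signed_powr (p - 1) (lo - y i) \<le> 0" by simp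
  qed
  moreover have "0 \<le> J hi" unfolding J_def
  proof (rule sum_nonneg)
    fix i assume "i \<in> I"
    then have "0 \<le> hi - y i" using fin by (simp add: hi_def)
    from signed_powr_mono[OF _ this, of "p - 1"] p show "0 \<le> signed_powr (p - 1) (hi - y i)" by simp
  qed
  ultimately obtain m where m: "J m = 0"
    using IVT'[of J lo 0 hi] continuous_on_subset[OF contJ] by auto
  have less: "F m < F x" if "x \<noteq> m" for x
  proof -
    have "(\<Sum>i\<in>I. \<bar>m - y i\<bar> powr p + p * signed_powr (p - 1) (m - y i) * (x - m)) < F x"
      unfolding F_def using ne fin that p
      by (intro sum_strict_mono) (use abs_powr_tangent_strict[of p "m - y i" "x - y i" for i] in auto)
    also have "(\<Sum>i\<in>I. \<bar>m - y i\<bar> powr p + p * signed_powr (p - 1) (m - y i) * (x - m))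
        = F m + p * J m * (x - m)"
      by (simp add: F_def J_def sum.distrib sum_distrib_left sum_distrib_right)
    finally show ?thesis using m by simp
  qed
  have "p_mean p I y = m"
    unfolding p_mean_def F_def[symmetric]
  proof (rule the_equality)
    show "is_arg_min F (\<lambda>_. True) m"
      using less by (force simp: is_arg_min_def not_less)
    show "x = m" if "is_arg_min F (\<lambda>_. True) x" for x
      using that less[of x] by (auto simp: is_arg_min_def)
  qed
  with m less[of x] show "(\<Sum>i\<in>I. signed_powr (p - 1) (p_mean p I y - y i)) = 0"
    "(\<Sum>i\<in>I. \<bar>p_mean p I y - y i\<bar> powr p) \<le> (\<Sum>i\<in>I. \<bar>x - y i\<bar> powr p)"
    by (auto simp: J_def F_def intro: less_imp_le) 
qed

text \<open>The comparison principle. A point \<open>x\<close> at which the derivative for the reference family \<open>z\<close> is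
  nonnegative lies above the \<open>p\<close>-mean of \<open>z\<close>, and the \<open>p\<close>-mean is monotone and commutes with adding
  constants.\<close>

lemma p_mean_upper:
  assumes p: "1 < p" and fin: "finite I" and ne: "I \<noteq> {}"
    and le: "\<And>i. i \<in> I \<Longrightarrow> y i \<le> z i + s"
    and bal: "0 \<le> (\<Sum>i\<in>I. signed_powr (p - 1) (x - z i))"
  shows "p_mean p I y \<le> x + s"
proof (rule ccontr)
  assume neg: "\<not> ?thesis"
  have "(\<Sum>i\<in>I. signed_powr (p - 1) (x - z i)) < (\<Sum>i\<in>I. signed_powr (p - 1) (p_mean p I y - y i))"
  proof (intro sum_strict_mono signed_powr_strict_mono fin ne)
    fix i assume "i \<in> I"
    from le[OF this] neg show "x - z i < p_mean p I y - y i" by linarith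
  qed (use p in simp)
  then show False using sum_signed_powr_p_mean[OF p fin ne, of y] bal by simp
qed

lemma p_mean_lower:
  assumes p: "1 < p" and fin: "finite I" and ne: "I \<noteq> {}"
    and le: "\<And>i. i \<in> I \<Longrightarrow> z i - s \<le> y i"
    and bal: "(\<Sum>i\<in>I. signed_powr (p - 1) (x - z i)) \<le> 0"
  shows "x - s \<le> p_mean p I y"
proof (rule ccontr)
  assume neg: "\<not> ?thesis"
  have "(\<Sum>i\<in>I. signed_powr (p - 1) (p_mean p I y - y i)) < (\<Sum>i\<in>I. signed_powr (p - 1) (x - z i))"
  proof (intro sum_strict_mono signed_powr_strict_mono fin ne)
    fix i assume "i \<in> I"
    from le[OF this] neg show "p_mean p I y - y i < x - z i" by linarith
  qed (use p in simp)
  then show False using sum_signed_powr_p_mean[OF p fin ne, of y] bal by simp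
qed

lemma p_mean_between:
  assumes "1 < p" "finite I" "I \<noteq> {}" "\<And>i. i \<in> I \<Longrightarrow> y i \<in> {a..b}"
  shows "p_mean p I y \<in> {a..b}"
  using p_mean_upper[OF assms(1-3), of y "\<lambda>_. b" 0 b]
    p_mean_lower[OF assms(1-3), of "\<lambda>_. a" 0 y a] assms(4) by auto

lemma p_mean_2:
  fixes y :: "'i \<Rightarrow> real"
  assumes "finite I" "I \<noteq> {}"
  shows "p_mean 2 I y = (\<Sum>i\<in>I. y i) / card I"
proof -
  have "signed_powr 1 x = x" for x by (simp add: signed_powr_def mult_sgn_abs)
  then have "(\<Sum>i\<in>I. p_mean 2 I y - y i) = 0"
    using sum_signed_powr_p_mean[of 2 I y] assms by simp
  then show ?thesis using assms by (simp add: sum_subtractf field_simps)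
qed

section \<open>Expectations along a random run\<close>

text \<open>The state space is arbitrary: besides profiles, the set of vertices that have not been selected
  yet is followed in this way.\<close>

primrec run :: "('s \<Rightarrow> 'a \<Rightarrow> 's) \<Rightarrow> 's \<Rightarrow> (nat \<Rightarrow> 'a) \<Rightarrow> nat \<Rightarrow> 's" where
  "run step s U 0 = s"
| "run step s U (Suc t) = step (run step s U t) (U t)"

text \<open>The expectation of \<open>g\<close> after \<open>t\<close> uniformly chosen steps, by conditioning on the first one. As
  iterated finite averages, expectations can be estimated without any measurability questions.\<close>

primrec run_mean :: "('s \<Rightarrow> 'a \<Rightarrow> 's) \<Rightarrow> 'a set \<Rightarrow> nat \<Rightarrow> ('s \<Rightarrow> real) \<Rightarrow> 's \<Rightarrow> real" where
  "run_mean step V 0 g s = g s"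
| "run_mean step V (Suc t) g s = (\<Sum>u\<in>V. run_mean step V t g (step s u)) / card V"

lemma p_dynamics_eq_run: "p_dynamics p V adj f U t = run (p_update p V adj) f U t"
  by (induction t) auto

lemma run_Suc_first: "run step s U (Suc t) = run step (step s (U 0)) (\<lambda>i. U (Suc i)) t"
  by (induction t) auto

lemma run_mean_mono:
  assumes "\<And>s u. s \<in> I \<Longrightarrow> u \<in> V \<Longrightarrow> step s u \<in> I" "s \<in> I"
    and "\<And>s. s \<in> I \<Longrightarrow> g s \<le> h s"
  shows "run_mean step V t g s \<le> run_mean step V t h s"
  using assms(2)
proof (induction t arbitrary: s)
  case (Suc t)
  then show ?case by (auto intro!: divide_right_mono sum_mono assms(1))
qed (simp add: assms)

lemma run_mean_nonneg:
  assumes "\<And>s. 0 \<le> g s"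
  shows "0 \<le> run_mean step V t g s"
  by (induction t arbitrary: s) (auto intro!: divide_nonneg_nonneg sum_nonneg assms)

lemma run_mean_const: "finite V \<Longrightarrow> V \<noteq> {} \<Longrightarrow> run_mean step V t (\<lambda>_. c) s = c"
  by (induction t arbitrary: s) auto

lemma run_mean_add:
  "run_mean step V t (\<lambda>s. g s + h s) s = run_mean step V t g s + run_mean step V t h s"
  by (induction t arbitrary: s) (auto simp: sum.distrib add_divide_distrib)

lemma run_mean_cmult: "run_mean step V t (\<lambda>s. c * g s) s = c * run_mean step V t g s"
  by (induction t arbitrary: s) (auto simp: sum_distrib_left)

lemma run_mean_sum:
  "run_mean step V t (\<lambda>s. \<Sum>x\<in>A. g x s) s = (\<Sum>x\<in>A. run_mean step V t (g x) s)"
proof (induction t arbitrary: s)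
  case (Suc t)
  then show ?case using sum.swap[of _ A V] by (auto simp: sum_divide_distrib)
qed simp

text \<open>Conditioning on the last step, which is what estimates for a single step need.\<close>

lemma run_mean_Suc_last:
  "run_mean step V (Suc t) g s = run_mean step V t (\<lambda>s. (\<Sum>u\<in>V. g (step s u)) / card V) s"
  by (induction t arbitrary: s) auto

lemma run_mean_geometric:
  assumes inv: "\<And>s u. s \<in> I \<Longrightarrow> u \<in> V \<Longrightarrow> step s u \<in> I" and s: "s \<in> I"
    and r: "0 \<le> r" and step: "\<And>s. s \<in> I \<Longrightarrow> (\<Sum>u\<in>V. g (step s u)) / card V \<le> r * g s"
  shows "run_mean step V t g s \<le> r ^ t * g s"
proof (induction t)
  case (Suc t)
  have "run_mean step V (Suc t) g s \<le> run_mean step V t (\<lambda>s. r * g s) s"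
    unfolding run_mean_Suc_last by (rule run_mean_mono[where I = I]) (use assms in auto)
  also have "\<dots> = r * run_mean step V t g s" by (rule run_mean_cmult)
  also have "\<dots> \<le> r * (r ^ t * g s)" using Suc r by (rule mult_left_mono)
  finally show ?case by simp
qed simp

lemma run_mean_markov:
  assumes inv: "\<And>s u. s \<in> I \<Longrightarrow> u \<in> V \<Longrightarrow> step s u \<in> I" and s: "s \<in> I"
    and nonneg: "\<And>s. s \<in> I \<Longrightarrow> 0 \<le> g s" and "0 < c"
    and P: "\<And>s. s \<in> I \<Longrightarrow> P s \<Longrightarrow> c \<le> g s"
  shows "run_mean step V t (\<lambda>s. of_bool (P s)) s \<le> run_mean step V t g s / c"
proof -
  have "run_mean step V t (\<lambda>s. of_bool (P s)) s \<le> run_mean step V t (\<lambda>s. (1 / c) * g s) s"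
    using assms by (intro run_mean_mono[where I = I]) (auto simp: of_bool_def)
  also have "\<dots> = (1 / c) * run_mean step V t g s" by (rule run_mean_cmult)
  finally show ?thesis by simp
qed

lemma run_mean_not:
  assumes "finite V" "V \<noteq> {}"
  shows "run_mean step V t (\<lambda>s. of_bool (\<not> P s)) s = 1 - run_mean step V t (\<lambda>s. of_bool (P s)) s"
proof -
  have "run_mean step V t (\<lambda>s. of_bool (\<not> P s) + of_bool (P s)) s = run_mean step V t (\<lambda>_. 1) s"
    by (rule arg_cong[where f = "\<lambda>g. run_mean step V t g s"]) auto
  then show ?thesis by (simp add: run_mean_add run_mean_const assms)
qed

lemma space_uniform_seq: "space (uniform_seq V) = UNIV \<rightarrow>\<^sub>E V"
  by (simp add: uniform_seq_def space_PiM space_uniform_count_measure)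

lemma sets_uniform_seq: "sets (uniform_seq V) = sets (Pi\<^sub>M UNIV (\<lambda>_. count_space V))"
  unfolding uniform_seq_def by (rule sets_PiM_cong) (auto simp: sets_uniform_count_measure)

text \<open>Given the first coordinate, which has finitely many values, the run depends on the shifted
  sequence only. So measurability needs no structure on the state space.\<close>

lemma measurable_run:
  fixes F :: "'s \<Rightarrow> ennreal"
  assumes "finite V"
  shows "(\<lambda>U. F (run step s U t)) \<in> borel_measurable (uniform_seq V)"
proof (induction t arbitrary: s)
  case (Suc t)
  have shift: "(\<lambda>U i. U (Suc i)) \<in> measurable (uniform_seq V) (uniform_seq V)"
    unfolding measurable_cong_sets[OF sets_uniform_seq sets_uniform_seq]
    by (rule measurable_PiM_single') (auto simp: space_PiM)
  have first: "(\<lambda>U. U 0) \<in> measurable (uniform_seq V) (count_space V)"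
    unfolding measurable_cong_sets[OF sets_uniform_seq refl]
    by (rule measurable_component_singleton) auto
  show ?case
    unfolding run_Suc_first
    by (rule measurable_compose_countable'[OF measurable_compose[OF shift Suc] first])
      (use assms in \<open>auto intro: countable_finite\<close>)
qed simp

text \<open>Putting an independent uniform vertex in front of a uniform sequence gives a uniform sequence,
  which is the recursion that defines \<open>run_mean\<close>.\<close>

lemma nn_integral_run:
  assumes V: "finite V" "V \<noteq> {}" and g: "\<And>s. 0 \<le> g s"
  shows "(\<integral>\<^sup>+ U. ennreal (g (run step s U t)) \<partial>uniform_seq V) = ennreal (run_mean step V t g s)"
proof (induction t arbitrary: s)
  interpret prob_space "uniform_count_measure V"
    using V by (rule prob_space_uniform_count_measure)
  interpret S: sequence_space "uniform_count_measure V" ..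
  have S_eq: "S.S = uniform_seq V" by (simp add: uniform_seq_def)
  have emeasure: "emeasure (uniform_seq V) (space (uniform_seq V)) = 1"
    using S.P.emeasure_space_1 by (simp add: S_eq)
  {
    case 0
    show ?case using emeasure by simp
  next
    case (Suc t)
    define f where "f = (\<lambda>U. ennreal (g (run step s U (Suc t))))"
    have [measurable]: "f \<in> borel_measurable S.S"
      unfolding S_eq f_def by (rule measurable_run[OF V(1)])
    have "(\<integral>\<^sup>+ U. f U \<partial>S.S)
      = (\<integral>\<^sup>+ z. f ((\<lambda>(x, \<omega>). case_nat x \<omega>) z) \<partial>(uniform_count_measure V \<Otimes>\<^sub>M S.S))"
      by (subst S.PiM_iter[symmetric]) (simp add: nn_integral_distr)
    also have "\<dots> = (\<integral>\<^sup>+ x. \<integral>\<^sup>+ U. f ((\<lambda>(x, \<omega>). case_nat x \<omega>) (x, U)) \<partial>S.S \<partial>uniform_count_measure V)"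
      by (subst S.nn_integral_fst) simp_all
    finally have "(\<integral>\<^sup>+ U. ennreal (g (run step s U (Suc t))) \<partial>uniform_seq V)
      = (\<integral>\<^sup>+ x. \<integral>\<^sup>+ U. ennreal (g (run step s (case_nat x U) (Suc t)))
            \<partial>uniform_seq V \<partial>uniform_count_measure V)"
      by (simp add: S_eq f_def del: run.simps)
    also have "\<dots> = (\<integral>\<^sup>+ x. ennreal (run_mean step V t g (step s x)) \<partial>uniform_count_measure V)"
      unfolding run_Suc_first by (simp add: Suc)
    also have "\<dots> = (\<Sum>u\<in>V. ennreal (run_mean step V t g (step s u)) * ennreal (1 / card V))"
      unfolding uniform_count_measure_def using V
      by (subst nn_integral_point_measure_finite) (auto simp: mult.commute)
    also have "\<dots> = ennreal (run_mean step V (Suc t) g s)"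
      using V by (simp add: run_mean_nonneg g sum_distrib_right[symmetric] ennreal_mult'[symmetric] sum_nonneg divide_inverse)
    finally show ?case .
  }
qed

text \<open>All indices below the infimum are outside \<open>T\<close>; for empty \<open>T\<close> both sides are infinite.\<close>

lemma ennreal_of_enat_Inf_le:
  fixes T :: "nat set"
  shows "ennreal_of_enat (Inf (enat ` T)) \<le> (\<Sum>t. ennreal (of_bool (t \<notin> T)))"
proof -
  have le: "of_nat N \<le> (\<Sum>t. ennreal (of_bool (t \<notin> T)))" if "enat N \<le> Inf (enat ` T)" for N
  proof -
    have "t \<notin> T" if "t < N" for t
    proof
      assume "t \<in> T"
      then have "Inf (enat ` T) \<le> enat t" by (intro Inf_lower imageI)
      with \<open>enat N \<le> Inf (enat ` T)\<close> have "enat N \<le> enat t" by (rule order_trans)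
      then show False using that by simp
    qed
    then have "(\<Sum>t<N. ennreal (of_bool (t \<notin> T))) = (\<Sum>t<N. 1)"
      by (intro sum.cong) auto
    then have "of_nat N = (\<Sum>t<N. ennreal (of_bool (t \<notin> T)))" by simp
    also have "\<dots> \<le> (\<Sum>t. ennreal (of_bool (t \<notin> T)))" by (intro sum_le_suminf) auto
    finally show ?thesis .
  qed
  show ?thesis
  proof (cases "Inf (enat ` T)")
    case (enat N)
    have "of_nat N \<le> (\<Sum>t. ennreal (of_bool (t \<notin> T)))" by (rule le) (simp only: enat order.refl)
    then show ?thesis unfolding enat ennreal_of_enat_enat .
  next
    case infinity
    then have "of_nat N \<le> (\<Sum>t. ennreal (of_bool (t \<notin> T)))" for N
      by (intro le) (simp only: infinity enat_ord_simps)
    then have "(SUP N. of_nat N) \<le> (\<Sum>t. ennreal (of_bool (t \<notin> T)))" by (intro SUP_least)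
    then show ?thesis unfolding ennreal_SUP_of_nat_eq_top infinity ennreal_of_enat_infty infinity_ennreal_def .
  qed
qed

lemma expected_consensus_time_le:
  assumes V: "finite V" "V \<noteq> {}"
  shows "expected_consensus_time p V adj \<epsilon> f0
    \<le> (\<Sum>t. ennreal (run_mean (p_update p V adj) V t (\<lambda>f. of_bool (\<epsilon> < osc V f)) f0))"
proof -
  have "expected_consensus_time p V adj \<epsilon> f0
      \<le> (\<integral>\<^sup>+ U. (\<Sum>t. ennreal (of_bool (\<epsilon> < osc V (run (p_update p V adj) f0 U t)))) \<partial>uniform_seq V)"
    unfolding expected_consensus_time_def consensus_time_def p_dynamics_eq_run
    by (intro nn_integral_mono order_trans[OF ennreal_of_enat_Inf_le]) (simp add: not_le)
  also have "\<dots> = (\<Sum>t. \<integral>\<^sup>+ U. ennreal (of_bool (\<epsilon> < osc V (run (p_update p V adj) f0 U t))) \<partial>uniform_seq V)"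
    using measurable_run[OF V(1), of "\<lambda>f. ennreal (of_bool (\<epsilon> < osc V f))"]
    by (intro nn_integral_suminf) auto
  also have "\<dots> = (\<Sum>t. ennreal (run_mean (p_update p V adj) V t (\<lambda>f. of_bool (\<epsilon> < osc V f)) f0))"
    using nn_integral_run[OF V, of "\<lambda>f. of_bool (\<epsilon> < osc V f)"] by simp
  finally show ?thesis .
qed

text \<open>The process that certifies a large oscillation may differ from the profile itself. Having no
  consensus at times \<open>0, \<dots>, t\<close> means that the consensus time is at least \<open>t + 1\<close>, so the bound is
  useful for \<open>t = 0\<close> too.\<close>

lemma expected_consensus_time_ge:
  assumes V: "finite V" "V \<noteq> {}"
    and osc: "\<And>U s. U \<in> UNIV \<rightarrow> V \<Longrightarrow> Q (run step z U t) \<Longrightarrow> s \<le> t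
       \<Longrightarrow> \<epsilon> < osc V (p_dynamics p V adj f0 U s)"
  shows "ennreal ((real t + 1) * run_mean step V t (\<lambda>z. of_bool (Q z)) z)
     \<le> expected_consensus_time p V adj \<epsilon> f0"
proof -
  let ?I = "\<lambda>U. ennreal (of_bool (Q (run step z U t)))"
  have "ennreal ((real t + 1) * run_mean step V t (\<lambda>z. of_bool (Q z)) z)
    = ennreal (real t + 1) * (\<integral>\<^sup>+ U. ?I U \<partial>uniform_seq V)"
    by (subst nn_integral_run[OF V]) (auto simp: ennreal_mult' run_mean_nonneg)
  also have "\<dots> = (\<integral>\<^sup>+ U. ennreal (real t + 1) * ?I U \<partial>uniform_seq V)"
    using measurable_run[OF V(1), of "\<lambda>z. ennreal (of_bool (Q z))"]
    by (intro nn_integral_cmult[symmetric])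
  also have "\<dots> \<le> (\<integral>\<^sup>+ U. ennreal_of_enat (consensus_time p V adj \<epsilon> f0 U) \<partial>uniform_seq V)"
  proof (rule nn_integral_mono)
    fix U assume "U \<in> space (uniform_seq V)"
    then have U: "U \<in> UNIV \<rightarrow> V" by (auto simp: space_uniform_seq)
    show "ennreal (real t + 1) * ?I U \<le> ennreal_of_enat (consensus_time p V adj \<epsilon> f0 U)"
    proof (cases "Q (run step z U t)")
      case True
      have "enat (Suc t) \<le> consensus_time p V adj \<epsilon> f0 U"
        unfolding consensus_time_def
      proof (rule INF_greatest)
        fix s assume "s \<in> {t. osc V (p_dynamics p V adj f0 U t) \<le> \<epsilon>}"
        then show "enat (Suc t) \<le> enat s"
          using osc[OF U True, of s] by (cases "s \<le> t") auto
      qed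
      then have "ennreal_of_enat (enat (Suc t)) \<le> ennreal_of_enat (consensus_time p V adj \<epsilon> f0 U)"
        by (rule ennreal_of_enat_le_iff[THEN iffD2])
      moreover have "ennreal_of_enat (enat (Suc t)) = ennreal (real t + 1)"
        unfolding ennreal_of_enat_enat ennreal_of_nat_eq_real_of_nat by (simp add: add.commute)
      ultimately show ?thesis using True by (simp add: add.commute)
    qed simp
  qed
  finally show ?thesis by (simp add: expected_consensus_time_def)
qed

section \<open>Contraction of the energy\<close>

locale p_graph =
  fixes p :: real and V :: "'a set" and adj :: "'a \<Rightarrow> 'a \<Rightarrow> bool"
  assumes p_gt_1: "1 < p"
    and finite_V: "finite V" and V_nonempty: "V \<noteq> {}"
    and adj_sym: "adj u v \<Longrightarrow> adj v u"
    and adj_irrefl: "\<not> adj u u"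
    and has_neighbor: "u \<in> V \<Longrightarrow> \<exists>v\<in>V. adj u v"
begin

definition nbrs :: "'a \<Rightarrow> 'a set" where
  "nbrs u = {v \<in> V. adj u v}"

abbreviation step :: "('a \<Rightarrow> real) \<Rightarrow> 'a \<Rightarrow> ('a \<Rightarrow> real)" where
  "step \<equiv> p_update p V adj"

text \<open>Every edge is counted once in each direction.\<close>

definition energy :: "('a \<Rightarrow> real) \<Rightarrow> real" where
  "energy f = (\<Sum>u\<in>V. \<Sum>v\<in>nbrs u. \<bar>f u - f v\<bar> powr p)"

lemma finite_nbrs [simp]: "finite (nbrs u)"
  using finite_V by (simp add: nbrs_def)

lemma nbrs_nonempty: "u \<in> V \<Longrightarrow> nbrs u \<noteq> {}"
  using has_neighbor by (auto simp: nbrs_def)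

lemma nbrs_subset: "v \<in> nbrs u \<Longrightarrow> v \<in> V"
  by (simp add: nbrs_def)

lemma card_nbrs_ge_1: "u \<in> V \<Longrightarrow> 1 \<le> card (nbrs u)"
  using nbrs_nonempty[of u] by (simp add: Suc_le_eq card_gt_0_iff)

lemma card_V_pos: "0 < card V"
  using finite_V V_nonempty by (simp add: card_gt_0_iff)

lemma step_eq: "step f u = f(u := p_mean p (nbrs u) f)"
  by (simp add: p_update_def nbrs_def)

lemma energy_nonneg: "0 \<le> energy f"
  by (simp add: energy_def sum_nonneg)

lemma sum_nbrs_swap:
  "(\<Sum>u\<in>V. \<Sum>v\<in>nbrs u. G u v) = (\<Sum>u\<in>V. \<Sum>v\<in>nbrs u. G v u)"
proof -
  have "(\<Sum>u\<in>V. \<Sum>v\<in>nbrs u. G u v) = (\<Sum>v\<in>V. \<Sum>u\<in>{u \<in> V. adj u v}. G u v)"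
    unfolding nbrs_def by (rule sum.swap_restrict) (use finite_V in auto)
  also have "\<dots> = (\<Sum>v\<in>V. \<Sum>u\<in>nbrs v. G u v)"
    by (intro sum.cong) (auto simp: nbrs_def intro: adj_sym)
  finally show ?thesis .
qed

lemma energy_fun_upd:
  assumes "u \<in> V"
  shows "energy (f(u := x)) = energy f
    + 2 * ((\<Sum>v\<in>nbrs u. \<bar>x - f v\<bar> powr p) - (\<Sum>v\<in>nbrs u. \<bar>f u - f v\<bar> powr p))"
proof -
  define F where "F g w v = (if adj w v then \<bar>g w - g v\<bar> powr p else 0)" for g :: "'a \<Rightarrow> real" and w v
  have nbrs_sum: "(\<Sum>v\<in>nbrs w. G v) = (\<Sum>v\<in>V. if adj w v then G v else 0)" for w and G :: "'a \<Rightarrow> real"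
    unfolding nbrs_def using finite_V by (rule sum.inter_filter)
  have split: "energy g = 2 * (\<Sum>v\<in>V. F g u v) + (\<Sum>w\<in>V - {u}. \<Sum>v\<in>V - {u}. F g w v)" for g
  proof -
    have sym: "F g w v = F g v w" for w v
      using adj_sym by (auto simp: F_def abs_minus_commute)
    have "F g u u = 0" by (simp add: F_def adj_irrefl)
    then have u: "(\<Sum>v\<in>V. F g u v) = (\<Sum>v\<in>V - {u}. F g u v)"
      using assms finite_V by (simp add: sum.remove)
    have "energy g = (\<Sum>w\<in>V. \<Sum>v\<in>V. F g w v)"
      by (simp add: energy_def F_def nbrs_sum)
    also have "\<dots> = (\<Sum>v\<in>V. F g u v) + (\<Sum>w\<in>V - {u}. \<Sum>v\<in>V. F g w v)"
      by (rule sum.remove[OF finite_V assms])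
    also have "(\<Sum>w\<in>V - {u}. \<Sum>v\<in>V. F g w v)
        = (\<Sum>w\<in>V - {u}. F g w u + (\<Sum>v\<in>V - {u}. F g w v))"
      by (intro sum.cong refl sum.remove finite_V assms)
    also have "\<dots> = (\<Sum>w\<in>V - {u}. F g u w) + (\<Sum>w\<in>V - {u}. \<Sum>v\<in>V - {u}. F g w v)"
      by (simp add: sum.distrib sym[of _ u])
    finally show ?thesis using u by simp
  qed
  have "(\<Sum>v\<in>V. F (f(u := x)) u v) = (\<Sum>v\<in>nbrs u. \<bar>x - f v\<bar> powr p)"
    unfolding nbrs_sum by (intro sum.cong) (auto simp: F_def adj_irrefl)
  moreover have "(\<Sum>v\<in>V. F f u v) = (\<Sum>v\<in>nbrs u. \<bar>f u - f v\<bar> powr p)"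
    unfolding nbrs_sum by (intro sum.cong) (auto simp: F_def)
  moreover have "(\<Sum>w\<in>V - {u}. \<Sum>v\<in>V - {u}. F (f(u := x)) w v) = (\<Sum>w\<in>V - {u}. \<Sum>v\<in>V - {u}. F f w v)"
    by (intro sum.cong) (auto simp: F_def)
  ultimately show ?thesis using split[of f] split[of "f(u := x)"] by (simp add: algebra_simps)
qed

text \<open>The \<open>p\<close>-mean minimizes the part of the energy carried by the edges at \<open>u\<close>, so any displacement
  \<open>h\<close> of \<open>f u\<close> may serve as a competitor.\<close>

lemma energy_step_le:
  assumes "u \<in> V"
  shows "energy (step f u) \<le> energy f
    - 2 * (\<Sum>v\<in>nbrs u. \<bar>f u - f v\<bar> powr p - \<bar>f u - f v - h\<bar> powr p)"
proof -
  have "(\<Sum>v\<in>nbrs u. \<bar>p_mean p (nbrs u) f - f v\<bar> powr p) \<le> (\<Sum>v\<in>nbrs u. \<bar>f u - h - f v\<bar> powr p)"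
    by (rule p_mean_minimal[OF p_gt_1 finite_nbrs nbrs_nonempty[OF assms]])
  also have "\<dots> = (\<Sum>v\<in>nbrs u. \<bar>f u - f v - h\<bar> powr p)" by (simp add: algebra_simps)
  finally show ?thesis
    unfolding step_eq energy_fun_upd[OF assms] sum_subtractf by simp
qed

text \<open>The flow \<open>signed_powr (p - 1) (f u - f v)\<close> is antisymmetric in \<open>u\<close> and \<open>v\<close>, so each edge contributes
  the product of its flow with \<open>f u - f v\<close>.\<close>

lemma summation_by_parts:
  "(\<Sum>u\<in>V. \<Sum>v\<in>nbrs u. signed_powr (p - 1) (f u - f v) * (f u - m)) = energy f / 2"
proof -
  let ?T = "\<Sum>u\<in>V. \<Sum>v\<in>nbrs u. signed_powr (p - 1) (f u - f v) * (f u - m)"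
  have anti: "signed_powr (p - 1) (f v - f u) = - signed_powr (p - 1) (f u - f v)" for u v
    using signed_powr_minus[of "p - 1" "f u - f v"] by simp
  have "?T = (\<Sum>u\<in>V. \<Sum>v\<in>nbrs u. signed_powr (p - 1) (f v - f u) * (f v - m))"
    by (rule sum_nbrs_swap)
  then have "2 * ?T = ?T + (\<Sum>u\<in>V. \<Sum>v\<in>nbrs u. signed_powr (p - 1) (f v - f u) * (f v - m))"
    by simp
  also have "\<dots> = (\<Sum>u\<in>V. \<Sum>v\<in>nbrs u. signed_powr (p - 1) (f u - f v) * (f u - f v))"
    unfolding sum.distrib[symmetric]
  proof (intro sum.cong refl)
    fix u v
    show "signed_powr (p - 1) (f u - f v) * (f u - m) + signed_powr (p - 1) (f v - f u) * (f v - m)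
        = signed_powr (p - 1) (f u - f v) * (f u - f v)"
      unfolding anti[of v u] by (simp add: right_diff_distrib)
  qed
  also have "\<dots> = energy f" by (simp add: signed_powr_mult_self energy_def)
  finally show ?thesis by simp
qed

text \<open>The centre \<open>m\<close> may depend on \<open>f\<close>. With the degree as weight, both rates of contraction depend on
  the graph only through \<open>X\<close>.\<close>

definition poincare :: "real \<Rightarrow> bool" where
  "poincare X \<longleftrightarrow> (\<forall>f. \<exists>m. (\<Sum>u\<in>V. card (nbrs u) * \<bar>f u - m\<bar> powr p) \<le> X powr p * energy f)"

lemma sum_energy_step_le:
  "(\<Sum>u\<in>V. energy (step f u)) \<le> card V * energy f
    - 2 * (\<Sum>u\<in>V. \<Sum>v\<in>nbrs u. \<bar>f u - f v\<bar> powr p - \<bar>f u - f v - k * (f u - m)\<bar> powr p)"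
proof -
  have "(\<Sum>u\<in>V. energy (step f u)) \<le> (\<Sum>u\<in>V. energy f
    - 2 * (\<Sum>v\<in>nbrs u. \<bar>f u - f v\<bar> powr p - \<bar>f u - f v - k * (f u - m)\<bar> powr p))"
    by (intro sum_mono energy_step_le)
  then show ?thesis by (simp add: sum_subtractf sum_distrib_left[symmetric])
qed

text \<open>With the competitor \<open>k * (f u - m)\<close> the linear gain is a multiple of \<open>k * energy f\<close>, while the
  remainder is of order \<open>k powr p * X powr p * energy f\<close>. Since \<open>p > 1\<close>, the gain wins for small
  \<open>k\<close>; the chosen \<open>k\<close> satisfies \<open>8 * k powr (p - 1) * X powr p = 1\<close>, which leaves half of it.\<close>

lemma energy_contraction_le_2:
  fixes X k :: real
  assumes "p \<le> 2" "1 \<le> X" "poincare X"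
  defines "k \<equiv> (8 * X powr p) powr (- 1 / (p - 1))"
  shows "(\<Sum>u\<in>V. energy (step f u)) \<le> (card V - k / 2) * energy f"
proof -
  obtain m where m: "(\<Sum>u\<in>V. card (nbrs u) * \<bar>f u - m\<bar> powr p) \<le> X powr p * energy f"
    using assms(1-3) by (auto simp: poincare_def)
  have X: "0 < X powr p" using assms(1-3) by simp
  have k: "0 < k" using X by (simp add: k_def)
  have kp: "k powr p = k / (8 * X powr p)"
  proof -
    have "k powr (p - 1) = (8 * X powr p) powr (-1)"
      unfolding k_def powr_powr using p_gt_1 by simp
    also have "\<dots> = 1 / (8 * X powr p)" using X by (simp add: powr_minus_divide)
    finally show ?thesis using k powr_add[of k "p - 1" 1] by (simp add: field_simps)
  qed
  have ptw: "\<bar>a - k * b\<bar> powr p \<le> \<bar>a\<bar> powr p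
      - p * k * (signed_powr (p - 1) a * b) + 2 * p * k powr p * \<bar>b\<bar> powr p" for a b
    using abs_powr_diff_upper_le_2[of p a "k * b"] assms(1) p_gt_1 k
    by (simp add: abs_mult powr_mult mult_ac)
  have ptw': "p * k * (signed_powr (p - 1) a * b) - 2 * p * k powr p * \<bar>b\<bar> powr p
      \<le> \<bar>a\<bar> powr p - \<bar>a - k * b\<bar> powr p" for a b
    using ptw[of a b] by linarith
  have "(\<Sum>u\<in>V. \<Sum>v\<in>nbrs u. p * k * (signed_powr (p - 1) (f u - f v) * (f u - m)) - 2 * p * k powr p * \<bar>f u - m\<bar> powr p)
      \<le> (\<Sum>u\<in>V. \<Sum>v\<in>nbrs u. \<bar>f u - f v\<bar> powr p - \<bar>f u - f v - k * (f u - m)\<bar> powr p)"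
    by (intro sum_mono ptw')
  moreover have "(\<Sum>u\<in>V. \<Sum>v\<in>nbrs u. p * k * (signed_powr (p - 1) (f u - f v) * (f u - m)) - 2 * p * k powr p * \<bar>f u - m\<bar> powr p)
      = p * k * (energy f / 2) - 2 * p * k powr p * (\<Sum>u\<in>V. card (nbrs u) * \<bar>f u - m\<bar> powr p)"
    unfolding sum_subtractf sum_distrib_left[symmetric] summation_by_parts
    by (simp add: sum_distrib_left algebra_simps)
  moreover have "2 * p * k powr p * (\<Sum>u\<in>V. card (nbrs u) * \<bar>f u - m\<bar> powr p) \<le> 2 * p * k powr p * (X powr p * energy f)"
    using m p_gt_1 by (intro mult_left_mono) auto
  moreover have "2 * p * k powr p * (X powr p * energy f) = p * k * energy f / 4"
    unfolding kp using X by (simp add: field_simps)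
  moreover have "1 * (k * energy f) \<le> p * (k * energy f)"
    using p_gt_1 k energy_nonneg by (intro mult_right_mono) auto
  ultimately have "k * energy f / 4
      \<le> (\<Sum>u\<in>V. \<Sum>v\<in>nbrs u. \<bar>f u - f v\<bar> powr p - \<bar>f u - f v - k * (f u - m)\<bar> powr p)"
    by linarith
  with sum_energy_step_le[of f k m] show ?thesis by (simp add: algebra_simps)
qed

text \<open>For \<open>p \<ge> 2\<close> the remainder contains the mixed term \<open>\<bar>f u - f v\<bar> powr (p - 2) * (k * (f u - m))\<^sup>2\<close>.
  Young's inequality at the scale \<open>1 / X\<close> and the Poincare inequality bound it by
  \<open>2 * k\<^sup>2 * X\<^sup>2 * energy f\<close>, and the pure power of \<open>k * X \<le> 1\<close> is smaller.\<close>

lemma energy_contraction_ge_2: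
  fixes X k :: real
  assumes "2 \<le> p" "1 \<le> X" "poincare X"
  defines "k \<equiv> 1 / (6 * (p * (p - 1) * 2 powr (p - 2)) * X\<^sup>2)"
  shows "(\<Sum>u\<in>V. energy (step f u)) \<le> (card V - k) * energy f"
proof -
  obtain m where m: "(\<Sum>u\<in>V. card (nbrs u) * \<bar>f u - m\<bar> powr p) \<le> X powr p * energy f"
    using assms(1-3) by (auto simp: poincare_def)
  define C where "C = p * (p - 1) * 2 powr (p - 2)"
  have "2 * 1 * 1 \<le> C" unfolding C_def using assms(1-3)
    by (intro mult_mono) (auto simp: ge_one_powr_ge_zero)
  then have C: "2 \<le> C" by simp
  have k_eq: "k = 1 / (6 * C * X\<^sup>2)" by (simp add: k_def C_def)
  have k: "0 < k" using C assms(1-3) by (simp add: k_eq)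
  have kX: "C * (k\<^sup>2 * X\<^sup>2) = k / 6" using C assms(1-3) by (simp add: k_eq field_simps power2_eq_square)
  have "k * X \<le> 1"
  proof -
    have "1 * X \<le> X * X" using assms(1-3) by (intro mult_right_mono) auto
    also have "\<dots> \<le> 6 * C * X\<^sup>2" using C assms(1-3) by (simp add: power2_eq_square)
    finally show ?thesis using C assms(1-3) by (simp add: k_eq divide_simps)
  qed
  then have kXp: "(k * X) powr p \<le> (k * X)\<^sup>2"
    using k assms(1-3) powr_mono'[of 2 p "k * X"] by simp
  have E: "0 \<le> energy f" by (rule energy_nonneg)
  have ptw: "\<bar>a - k * b\<bar> powr p \<le> \<bar>a\<bar> powr p - p * k * (signed_powr (p - 1) a * b)
      + C * (k\<^sup>2 * X\<^sup>2) * \<bar>a\<bar> powr p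
      + C * (k\<^sup>2 * X\<^sup>2 * X powr (- p) + k powr p) * \<bar>b\<bar> powr p" for a b
  proof -
    have "\<bar>a\<bar> powr (p - 2) * (k * b)\<^sup>2 = k\<^sup>2 * (\<bar>a\<bar> powr (p - 2) * b\<^sup>2)"
      by (simp add: power_mult_distrib)
    also have "\<dots> \<le> k\<^sup>2 * ((\<bar>a\<bar> powr p + (1 / X) powr p * \<bar>b\<bar> powr p) / (1 / X)\<^sup>2)"
      using assms(1-2) by (intro mult_left_mono scaled_young) auto
    also have "\<dots> = k\<^sup>2 * X\<^sup>2 * \<bar>a\<bar> powr p + k\<^sup>2 * X\<^sup>2 * X powr (- p) * \<bar>b\<bar> powr p"
      using assms(2) by (simp add: powr_divide powr_minus field_simps)
    finally have "\<bar>a\<bar> powr (p - 2) * (k * b)\<^sup>2 + \<bar>k * b\<bar> powr p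
      \<le> k\<^sup>2 * X\<^sup>2 * \<bar>a\<bar> powr p + (k\<^sup>2 * X\<^sup>2 * X powr (- p) + k powr p) * \<bar>b\<bar> powr p"
      using k by (simp add: abs_mult powr_mult distrib_right)
    then have "C * (\<bar>a\<bar> powr (p - 2) * (k * b)\<^sup>2 + \<bar>k * b\<bar> powr p)
      \<le> C * (k\<^sup>2 * X\<^sup>2 * \<bar>a\<bar> powr p + (k\<^sup>2 * X\<^sup>2 * X powr (- p) + k powr p) * \<bar>b\<bar> powr p)"
      using C by (intro mult_left_mono) auto
    then show ?thesis
      using abs_powr_diff_upper_ge_2[OF assms(1), of a "k * b", folded C_def]
      by (simp add: algebra_simps)
  qed
  have ptw': "p * k * (signed_powr (p - 1) a * b) - C * (k\<^sup>2 * X\<^sup>2) * \<bar>a\<bar> powr p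
      - C * (k\<^sup>2 * X\<^sup>2 * X powr (- p) + k powr p) * \<bar>b\<bar> powr p
      \<le> \<bar>a\<bar> powr p - \<bar>a - k * b\<bar> powr p" for a b
    using ptw[of a b] by linarith
  have "(\<Sum>u\<in>V. \<Sum>v\<in>nbrs u. p * k * (signed_powr (p - 1) (f u - f v) * (f u - m))
       - C * (k\<^sup>2 * X\<^sup>2) * \<bar>f u - f v\<bar> powr p - C * (k\<^sup>2 * X\<^sup>2 * X powr (- p) + k powr p) * \<bar>f u - m\<bar> powr p)
      \<le> (\<Sum>u\<in>V. \<Sum>v\<in>nbrs u. \<bar>f u - f v\<bar> powr p - \<bar>f u - f v - k * (f u - m)\<bar> powr p)"
    by (intro sum_mono ptw')
  moreover have "(\<Sum>u\<in>V. \<Sum>v\<in>nbrs u. p * k * (signed_powr (p - 1) (f u - f v) * (f u - m))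
       - C * (k\<^sup>2 * X\<^sup>2) * \<bar>f u - f v\<bar> powr p - C * (k\<^sup>2 * X\<^sup>2 * X powr (- p) + k powr p) * \<bar>f u - m\<bar> powr p)
      = p * k * (energy f / 2) - C * (k\<^sup>2 * X\<^sup>2) * energy f
       - C * (k\<^sup>2 * X\<^sup>2 * X powr (- p) + k powr p) * (\<Sum>u\<in>V. card (nbrs u) * \<bar>f u - m\<bar> powr p)"
    unfolding sum_subtractf sum_distrib_left[symmetric] summation_by_parts energy_def[symmetric]
    by (simp add: sum_distrib_left algebra_simps)
  moreover have "C * (k\<^sup>2 * X\<^sup>2 * X powr (- p) + k powr p) * (\<Sum>u\<in>V. card (nbrs u) * \<bar>f u - m\<bar> powr p)
      \<le> C * (k\<^sup>2 * X\<^sup>2 * X powr (- p) + k powr p) * (X powr p * energy f)"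
    using m C by (intro mult_left_mono) auto
  moreover have "C * (k\<^sup>2 * X\<^sup>2 * X powr (- p) + k powr p) * (X powr p * energy f)
      = (C * (k\<^sup>2 * X\<^sup>2) + C * (k * X) powr p) * energy f"
    using assms(1-3) k by (simp add: powr_mult powr_minus field_simps)
  moreover have "C * (k * X) powr p * energy f \<le> C * (k\<^sup>2 * X\<^sup>2) * energy f"
    using kXp C E by (intro mult_right_mono mult_left_mono) (auto simp: power_mult_distrib)
  moreover have "2 * (k * energy f) \<le> p * (k * energy f)"
    using assms(1) k E by (intro mult_right_mono) auto
  ultimately have "k * energy f / 2
      \<le> (\<Sum>u\<in>V. \<Sum>v\<in>nbrs u. \<bar>f u - f v\<bar> powr p - \<bar>f u - f v - k * (f u - m)\<bar> powr p)"
    unfolding kX by (simp only: distrib_right)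
  with sum_energy_step_le[of f k m] show ?thesis by (simp add: algebra_simps)
qed

lemma osc_le:
  assumes "\<And>v. v \<in> V \<Longrightarrow> f v \<in> {a..b}"
  shows "osc V f \<le> b - a"
proof -
  have "Max (f ` V) \<le> b" "a \<le> Min (f ` V)"
    using assms finite_V V_nonempty by (auto simp: Max_le_iff Min_ge_iff)
  then show ?thesis by (simp add: osc_def)
qed

lemma osc_ge:
  assumes "u \<in> V" "v \<in> V"
  shows "f u - f v \<le> osc V f"
proof -
  have "f u \<le> Max (f ` V)" "Min (f ` V) \<le> f v" using assms finite_V by auto
  then show ?thesis by (simp add: osc_def)
qed

lemma step_range:
  assumes "\<And>v. v \<in> V \<Longrightarrow> f v \<in> {a..b}" "u \<in> V" "v \<in> V"
  shows "step f u v \<in> {a..b}"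
proof -
  have "p_mean p (nbrs u) f \<in> {a..b}"
    by (rule p_mean_between[OF p_gt_1 finite_nbrs nbrs_nonempty]) (use assms nbrs_subset in auto)
  then show ?thesis using assms by (auto simp: step_eq)
qed

lemma osc_step_le:
  assumes "u \<in> V"
  shows "osc V (step f u) \<le> osc V f"
  unfolding osc_def[of V f]
  by (rule osc_le, rule step_range) (use assms finite_V in auto)

lemma osc_run_antimono:
  assumes "U \<in> UNIV \<rightarrow> V" "s \<le> t"
  shows "osc V (run step f U t) \<le> osc V (run step f U s)"
  using assms(2)
proof (induction t rule: dec_induct)
  case (step t)
  then show ?case using osc_step_le[of "U t" "run (p_update p V adj) f U t"] assms(1) by force
qed simp

text \<open>A single vertex far from the centre already contributes a large term to the left-hand side of
  the Poincare inequality, its degree being at least \<open>1\<close>.\<close>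

lemma osc_energy:
  assumes "poincare X" "1 \<le> X" "0 < \<epsilon>" "\<epsilon> < osc V f"
  shows "(\<epsilon> / (2 * X)) powr p \<le> energy f"
proof -
  obtain m where m: "(\<Sum>u\<in>V. card (nbrs u) * \<bar>f u - m\<bar> powr p) \<le> X powr p * energy f"
    using assms by (auto simp: poincare_def)
  have "\<exists>u\<in>V. \<epsilon> / 2 \<le> \<bar>f u - m\<bar>"
  proof (rule ccontr)
    assume neg: "\<not> (\<exists>u\<in>V. \<epsilon> / 2 \<le> \<bar>f u - m\<bar>)"
    have "f v \<in> {m - \<epsilon> / 2 .. m + \<epsilon> / 2}" if "v \<in> V" for v
    proof -
      have "\<bar>f v - m\<bar> < \<epsilon> / 2" using neg that by (meson not_le)
      then have "m - \<epsilon> / 2 \<le> f v" "f v \<le> m + \<epsilon> / 2" by linarith+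
      then show ?thesis by simp
    qed
    then have "osc V f \<le> \<epsilon>" using osc_le[of f "m - \<epsilon> / 2" "m + \<epsilon> / 2"] by simp
    then show False using assms by simp
  qed
  then obtain u where u: "u \<in> V" "\<epsilon> / 2 \<le> \<bar>f u - m\<bar>" by blast
  have "(\<epsilon> / 2) powr p \<le> 1 * \<bar>f u - m\<bar> powr p"
    using u assms p_gt_1 by (auto intro: powr_mono2)
  also have "\<dots> \<le> card (nbrs u) * \<bar>f u - m\<bar> powr p"
    using card_nbrs_ge_1[OF u(1)] by (intro mult_right_mono) auto
  also have "\<dots> \<le> (\<Sum>u\<in>V. card (nbrs u) * \<bar>f u - m\<bar> powr p)"
    using u finite_V by (intro member_le_sum) auto
  also note m
  finally have "(\<epsilon> / 2) powr p / X powr p \<le> energy f"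
    using assms by (simp add: field_simps)
  moreover have "(\<epsilon> / 2) powr p / X powr p = (\<epsilon> / (2 * X)) powr p"
    using assms by (simp flip: powr_divide)
  ultimately show ?thesis by simp
qed

end

text \<open>The bound \<open>a t \<le> 1\<close> is used until the geometric bound drops below \<open>1\<close>, which happens at time
  \<open>ln A / r\<close>; the tail is a geometric series with sum \<open>1 / r\<close>.\<close>

lemma suminf_min_one_geometric_le:
  fixes a :: "nat \<Rightarrow> real"
  assumes a: "\<And>t. 0 \<le> a t" "\<And>t. a t \<le> 1" "\<And>t. a t \<le> A * (1 - r) ^ t"
    and "1 \<le> A" "0 < r" "r \<le> 1"
  shows "(\<Sum>t. ennreal (a t)) \<le> ennreal ((ln A + 2) / r)"
proof -
  define T where "T = nat \<lceil>ln A / r\<rceil>"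
  have lnA: "0 \<le> ln A" using assms by simp
  have T: "ln A / r \<le> T" "T \<le> ln A / r + 1"
    using lnA assms by (auto simp: T_def) 
  have tail: "a (t + T) \<le> (1 - r) ^ t" for t
  proof -
    have "(1 - r) ^ T \<le> exp (- r) ^ T"
      using assms exp_ge_add_one_self[of "- r"] by (intro power_mono) auto
    also have "\<dots> = exp (- (r * T))" by (simp add: exp_of_nat_mult[symmetric] mult.commute)
    also have "\<dots> \<le> exp (- ln A)" using T assms by (simp add: field_simps)
    also have "\<dots> = 1 / A" using assms by (simp add: exp_minus field_simps)
    finally have "A * (1 - r) ^ T \<le> 1" using assms by (simp add: field_simps)
    then have "A * (1 - r) ^ T * (1 - r) ^ t \<le> 1 * (1 - r) ^ t"
      using assms by (intro mult_right_mono) auto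
    then show ?thesis using a(3)[of "t + T"] by (simp add: power_add mult_ac)
  qed
  have "(\<Sum>t. ennreal (a t)) = (\<Sum>t. ennreal (a (t + T))) + (\<Sum>t<T. ennreal (a t))"
    by (rule suminf_offset) auto
  also have "\<dots> \<le> (\<Sum>t. ennreal ((1 - r) ^ t)) + (\<Sum>t<T. 1)"
    using a tail by (intro add_mono suminf_le sum_mono) (auto intro: ennreal_leI)
  also have "(\<Sum>t. ennreal ((1 - r) ^ t)) = ennreal (1 / r)"
    using geometric_sums[of "1 - r"] assms by (intro suminf_ennreal_eq) auto
  also have "(\<Sum>t<T. 1) = ennreal (real T)" by (simp add: ennreal_of_nat_eq_real_of_nat)
  also have "ennreal (1 / r) + ennreal (real T) = ennreal (1 / r + real T)"
    using assms by (subst ennreal_plus) auto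
  also have "\<dots> \<le> ennreal ((ln A + 2) / r)"
  proof (rule ennreal_leI)
    have "1 \<le> 1 / r" using assms by simp
    then show "1 / r + real T \<le> (ln A + 2) / r" using T by (simp add: add_divide_distrib)
  qed
  finally show ?thesis .
qed

context p_graph
begin

lemma expected_consensus_time_upper:
  fixes \<rho> X \<epsilon> A :: real
  assumes X: "poincare X" "1 \<le> X" and \<epsilon>: "0 < \<epsilon>"
    and \<rho>: "0 < \<rho>" "\<rho> \<le> card V"
    and contr: "\<And>f. (\<Sum>u\<in>V. energy (step f u)) \<le> (card V - \<rho>) * energy f"
    and A: "energy f0 * (2 * X / \<epsilon>) powr p \<le> A" "1 \<le> A"
  shows "expected_consensus_time p V adj \<epsilon> f0 \<le> ennreal (card V * (ln A + 2) / \<rho>)"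
proof -
  let ?a = "\<lambda>t. run_mean step V t (\<lambda>f. of_bool (\<epsilon> < osc V f)) f0"
  have n: "0 < real (card V)" using card_V_pos by simp
  have "?a t \<le> A * (1 - \<rho> / card V) ^ t" for t
  proof -
    have "?a t \<le> run_mean step V t energy f0 / (\<epsilon> / (2 * X)) powr p"
      by (rule run_mean_markov[where I = UNIV])
        (use osc_energy[OF X \<epsilon>] X \<epsilon> energy_nonneg in auto)
    also have "\<dots> \<le> ((1 - \<rho> / card V) ^ t * energy f0) / (\<epsilon> / (2 * X)) powr p"
    proof (intro divide_right_mono run_mean_geometric[where I = UNIV])
      show "(\<Sum>u\<in>V. energy (step f u)) / card V \<le> (1 - \<rho> / card V) * energy f" for f
        using contr[of f] n by (simp add: field_simps)
    qed (use \<rho> n in auto)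
    also have "\<dots> = (energy f0 * (2 * X / \<epsilon>) powr p) * (1 - \<rho> / card V) ^ t"
      using X \<epsilon> by (simp add: powr_divide powr_mult field_simps)
    also have "\<dots> \<le> A * (1 - \<rho> / card V) ^ t"
      using A \<rho> n by (intro mult_right_mono) auto
    finally show ?thesis .
  qed
  moreover have "?a t \<le> 1" for t
    using run_mean_mono[of UNIV V step f0 "\<lambda>f. of_bool (\<epsilon> < osc V f)" "\<lambda>_. 1" t]
    by (simp add: run_mean_const finite_V V_nonempty)
  moreover have "0 \<le> ?a t" for t by (rule run_mean_nonneg) simp
  ultimately have "(\<Sum>t. ennreal (?a t)) \<le> ennreal ((ln A + 2) / (\<rho> / card V))"
    using \<rho> n A by (intro suminf_min_one_geometric_le) auto
  also have "(ln A + 2) / (\<rho> / card V) = card V * (ln A + 2) / \<rho>" by simp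
  finally show ?thesis
    using expected_consensus_time_le[OF finite_V V_nonempty, of p adj \<epsilon> f0] by (rule order_trans[rotated])
qed

end

section \<open>Lower bounds from unvisited vertices and from barriers\<close>

text \<open>The potential \<open>1 / (N + 1)\<close>, with \<open>N\<close> the number of elements of \<open>A\<close> not yet collected, is tailored
  to the coupon collector: for \<open>N > 0\<close> one uniform draw multiplies its mean by exactly \<open>1 + 1 / n\<close>.
  Since it equals \<open>1\<close> when \<open>A\<close> is exhausted, its mean bounds the probability of that event.\<close>

lemma sum_inverse_Suc_card_Diff:
  assumes "finite V" "A \<subseteq> V"
  shows "(\<Sum>u\<in>V. 1 / (real (card ((S - {u}) \<inter> A)) + 1))
    \<le> (real (card V) + 1) / (real (card (S \<inter> A)) + 1)"
proof -
  define N where "N = card (S \<inter> A)"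
  have fin: "finite (S \<inter> A)" and sub: "S \<inter> A \<subseteq> V" using assms finite_subset by auto
  have NV: "N \<le> card V" unfolding N_def by (rule card_mono[OF assms(1) sub])
  have hit: "card ((S - {u}) \<inter> A) = N - 1" if "u \<in> S \<inter> A" for u
  proof -
    have "(S - {u}) \<inter> A = S \<inter> A - {u}" by auto
    then show ?thesis using that fin by (simp add: N_def)
  qed
  have miss: "card ((S - {u}) \<inter> A) = N" if "u \<in> V - S \<inter> A" for u
  proof -
    have "(S - {u}) \<inter> A = S \<inter> A" using that by auto
    then show ?thesis by (simp add: N_def)
  qed
  have "(\<Sum>u\<in>V. 1 / (real (card ((S - {u}) \<inter> A)) + 1))
      = (\<Sum>u\<in>V - S \<inter> A. 1 / (real N + 1)) + (\<Sum>u\<in>S \<inter> A. 1 / (real (N - 1) + 1))"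
    unfolding sum.subset_diff[OF sub assms(1)]
    by (intro arg_cong2[where f = "(+)"] sum.cong refl) (auto simp only: hit miss)
  also have "\<dots> = (real (card V) - N) / (real N + 1) + N * (1 / (real (N - 1) + 1))"
    using NV assms fin sub by (simp add: card_Diff_subset N_def of_nat_diff)
  also have "\<dots> \<le> (real (card V) + 1) / (real N + 1)"
    by (cases N) (simp_all add: field_simps)
  finally show ?thesis by (simp add: N_def)
qed

lemma half_card_subset:
  assumes "finite V" "2 \<le> card V"
  obtains A where "A \<subseteq> V" "A \<noteq> {}" "V - A \<noteq> {}"
    "card V \<le> 2 * (card A + 1)" "card V \<le> 2 * (card (V - A) + 1)"
proof -
  obtain A where A: "A \<subseteq> V" "card A = card V div 2"
    by (rule obtain_subset_with_card_n[of "card V div 2" V]) auto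
  have B: "card (V - A) = card V - card V div 2"
    using card_Diff_subset[OF finite_subset[OF A(1) assms(1)] A(1)] A(2) by simp
  have "card A \<noteq> 0" "card (V - A) \<noteq> 0" using A B assms(2) by linarith+
  then have "A \<noteq> {}" "V - A \<noteq> {}" by (metis card.empty)+
  then show ?thesis using A B by (intro that[of A]) auto
qed

context p_graph
begin

abbreviation profiles :: "('a \<Rightarrow> real) set" where
  "profiles \<equiv> V \<rightarrow>\<^sub>E {-1..1}"

lemma one_plus_power_le_exp: "0 \<le> x \<Longrightarrow> (1 + x) ^ t \<le> exp (real t * x)" for x :: real
  using power_mono[OF exp_ge_add_one_self[of x], of t] by (simp add: exp_of_nat_mult)

text \<open>An unselected vertex keeps its initial value, so the oscillation is \<open>2\<close> as long as both halves
  contain one. Within \<open>n * ln n / 2\<close> steps each half is exhausted with probability at most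
  \<open>sqrt n / (n / 2)\<close>, which is small for \<open>n \<ge> 64\<close>; for smaller \<open>n\<close> already the trivial bound \<open>1\<close>
  on the consensus time suffices.\<close>

lemma coupon_collector_lower:
  assumes "2 \<le> card V"
  shows "ennreal (card V * ln (card V) / 8192)
    \<le> (SUP f0\<in>profiles. expected_consensus_time p V adj (1 / 2) f0)"
proof -
  define n where "n = real (card V)"
  have n: "2 \<le> n" using assms by (simp add: n_def)
  obtain A where A: "A \<subseteq> V" "A \<noteq> {}" "V - A \<noteq> {}"
    "card V \<le> 2 * (card A + 1)" "card V \<le> 2 * (card (V - A) + 1)"
    using half_card_subset[OF finite_V assms] .
  define f0 where "f0 = restrict (\<lambda>v. if v \<in> A then 1 else - 1 :: real) V"
  have f0: "f0 \<in> profiles" by (auto simp: f0_def)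
  define Q where "Q S \<longleftrightarrow> S \<inter> A \<noteq> {} \<and> S \<inter> (V - A) \<noteq> {}" for S
  define st where "st S u = S - {u}" for S and u :: 'a
  \<comment> \<open>Over \<open>n * ln n / 2\<close> steps the potential grows at most by the factor \<open>sqrt n\<close>.\<close>
  define T where "T = (if n < 64 then 0 else nat \<lfloor>n * ln n / 2\<rfloor>)"
  have unhit: "p_dynamics p V adj f0 U s v = f0 v" if "v \<in> run st V U s" for U s v
    using that by (induction s) (auto simp: st_def p_update_def)
  have run_sub: "run st V U s \<subseteq> V" for U s by (induction s) (auto simp: st_def)
  have run_mono: "run st V U t \<subseteq> run st V U s" if "s \<le> t" for U s t
    using that by (induction t rule: dec_induct) (auto simp: st_def)
  have "1 / 2 < osc V (p_dynamics p V adj f0 U s)" if Q: "Q (run st V U T)" and "s \<le> T" for U s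
  proof -
    obtain u v where uv: "u \<in> run st V U s" "u \<in> A" "v \<in> run st V U s" "v \<in> V - A"
      using Q run_mono[OF \<open>s \<le> T\<close>, of U] by (auto simp: Q_def)
    then have "f0 u - f0 v \<le> osc V (p_dynamics p V adj f0 U s)"
      using osc_ge[of u v "p_dynamics p V adj f0 U s"] A by (auto simp: unhit)
    moreover have "f0 u - f0 v = 2" using uv A by (auto simp: f0_def)
    ultimately show ?thesis by simp
  qed
  then have ge: "ennreal ((real T + 1) * run_mean st V T (\<lambda>S. of_bool (Q S)) V)
      \<le> expected_consensus_time p V adj (1 / 2) f0"
    by (intro expected_consensus_time_ge finite_V V_nonempty) auto
  have hitting: "run_mean st V T (\<lambda>S. of_bool (S \<inter> B = {})) V \<le> (1 + 1 / n) ^ T / (real (card B) + 1)"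
    if "B \<subseteq> V" for B
  proof -
    define g where "g S = 1 / (real (card (S \<inter> B)) + 1)" for S
    have "run_mean st V T (\<lambda>S. of_bool (S \<inter> B = {})) V \<le> run_mean st V T g V / 1"
      by (rule run_mean_markov[where I = UNIV]) (auto simp: g_def)
    also have "run_mean st V T g V / 1 \<le> (1 + 1 / n) ^ T * g V"
      unfolding div_by_1
    proof (rule run_mean_geometric[where I = UNIV])
      fix S
      have "(\<Sum>u\<in>V. g (st S u)) \<le> (n + 1) * g S"
        using sum_inverse_Suc_card_Diff[OF finite_V that, of S] by (simp add: g_def st_def n_def)
      then have "(\<Sum>u\<in>V. g (st S u)) / n \<le> (n + 1) * g S / n"
        using n by (intro divide_right_mono) auto
      also have "(n + 1) * g S / n = (1 + 1 / n) * g S" using n by (simp add: field_simps)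
      finally show "(\<Sum>u\<in>V. g (st S u)) / card V \<le> (1 + 1 / n) * g S" by (simp add: n_def)
    qed (use n in auto)
    also have "V \<inter> B = B" using that by auto
    then have "g V = 1 / (real (card B) + 1)" by (simp add: g_def)
    finally show ?thesis by simp
  qed
  have half: "1 / 2 \<le> run_mean st V T (\<lambda>S. of_bool (Q S)) V"
  proof (cases "n < 64")
    case True
    have "V \<inter> A \<noteq> {}" "V \<inter> (V - A) \<noteq> {}" using A by auto
    then show ?thesis using True by (simp add: T_def Q_def)
  next
    case False
    define B where "B = V - A"
    have sq: "8 \<le> sqrt n" using False real_le_rsqrt[of 8 n] by simp
    have "0 \<le> n * ln n / 2" using n by simp
    then have "real T \<le> n * ln n / 2" unfolding T_def using False by simp linarith
    then have "real T * (1 / n) \<le> ln (sqrt n)" using n by (simp add: ln_sqrt field_simps)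
    then have "exp (real T * (1 / n)) \<le> sqrt n" using n by (simp add: ln_ge_iff[symmetric])
    then have pow: "(1 + 1 / n) ^ T \<le> sqrt n" using one_plus_power_le_exp[of "1 / n" T] n by simp
    have small: "run_mean st V T (\<lambda>S. of_bool (S \<inter> B = {})) V \<le> 1 / 4"
      if "B \<subseteq> V" "card V \<le> 2 * (card B + 1)" for B
    proof -
      have B: "n / 2 \<le> real (card B) + 1" using that by (simp add: n_def)
      note hitting[OF that(1)]
      also have "(1 + 1 / n) ^ T / (real (card B) + 1) \<le> sqrt n / (n / 2)"
        using pow B n by (intro frac_le) auto
      also have "\<dots> = 2 / sqrt n" using n by (simp add: field_simps)
      also have "\<dots> \<le> 2 / 8" using sq n by (intro divide_left_mono) auto
      finally show ?thesis by simp
    qed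
    have "run_mean st V T (\<lambda>S. of_bool (\<not> Q S)) V
        \<le> run_mean st V T (\<lambda>S. of_bool (S \<inter> A = {}) + of_bool (S \<inter> B = {})) V"
      by (rule run_mean_mono[where I = UNIV]) (auto simp: Q_def B_def)
    also have "\<dots> \<le> 1 / 4 + 1 / 4"
      unfolding run_mean_add B_def by (intro add_mono small A Diff_subset)
    finally show ?thesis unfolding run_mean_not[OF finite_V V_nonempty] by simp
  qed
  have "n * ln n / 8192 \<le> (real T + 1) * (1 / 2)"
  proof (cases "n < 64")
    case True
    have "n * ln n \<le> n * n" using n ln_le_minus_one[of n] by (intro mult_left_mono) auto
    also have "\<dots> \<le> 64 * 64" using True n by (intro mult_mono) auto
    finally have "n * ln n \<le> 4096" by simp
    with True show ?thesis by (simp add: T_def)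
  next
    case False
    have "n * ln n / 2 \<le> real T + 1" using n by (simp add: T_def False)
    then have "n * ln n / 2 * (1 / 2) \<le> (real T + 1) * (1 / 2)" by (rule mult_right_mono) simp
    moreover have "n * ln n / 8192 \<le> n * ln n / 2 * (1 / 2)" using n by simp
    ultimately show ?thesis by (rule order_trans[rotated])
  qed
  also have "\<dots> \<le> (real T + 1) * run_mean st V T (\<lambda>S. of_bool (Q S)) V"
    using half by (intro mult_left_mono) auto
  finally have "ennreal (n * ln n / 8192) \<le> expected_consensus_time p V adj (1 / 2) f0"
    using ge by (meson ennreal_leI order_trans)
  also have "\<dots> \<le> (SUP f0\<in>profiles. expected_consensus_time p V adj (1 / 2) f0)"
    by (intro SUP_upper f0)
  finally show ?thesis by (simp add: n_def)
qed

text \<open>The two signs say that the \<open>p\<close>-mean of \<open>\<phi>\<close> over the neighbors of \<open>u\<close> is within \<open>h\<close> of \<open>\<phi> u\<close>;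
  unlike the \<open>p\<close>-mean, these sums are explicit.\<close>

definition barrier :: "real \<Rightarrow> ('a \<Rightarrow> real) \<Rightarrow> bool" where
  "barrier h \<phi> \<longleftrightarrow> (\<forall>u\<in>V. 0 \<le> (\<Sum>v\<in>nbrs u. signed_powr (p - 1) (\<phi> u + h - \<phi> v)) \<and>
     (\<Sum>v\<in>nbrs u. signed_powr (p - 1) (\<phi> u - h - \<phi> v)) \<le> 0)"

lemma barrier_step:
  assumes "barrier h \<phi>" "u \<in> V" "\<And>v. v \<in> nbrs u \<Longrightarrow> \<bar>f v - \<phi> v\<bar> \<le> s"
  shows "\<bar>p_mean p (nbrs u) f - \<phi> u\<bar> \<le> h + s"
proof -
  note ne = p_gt_1 finite_nbrs nbrs_nonempty[OF assms(2)]
  have "p_mean p (nbrs u) f \<le> (\<phi> u + h) + s"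
    by (rule p_mean_upper[OF ne, where z = \<phi>]) (use assms(1,2) assms(3) in \<open>force simp: barrier_def abs_le_iff\<close>)+
  moreover have "(\<phi> u - h) - s \<le> p_mean p (nbrs u) f"
    by (rule p_mean_lower[OF ne, where z = \<phi>]) (use assms(1,2) assms(3) in \<open>force simp: barrier_def abs_le_iff\<close>)+
  ultimately show ?thesis by (simp add: abs_le_iff)
qed

text \<open>The potential \<open>\<Sum>u. exp (\<bar>f u - \<phi> u\<bar> / h)\<close> counts chains of updates at successive neighbors: by
  \<open>barrier_step\<close> an update at \<open>u\<close> adds at most \<open>exp 1\<close> times the terms of the neighbors of \<open>u\<close>, so
  its mean grows at most by the factor \<open>1 + exp 1 * D / n\<close> per step. Starting from \<open>n\<close>, it would have
  to reach \<open>exp (1 / (2 * h))\<close> before the oscillation can fall to \<open>1/2\<close>. This is informative only if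
  \<open>1 / h\<close> dominates \<open>ln n\<close>; otherwise the coupon collector bound is the stronger one.\<close>

lemma barrier_consensus_lower:
  assumes barrier: "barrier h \<phi>" "0 < h"
    and range: "\<phi> \<in> profiles" and ends: "u0 \<in> V" "u1 \<in> V" "\<phi> u0 = 1" "\<phi> u1 = - 1"
    and D: "\<And>u. u \<in> V \<Longrightarrow> card (nbrs u) \<le> D"
  shows "ennreal (card V / (100000 * real D * h))
    \<le> (SUP f0\<in>profiles. expected_consensus_time p V adj (1 / 2) f0)"
proof -
  define n where "n = real (card V)"
  have "u0 \<noteq> u1" using ends by auto
  then have cV: "2 \<le> card V"
    using card_mono[OF finite_V, of "{u0, u1}"] ends by simp
  then have n: "2 \<le> n" by (simp add: n_def)
  have D1: "1 \<le> real D" using D[OF ends(1)] card_nbrs_ge_1[OF ends(1)] by linarith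
  define K where "K = 1 / (2 * h)"
  have K: "0 < K" using barrier by (simp add: K_def)
  have e: "exp 1 \<le> (3::real)" by (rule exp_le)
  have target: "card V / (100000 * real D * h) = n * K / (50000 * D)"
    by (simp add: K_def n_def)
  show ?thesis
  proof (cases "2 * ln (2 * n) \<le> K")
    case False
    have "ln (2 * n) \<le> ln (n * n)" using n by (subst ln_le_cancel_iff) auto
    also have "\<dots> = 2 * ln n" using n by (simp add: ln_mult)
    finally have "K \<le> 4 * ln n" using False by simp
    then have "n * K / (50000 * D) \<le> n * (4 * ln n) / (50000 * 1)"
      using n D1 by (intro frac_le mult_left_mono mult_nonneg_nonneg) auto
    also have "\<dots> \<le> n * ln n / 8192" using n by simp
    finally have "ennreal (n * K / (50000 * D)) \<le> ennreal (n * ln n / 8192)" by (rule ennreal_leI)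
    also note coupon_collector_lower[OF cV, folded n_def]
    finally show ?thesis unfolding target .
  next
    case True
    define Z where "Z f = (\<Sum>u\<in>V. exp (\<bar>f u - \<phi> u\<bar> / h))" for f
    \<comment> \<open>Up to time \<open>T\<close> the potential grows at most by the factor \<open>exp (K / 2)\<close>, half of the exponent it needs.\<close>
    define T where "T = nat \<lfloor>n * K / (2 * exp 1 * D)\<rfloor>"
    have Z_step: "(\<Sum>w\<in>V. Z (step f w)) / card V \<le> (1 + exp 1 * D / n) * Z f" for f
    proof -
      have upd: "Z (step f w) \<le> Z f + exp 1 * (\<Sum>v\<in>nbrs w. exp (\<bar>f v - \<phi> v\<bar> / h))" if w: "w \<in> V" for w
      proof -
        let ?s = "Max ((\<lambda>v. \<bar>f v - \<phi> v\<bar>) ` nbrs w)"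
        have "?s \<in> (\<lambda>v. \<bar>f v - \<phi> v\<bar>) ` nbrs w"
          using nbrs_nonempty[OF w] by (intro Max_in) auto
        then obtain v where v: "v \<in> nbrs w" "?s = \<bar>f v - \<phi> v\<bar>" by auto
        have "\<bar>p_mean p (nbrs w) f - \<phi> w\<bar> \<le> h + \<bar>f v - \<phi> v\<bar>"
          unfolding v(2)[symmetric] by (rule barrier_step[OF barrier(1) w]) simp
        then have "\<bar>p_mean p (nbrs w) f - \<phi> w\<bar> / h \<le> 1 + \<bar>f v - \<phi> v\<bar> / h"
          using barrier(2) by (simp add: field_simps)
        then have "exp (\<bar>p_mean p (nbrs w) f - \<phi> w\<bar> / h) \<le> exp 1 * exp (\<bar>f v - \<phi> v\<bar> / h)"
          by (simp flip: exp_add)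
        also have "\<dots> \<le> exp 1 * (\<Sum>v\<in>nbrs w. exp (\<bar>f v - \<phi> v\<bar> / h))"
          using v by (intro mult_left_mono member_le_sum) auto
        finally have new: "exp (\<bar>p_mean p (nbrs w) f - \<phi> w\<bar> / h)
            \<le> exp 1 * (\<Sum>v\<in>nbrs w. exp (\<bar>f v - \<phi> v\<bar> / h))" .
        have "Z (step f w) = exp (\<bar>p_mean p (nbrs w) f - \<phi> w\<bar> / h) + (\<Sum>u\<in>V - {w}. exp (\<bar>f u - \<phi> u\<bar> / h))"
          unfolding Z_def sum.remove[OF finite_V w] by (simp add: step_eq)
        also have "(\<Sum>u\<in>V - {w}. exp (\<bar>f u - \<phi> u\<bar> / h)) \<le> Z f"
          unfolding Z_def using finite_V by (intro sum_mono2) auto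
        finally show ?thesis using new by linarith
      qed
      have "(\<Sum>w\<in>V. \<Sum>v\<in>nbrs w. exp (\<bar>f v - \<phi> v\<bar> / h)) = (\<Sum>v\<in>V. card (nbrs v) * exp (\<bar>f v - \<phi> v\<bar> / h))"
        by (subst sum_nbrs_swap) simp
      also have "\<dots> \<le> (\<Sum>v\<in>V. D * exp (\<bar>f v - \<phi> v\<bar> / h))"
        using D by (intro sum_mono mult_right_mono) auto
      also have "\<dots> = D * Z f" by (simp add: Z_def sum_distrib_left)
      finally have *: "(\<Sum>w\<in>V. \<Sum>v\<in>nbrs w. exp (\<bar>f v - \<phi> v\<bar> / h)) \<le> D * Z f" .
      have "(\<Sum>w\<in>V. Z (step f w)) \<le> (\<Sum>w\<in>V. Z f + exp 1 * (\<Sum>v\<in>nbrs w. exp (\<bar>f v - \<phi> v\<bar> / h)))"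
        by (intro sum_mono upd)
      also have "\<dots> = n * Z f + exp 1 * (\<Sum>w\<in>V. \<Sum>v\<in>nbrs w. exp (\<bar>f v - \<phi> v\<bar> / h))"
        by (simp add: sum.distrib n_def sum_distrib_left)
      also have "\<dots> \<le> n * Z f + exp 1 * (D * Z f)"
        using * by (intro add_left_mono mult_left_mono) auto
      finally show ?thesis using n by (simp add: n_def field_simps)
    qed
    have Z_nonneg: "0 \<le> Z f" for f by (simp add: Z_def sum_nonneg)
    have Z_big: "exp K \<le> Z f" if "\<not> 1 / 2 < osc V f" for f
    proof -
      have "f u0 - f u1 \<le> 1 / 2" using osc_ge[OF ends(1,2), of f] that by simp
      then obtain u where u: "u \<in> V" "1 / 2 \<le> \<bar>f u - \<phi> u\<bar>"
        using ends by (cases "f u0 \<le> 1 / 2") (auto simp: abs_if)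
      have "K = (1 / 2) / h" by (simp add: K_def)
      also have "\<dots> \<le> \<bar>f u - \<phi> u\<bar> / h" using u barrier(2) by (intro divide_right_mono) auto
      finally have "exp K \<le> exp (\<bar>f u - \<phi> u\<bar> / h)" by simp
      also have "\<dots> \<le> Z f" unfolding Z_def using u finite_V by (intro member_le_sum) auto
      finally show ?thesis .
    qed
    have T: "real T \<le> n * K / (2 * exp 1 * D)" "n * K / (2 * exp 1 * D) \<le> real T + 1"
      using n K by (auto simp: T_def) 
    have "run_mean step V T (\<lambda>f. of_bool (\<not> 1 / 2 < osc V f)) \<phi> \<le> run_mean step V T Z \<phi> / exp K"
      by (rule run_mean_markov[where I = UNIV]) (use Z_nonneg Z_big in auto)
    also have "\<dots> \<le> ((1 + exp 1 * D / n) ^ T * Z \<phi>) / exp K"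
      by (intro divide_right_mono run_mean_geometric[where I = UNIV] Z_step) (use n in auto)
    also have "Z \<phi> = n" by (simp add: Z_def n_def)
    also have "(1 + exp 1 * D / n) ^ T * n / exp K \<le> exp (K / 2) * n / exp K"
    proof (intro divide_right_mono mult_right_mono)
      have "real T * (exp 1 * D / n) \<le> n * K / (2 * exp 1 * D) * (exp 1 * D / n)"
        using T n by (intro mult_right_mono) auto
      also have "\<dots> = K / 2" using n D1 by (simp add: field_simps)
      finally have "exp (real T * (exp 1 * D / n)) \<le> exp (K / 2)" by simp
      moreover have "(1 + exp 1 * D / n) ^ T \<le> exp (real T * (exp 1 * D / n))"
        using n by (intro one_plus_power_le_exp) auto
      ultimately show "(1 + exp 1 * D / n) ^ T \<le> exp (K / 2)" by (rule order_trans[rotated])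
    qed (use n in auto)
    also have "exp (K / 2) * n / exp K = n / exp (K / 2)"
    proof -
      have "exp K = exp (K / 2) * exp (K / 2)" by (simp flip: exp_add)
      then show ?thesis by simp
    qed
    also have "\<dots> \<le> n / (2 * n)"
    proof (rule divide_left_mono)
      have "exp (ln (2 * n)) \<le> exp (K / 2)" using True by simp
      then show "2 * n \<le> exp (K / 2)" using n by simp
    qed (use n in auto)
    also have "\<dots> = 1 / 2" using n by simp
    finally have "1 / 2 \<le> run_mean step V T (\<lambda>f. of_bool (1 / 2 < osc V f)) \<phi>"
      unfolding run_mean_not[OF finite_V V_nonempty] by simp
    moreover have "n * K / (50000 * D) \<le> (real T + 1) * (1 / 2)"
    proof -
      have "n * K / (50000 * D) \<le> n * K / (4 * exp 1 * D)"
        using n K D1 e by (intro divide_left_mono mult_right_mono) auto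
      also have "\<dots> = n * K / (2 * exp 1 * D) * (1 / 2)" by simp
      also have "\<dots> \<le> (real T + 1) * (1 / 2)" by (intro mult_right_mono T) simp
      finally show ?thesis .
    qed
    ultimately have "n * K / (50000 * D) \<le> (real T + 1) * run_mean step V T (\<lambda>f. of_bool (1 / 2 < osc V f)) \<phi>"
      using mult_left_mono[of "1 / 2" "run_mean step V T (\<lambda>f. of_bool (1 / 2 < osc V f)) \<phi>" "real T + 1"]
      by linarith
    then have "ennreal (n * K / (50000 * D))
      \<le> ennreal ((real T + 1) * run_mean step V T (\<lambda>f. of_bool (1 / 2 < osc V f)) \<phi>)"
      by (rule ennreal_leI)
    also have "\<dots> \<le> expected_consensus_time p V adj (1 / 2) \<phi>"
      by (rule expected_consensus_time_ge[OF finite_V V_nonempty])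
        (unfold p_dynamics_eq_run, erule less_le_trans, rule osc_run_antimono)
    also have "\<dots> \<le> (SUP f0\<in>profiles. expected_consensus_time p V adj (1 / 2) f0)"
      by (intro SUP_upper range)
    finally show ?thesis unfolding target .
  qed
qed

text \<open>For \<open>p = 2\<close> the expected profile evolves linearly, and at each step every vertex takes a
  fraction \<open>1 / n\<close> of its update. So the deviation from a barrier grows by \<open>h / n\<close> per step, without
  the factor \<open>D\<close> that chains of neighbors cost in the nonlinear case.\<close>

lemma run_mean_value_drift:
  assumes "p = 2" "barrier h \<phi>" "0 < h" "x \<in> V"
  shows "\<bar>run_mean step V t (\<lambda>f. f x) \<phi> - \<phi> x\<bar> \<le> t * h / card V"
  using assms(4)
proof (induction t arbitrary: x)
  case (Suc t)
  define n where "n = real (card V)"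
  have n: "1 \<le> n" using card_V_pos by (simp add: n_def Suc_le_eq)
  define a where "a v = run_mean step V t (\<lambda>f. f v) \<phi>" for v
  have avg: "(\<Sum>u\<in>V. step f u x) / card V = (1 - 1 / n) * f x + (1 / n) * p_mean p (nbrs x) f" for f
  proof -
    have "(\<Sum>u\<in>V. step f u x) = p_mean p (nbrs x) f + (\<Sum>u\<in>V - {x}. f x)"
      unfolding sum.remove[OF finite_V Suc.prems]
      by (intro arg_cong2[where f = "(+)"] sum.cong) (auto simp: step_eq)
    also have "(\<Sum>u\<in>V - {x}. f x) = (n - 1) * f x"
      using Suc.prems finite_V card_V_pos by (simp add: n_def of_nat_diff Suc_le_eq)
    finally have "(\<Sum>u\<in>V. step f u x) / card V = (p_mean p (nbrs x) f + (n - 1) * f x) / n"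
      by (simp add: n_def)
    also have "\<dots> = (1 - 1 / n) * f x + (1 / n) * p_mean p (nbrs x) f"
      using n by (simp add: field_simps)
    finally show ?thesis .
  qed
  have mean: "p_mean p (nbrs x) f = (\<Sum>v\<in>nbrs x. (1 / card (nbrs x)) * f v)" for f
    using p_mean_2[of "nbrs x" f] nbrs_nonempty[OF Suc.prems] assms(1)
    by (simp add: sum_divide_distrib)
  have "run_mean step V (Suc t) (\<lambda>f. f x) \<phi>
      = run_mean step V t (\<lambda>f. (1 - 1 / n) * f x + (1 / n) * (\<Sum>v\<in>nbrs x. (1 / card (nbrs x)) * f v)) \<phi>"
    unfolding run_mean_Suc_last avg mean ..
  also have "\<dots> = (1 - 1 / n) * a x + (1 / n) * p_mean p (nbrs x) a"
    unfolding run_mean_add run_mean_cmult run_mean_sum mean a_def ..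
  finally have eq: "run_mean step V (Suc t) (\<lambda>f. f x) \<phi> - \<phi> x
      = (1 - 1 / n) * (a x - \<phi> x) + (1 / n) * (p_mean p (nbrs x) a - \<phi> x)"
    by (simp add: algebra_simps)
  have IH: "\<bar>a v - \<phi> v\<bar> \<le> t * h / n" if "v \<in> V" for v
    using Suc.IH[OF that] by (simp add: a_def n_def)
  have "\<bar>p_mean p (nbrs x) a - \<phi> x\<bar> \<le> h + t * h / n"
    by (rule barrier_step[OF assms(2) Suc.prems]) (use IH nbrs_subset in auto)
  then have "(1 / n) * \<bar>p_mean p (nbrs x) a - \<phi> x\<bar> \<le> (1 / n) * (h + t * h / n)"
    using n by (intro mult_left_mono) auto
  moreover have "(1 - 1 / n) * \<bar>a x - \<phi> x\<bar> \<le> (1 - 1 / n) * (t * h / n)"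
    using n IH[OF Suc.prems] by (intro mult_left_mono) auto
  moreover have "(1 - 1 / n) * (t * h / n) + (1 / n) * (h + t * h / n) = Suc t * h / n"
    using n by (simp add: field_simps)
  moreover have "\<bar>(1 - 1 / n) * (a x - \<phi> x) + (1 / n) * (p_mean p (nbrs x) a - \<phi> x)\<bar>
      \<le> (1 - 1 / n) * \<bar>a x - \<phi> x\<bar> + (1 / n) * \<bar>p_mean p (nbrs x) a - \<phi> x\<bar>"
    using n by (intro order_trans[OF abs_triangle_ineq]) (simp add: abs_mult)
  ultimately show ?case unfolding eq n_def[symmetric] by linarith
qed simp

text \<open>The values at the two ends stay \<open>3/2\<close> apart in expectation for \<open>n / (4 * h)\<close> steps. As they are
  at most \<open>2\<close> apart, the oscillation exceeds \<open>1/2\<close> with probability at least \<open>2/3\<close>.\<close>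

lemma barrier_consensus_lower_2:
  assumes p2: "p = 2" and barrier: "barrier h \<phi>" "0 < h"
    and range: "\<phi> \<in> profiles" and ends: "u0 \<in> V" "u1 \<in> V" "\<phi> u0 = 1" "\<phi> u1 = - 1"
  shows "ennreal (card V / (6 * h))
    \<le> (SUP f0\<in>profiles. expected_consensus_time p V adj (1 / 2) f0)"
proof -
  define n where "n = real (card V)"
  have n: "0 < n" using card_V_pos by (simp add: n_def)
  define T where "T = nat \<lfloor>n / (4 * h)\<rfloor>"
  have T: "real T \<le> n / (4 * h)" "n / (4 * h) \<le> real T + 1"
    using n barrier(2) by (auto simp: T_def)
  let ?P = "run_mean step V T (\<lambda>f. of_bool (1 / 2 < osc V f)) \<phi>"
  have "real T * h / n \<le> 1 / 4" using T(1) n barrier(2) by (simp add: field_simps)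
  then have drift: "real T * h / card V \<le> 1 / 4" by (simp add: n_def)
  have "3 / 2 \<le> run_mean step V T (\<lambda>f. f u0) \<phi> - run_mean step V T (\<lambda>f. f u1) \<phi>"
    using run_mean_value_drift[OF p2 barrier ends(1), of T]
      run_mean_value_drift[OF p2 barrier ends(2), of T] drift
    unfolding ends by linarith
  also have "\<dots> = run_mean step V T (\<lambda>f. f u0 + (- 1) * f u1) \<phi>"
    unfolding run_mean_add run_mean_cmult by simp
  also have "\<dots> \<le> run_mean step V T (\<lambda>f. 1 / 2 + (3 / 2) * of_bool (1 / 2 < osc V f)) \<phi>"
  proof (rule run_mean_mono[where I = "{f. \<forall>v\<in>V. f v \<in> {-1..1}}"])
    show "step f u \<in> {f. \<forall>v\<in>V. f v \<in> {-1..1}}" if "f \<in> {f. \<forall>v\<in>V. f v \<in> {-1..1}}" "u \<in> V" for f u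
      using step_range[of f "-1" 1 u] that by blast
    show "f u0 + (- 1) * f u1 \<le> 1 / 2 + (3 / 2) * of_bool (1 / 2 < osc V f)"
      if "f \<in> {f. \<forall>v\<in>V. f v \<in> {-1..1}}" for f
    proof -
      have "f u0 \<le> 1" "- 1 \<le> f u1" using that ends(1,2) by auto
      then show ?thesis using osc_ge[OF ends(1,2), of f] by (cases "1 / 2 < osc V f") auto
    qed
  qed (use range in auto)
  also have "\<dots> = 1 / 2 + (3 / 2) * ?P"
    unfolding run_mean_add run_mean_cmult by (simp add: run_mean_const finite_V V_nonempty)
  finally have "2 / 3 \<le> ?P" by simp
  then have "(real T + 1) * (2 / 3) \<le> (real T + 1) * ?P" by (intro mult_left_mono) auto
  moreover have "n / (6 * h) \<le> (real T + 1) * (2 / 3)" using T(2) barrier(2) by (simp add: field_simps)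
  ultimately have "ennreal (n / (6 * h)) \<le> ennreal ((real T + 1) * ?P)" by (intro ennreal_leI) linarith
  also have "\<dots> \<le> expected_consensus_time p V adj (1 / 2) \<phi>"
    by (rule expected_consensus_time_ge[OF finite_V V_nonempty])
      (unfold p_dynamics_eq_run, erule less_le_trans, rule osc_run_antimono)
  also have "\<dots> \<le> (SUP f0\<in>profiles. expected_consensus_time p V adj (1 / 2) f0)"
    by (intro SUP_upper range)
  finally show ?thesis by (simp add: n_def)
qed

end

section \<open>Poincare inequalities on the box\<close>

lemma finite_lattice_box [simp]: "finite (lattice_box d L)"
  by (auto simp: lattice_box_def intro: finite_PiE)

lemma card_lattice_box: "card (lattice_box d L) = L ^ d"
  by (simp add: lattice_box_def card_PiE)

lemma lattice_box_less: "x \<in> lattice_box d L \<Longrightarrow> i < d \<Longrightarrow> x i < L"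
  by (auto simp: lattice_box_def PiE_iff)

lemma lattice_box_upd: "x \<in> lattice_box d L \<Longrightarrow> i < d \<Longrightarrow> j < L \<Longrightarrow> x(i := j) \<in> lattice_box d L"
  by (auto simp: lattice_box_def PiE_iff extensional_def)

lemma lattice_box_nonempty: "0 < L \<Longrightarrow> lattice_box d L \<noteq> {}"
  by (auto simp: lattice_box_def PiE_eq_empty_iff)

text \<open>Slices orthogonal to the last axis, for inductions on the dimension.\<close>

lemma sum_lattice_box_Suc:
  "(\<Sum>x\<in>lattice_box (Suc d) L. h x) = (\<Sum>j<L. \<Sum>x\<in>lattice_box d L. h (x(d := j)))"
proof -
  have "(\<Sum>x\<in>lattice_box (Suc d) L. h x)
      = (\<Sum>z\<in>{..<L} \<times> lattice_box d L. h ((\<lambda>(j, x). x(d := j)) z))"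
    unfolding lattice_box_def lessThan_Suc PiE_insert_eq
    by (subst sum.reindex) (use inj_combinator[of d "{..<d}" "\<lambda>_. {..<L}"] in \<open>auto simp: comp_def\<close>)
  then show ?thesis by (simp add: sum.cartesian_product case_prod_beta')
qed

lemma sum_sq_diff_eq:
  fixes a :: "nat \<Rightarrow> real"
  shows "(\<Sum>j<L. \<Sum>k<L. (a j - a k)\<^sup>2) = 2 * real L * (\<Sum>j<L. (a j)\<^sup>2) - 2 * (\<Sum>j<L. a j)\<^sup>2"
proof -
  have "(\<Sum>j<L. \<Sum>k<L. (a j - a k)\<^sup>2)
      = (\<Sum>j<L. real L * (a j)\<^sup>2 + (\<Sum>k<L. (a k)\<^sup>2) - 2 * a j * (\<Sum>k<L. a k))"
    by (simp add: power2_diff sum.distrib sum_subtractf sum_distrib_left)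
  also have "\<dots> = 2 * real L * (\<Sum>j<L. (a j)\<^sup>2) - 2 * (\<Sum>j<L. a j)\<^sup>2"
    by (simp add: sum.distrib sum_subtractf sum_distrib_left[symmetric] sum_distrib_right[symmetric] power2_eq_square)
  finally show ?thesis .
qed

text \<open>The variance is at most the sum over the axes of the mean variances along lines in that axis. By
  induction on \<open>d\<close>: the variances within the slices of the last axis are covered by the induction
  hypothesis, and what remains is the variance of the slice sums, which the Cauchy--Schwarz
  inequality bounds by the variances along the last axis. No factor \<open>d\<close> is lost.\<close>

lemma efron_stein_lattice_box:
  fixes g :: "(nat \<Rightarrow> nat) \<Rightarrow> real"
  assumes "0 < L"
  shows "(\<Sum>x\<in>lattice_box d L. (g x)\<^sup>2) - (\<Sum>x\<in>lattice_box d L. g x)\<^sup>2 / real L ^ d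
    \<le> (\<Sum>i<d. (1 / (2 * real L)) * (\<Sum>x\<in>lattice_box d L. \<Sum>k<L. (g x - g (x(i := k)))\<^sup>2))"
proof (induction d arbitrary: g)
  case 0
  show ?case by (simp add: lattice_box_def)
next
  case (Suc d)
  define N where "N = real (L ^ d)"
  have N: "0 < N" using assms by (simp add: N_def)
  define G where "G j = (\<Sum>x\<in>lattice_box d L. g (x(d := j)))" for j
  have "(\<Sum>j<L. (G j)\<^sup>2) / N - (\<Sum>j<L. G j)\<^sup>2 / (N * real L)
      = (1 / (2 * real L)) * ((1 / N) * (2 * real L * (\<Sum>j<L. (G j)\<^sup>2) - 2 * (\<Sum>j<L. G j)\<^sup>2))"
    using N assms by (simp add: field_simps)
  also have "\<dots> = (1 / (2 * real L)) * (\<Sum>j<L. \<Sum>k<L. (1 / N) * (G j - G k)\<^sup>2)"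
    unfolding sum_sq_diff_eq[symmetric] by (simp add: sum_distrib_left)
  also have "\<dots> \<le> (1 / (2 * real L)) * (\<Sum>j<L. \<Sum>k<L. \<Sum>x\<in>lattice_box d L. (g (x(d := j)) - g (x(d := k)))\<^sup>2)"
  proof (intro mult_left_mono sum_mono)
    fix j k
    have "(G j - G k)\<^sup>2 = (\<Sum>x\<in>lattice_box d L. g (x(d := j)) - g (x(d := k)))\<^sup>2"
      by (simp add: G_def sum_subtractf)
    also have "\<dots> \<le> (\<Sum>x\<in>lattice_box d L. (g (x(d := j)) - g (x(d := k)))\<^sup>2) * N"
      using sum_squared_le_sum_of_squares[of "\<lambda>x. g (x(d := j)) - g (x(d := k))" "lattice_box d L"]
      by (simp add: N_def card_lattice_box)
    finally show "(1 / N) * (G j - G k)\<^sup>2 \<le> (\<Sum>x\<in>lattice_box d L. (g (x(d := j)) - g (x(d := k)))\<^sup>2)"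
      using N by (simp add: field_simps)
  qed simp
  also have "(\<Sum>j<L. \<Sum>k<L. \<Sum>x\<in>lattice_box d L. (g (x(d := j)) - g (x(d := k)))\<^sup>2)
      = (\<Sum>x\<in>lattice_box (Suc d) L. \<Sum>k<L. (g x - g (x(d := k)))\<^sup>2)"
    unfolding sum_lattice_box_Suc by (intro sum.cong refl) (subst sum.swap, simp)
  finally have last: "(\<Sum>j<L. (G j)\<^sup>2) / N - (\<Sum>j<L. G j)\<^sup>2 / (N * real L)
      \<le> (1 / (2 * real L)) * (\<Sum>x\<in>lattice_box (Suc d) L. \<Sum>k<L. (g x - g (x(d := k)))\<^sup>2)" .
  have "(\<Sum>j<L. (\<Sum>x\<in>lattice_box d L. (g (x(d := j)))\<^sup>2) - (G j)\<^sup>2 / N)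
      \<le> (\<Sum>j<L. \<Sum>i<d. (1 / (2 * real L)) * (\<Sum>x\<in>lattice_box d L. \<Sum>k<L. (g (x(d := j)) - g (x(i := k, d := j)))\<^sup>2))"
    unfolding G_def N_def of_nat_power by (intro sum_mono Suc.IH)
  also have "\<dots> = (\<Sum>i<d. (1 / (2 * real L)) * (\<Sum>x\<in>lattice_box (Suc d) L. \<Sum>k<L. (g x - g (x(i := k)))\<^sup>2))"
    unfolding sum_lattice_box_Suc sum_distrib_left
    by (subst sum.swap) (intro sum.cong refl, simp add: fun_upd_twist)
  finally have slices: "(\<Sum>j<L. (\<Sum>x\<in>lattice_box d L. (g (x(d := j)))\<^sup>2)) - (\<Sum>j<L. (G j)\<^sup>2) / N
      \<le> (\<Sum>i<d. (1 / (2 * real L)) * (\<Sum>x\<in>lattice_box (Suc d) L. \<Sum>k<L. (g x - g (x(i := k)))\<^sup>2))"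
    by (simp add: sum_subtractf sum_divide_distrib)
  have "(\<Sum>x\<in>lattice_box (Suc d) L. (g x)\<^sup>2) - (\<Sum>x\<in>lattice_box (Suc d) L. g x)\<^sup>2 / real L ^ Suc d
      = ((\<Sum>j<L. (\<Sum>x\<in>lattice_box d L. (g (x(d := j)))\<^sup>2)) - (\<Sum>j<L. (G j)\<^sup>2) / N)
        + ((\<Sum>j<L. (G j)\<^sup>2) / N - (\<Sum>j<L. G j)\<^sup>2 / (N * real L))"
    unfolding sum_lattice_box_Suc G_def[symmetric] by (simp add: N_def mult.commute)
  also have "\<dots> \<le> (\<Sum>i<Suc d. (1 / (2 * real L)) * (\<Sum>x\<in>lattice_box (Suc d) L. \<Sum>k<L. (g x - g (x(i := k)))\<^sup>2))"
    unfolding sum.lessThan_Suc by (intro add_mono slices last)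
  finally show ?case .
qed

text \<open>The map \<open>(x, a) \<mapsto> (x(i := a), x i)\<close> is an involution.\<close>

lemma sum_over_lines:
  fixes H :: "(nat \<Rightarrow> nat) \<Rightarrow> real"
  assumes "i < d"
  shows "(\<Sum>x\<in>lattice_box d L. \<Sum>a<L. H (x(i := a))) = real L * (\<Sum>x\<in>lattice_box d L. H x)"
proof -
  have "(\<Sum>x\<in>lattice_box d L. \<Sum>a<L. H (x(i := a)))
      = (\<Sum>(x, a)\<in>lattice_box d L \<times> {..<L}. H (x(i := a)))"
    by (simp add: sum.cartesian_product)
  also have "\<dots> = (\<Sum>(x, a)\<in>lattice_box d L \<times> {..<L}. H x)"
    by (rule sum.reindex_bij_witness[where i = "\<lambda>(x, a). (x(i := a), x i)" and j = "\<lambda>(x, a). (x(i := a), x i)"])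
      (use assms in \<open>auto simp: lattice_box_upd lattice_box_less\<close>)
  also have "\<dots> = real L * (\<Sum>x\<in>lattice_box d L. H x)"
    by (simp add: sum.cartesian_product[symmetric] sum_distrib_left)
  finally show ?thesis .
qed

lemma path_abs_diff_powr_le:
  fixes F :: "nat \<Rightarrow> real"
  assumes "1 < r" "a < L" "b < L"
  shows "\<bar>F a - F b\<bar> powr r \<le> real L powr (r - 1) * (\<Sum>j<L. if j + 1 < L then \<bar>F (j + 1) - F j\<bar> powr r else 0)"
proof -
  have main: "\<bar>F a - F b\<bar> powr r \<le> real L powr (r - 1) * (\<Sum>j<L. if j + 1 < L then \<bar>F (j + 1) - F j\<bar> powr r else 0)"
    if "b \<le> a" "a < L" for a b
  proof -
    have "F a - F b = (\<Sum>j\<in>{b..<a}. F (j + 1) - F j)"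
      using sum_Suc_diff'[OF that(1), of F] by simp
    then have "\<bar>F a - F b\<bar> powr r
        \<le> real (card {b..<a}) powr (r - 1) * (\<Sum>j\<in>{b..<a}. \<bar>F (j + 1) - F j\<bar> powr r)"
      using power_mean_le[OF assms(1), of "{b..<a}" "\<lambda>j. F (j + 1) - F j"] by simp
    also have "\<dots> \<le> real L powr (r - 1) * (\<Sum>j\<in>{b..<a}. if j + 1 < L then \<bar>F (j + 1) - F j\<bar> powr r else 0)"
      using that assms by (intro mult_mono powr_mono2 sum_mono sum_nonneg) auto
    also have "\<dots> \<le> real L powr (r - 1) * (\<Sum>j<L. if j + 1 < L then \<bar>F (j + 1) - F j\<bar> powr r else 0)"
      using that by (intro mult_left_mono sum_mono2) auto
    finally show ?thesis .
  qed
  show ?thesis using main[of b a] main[of a b] assms by (cases "b \<le> a") (auto simp: abs_minus_commute)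
qed

text \<open>The part of the \<open>r\<close>-energy carried by the edges parallel to the axis \<open>i\<close>, each counted once.\<close>

definition axis_energy :: "nat \<Rightarrow> nat \<Rightarrow> real \<Rightarrow> nat \<Rightarrow> ((nat \<Rightarrow> nat) \<Rightarrow> real) \<Rightarrow> real" where
  "axis_energy d L r i f =
    (\<Sum>x\<in>lattice_box d L. if x i + 1 < L then \<bar>f (x(i := x i + 1)) - f x\<bar> powr r else 0)"

text \<open>On a line the bound is the power mean inequality along the path between two points; averaging
  over lines turns it into a statement about the box.\<close>

lemma axis_poincare:
  assumes "1 < r" "i < d" "0 < L"
  shows "(\<Sum>x\<in>lattice_box d L. \<Sum>b<L. \<bar>f x - f (x(i := b))\<bar> powr r)
    \<le> real L powr (r + 1) * axis_energy d L r i f"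
proof -
  define H where "H x = (if x i + 1 < L then \<bar>f (x(i := x i + 1)) - f x\<bar> powr r else 0)" for x
  have "real L * (\<Sum>x\<in>lattice_box d L. \<Sum>b<L. \<bar>f x - f (x(i := b))\<bar> powr r)
      = (\<Sum>x\<in>lattice_box d L. \<Sum>a<L. \<Sum>b<L. \<bar>f (x(i := a)) - f (x(i := b))\<bar> powr r)"
    using sum_over_lines[OF assms(2), of "\<lambda>x. \<Sum>b<L. \<bar>f x - f (x(i := b))\<bar> powr r" L] by simp
  also have "\<dots> \<le> (\<Sum>x\<in>lattice_box d L. \<Sum>a<L. \<Sum>b<L. real L powr (r - 1) * (\<Sum>j<L. H (x(i := j))))"
  proof (intro sum_mono)
    fix x a b assume "a \<in> {..<L}" "b \<in> {..<L}"
    then show "\<bar>f (x(i := a)) - f (x(i := b))\<bar> powr r \<le> real L powr (r - 1) * (\<Sum>j<L. H (x(i := j)))"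
      using path_abs_diff_powr_le[OF assms(1), of a L b "\<lambda>a. f (x(i := a))"]
      by (simp add: H_def cong: if_cong)
  qed
  also have "\<dots> = real L powr (r - 1) * real L * real L * (\<Sum>x\<in>lattice_box d L. \<Sum>j<L. H (x(i := j)))"
    by (simp add: sum_distrib_left mult_ac)
  also have "\<dots> = real L * (real L powr (r + 1) * (\<Sum>x\<in>lattice_box d L. H x))"
    unfolding sum_over_lines[OF assms(2)] using assms(3) by (simp add: powr_add powr_diff)
  finally show ?thesis using assms(3) by (simp add: H_def axis_energy_def)
qed

lemma p_graph_lattice_box:
  assumes "1 < p" "1 \<le> d" "2 \<le> L"
  shows "p_graph p (lattice_box d L) (box_adj d)"
proof
  show "finite (lattice_box d L)" "1 < p" using assms by auto
  show "lattice_box d L \<noteq> {}" using assms by (intro lattice_box_nonempty) auto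
  show "box_adj d v u" if "box_adj d u v" for u v using that by (auto simp: box_adj_def)
  show "\<not> box_adj d u u" for u by (auto simp: box_adj_def fun_eq_iff)
  show "\<exists>v\<in>lattice_box d L. box_adj d u v" if u: "u \<in> lattice_box d L" for u
  proof (cases "u 0 + 1 < L")
    case True
    then show ?thesis using assms u
      by (intro bexI[of _ "u(0 := u 0 + 1)"] lattice_box_upd) (auto simp: box_adj_def)
  next
    case False
    have "u 0 < L" using assms u by (intro lattice_box_less[of u d]) auto
    then show ?thesis using False assms u
      by (intro bexI[of _ "u(0 := u 0 - 1)"] lattice_box_upd)
        (auto simp: box_adj_def intro!: exI[of _ 0])
  qed
qed

locale box_graph =
  fixes p :: real and d L :: nat
  assumes p: "1 < p" and d: "2 \<le> d" and L: "2 \<le> L"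
begin

sublocale p_graph p "lattice_box d L" "box_adj d"
  using p d L by (intro p_graph_lattice_box) auto

text \<open>Sorting the neighbors by axis and orientation makes sums over neighbors computable.\<close>

lemma sum_nbrs_box:
  fixes F :: "(nat \<Rightarrow> nat) \<Rightarrow> real"
  assumes x: "x \<in> lattice_box d L"
  shows "(\<Sum>v\<in>nbrs x. F v) = (\<Sum>i<d. (if x i + 1 < L then F (x(i := x i + 1)) else 0)
    + (if 0 < x i then F (x(i := x i - 1)) else 0))"
proof -
  let ?A = "{i \<in> {..<d}. x i + 1 < L}" and ?B = "{i \<in> {..<d}. 0 < x i}"
  let ?up = "\<lambda>i. x(i := x i + 1)" and ?dn = "\<lambda>i. x(i := x i - 1)"
  have up_inj: "inj_on ?up ?A" by (rule inj_onI) (auto simp: fun_eq_iff split: if_splits)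
  have dn_inj: "inj_on ?dn ?B"
  proof (rule inj_onI)
    fix i j assume ij: "i \<in> ?B" "j \<in> ?B" and eq: "x(i := x i - 1) = x(j := x j - 1)"
    show "i = j"
    proof (rule ccontr)
      assume "i \<noteq> j"
      then have "x i - 1 = x i" using fun_cong[OF eq, of i] by simp
      moreover have "0 < x i" using ij by simp
      ultimately show False by linarith
    qed
  qed
  have disj: "?up ` ?A \<inter> ?dn ` ?B = {}"
  proof safe
    fix i j assume eq: "x(i := x i + 1) = x(j := x j - 1)"
    have "x i + 1 = (if i = j then x i - 1 else x i)"
      using fun_cong[OF eq, of i] by (auto split: if_splits)
    then have False by (auto split: if_splits)
    then show "x(i := x i + 1) \<in> {}" ..
  qed
  have nbrs_eq: "nbrs x = ?up ` ?A \<union> ?dn ` ?B"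
  proof (intro set_eqI iffI)
    fix v assume "v \<in> nbrs x"
    then obtain i where v: "v \<in> lattice_box d L" "i < d"
      and "v = x(i := x i + 1) \<or> x = v(i := v i + 1)"
      by (auto simp: nbrs_def box_adj_def)
    then consider "v = x(i := x i + 1)" | "x = v(i := v i + 1)" by blast
    then show "v \<in> ?up ` ?A \<union> ?dn ` ?B"
    proof cases
      case 1
      then have "x i + 1 < L" using lattice_box_less[OF v] by simp
      then have "i \<in> ?A" using v(2) by simp
      then show ?thesis using 1 by blast
    next
      case 2
      then have xi: "x i = v i + 1" by (metis fun_upd_same)
      have "v = x(i := x i - 1)"
      proof
        fix k show "v k = (x(i := x i - 1)) k" using fun_cong[OF 2, of k] xi by auto
      qed
      moreover have "i \<in> ?B" using v(2) xi by simp
      ultimately show ?thesis by blast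
    qed
  next
    fix v assume "v \<in> ?up ` ?A \<union> ?dn ` ?B"
    then show "v \<in> nbrs x"
    proof
      assume "v \<in> ?up ` ?A"
      then show ?thesis using x by (auto simp: nbrs_def box_adj_def intro: lattice_box_upd)
    next
      assume "v \<in> ?dn ` ?B"
      then obtain i where i: "i < d" "0 < x i" and v: "v = x(i := x i - 1)" by auto
      have "x i - 1 < L" using lattice_box_less[OF x i(1)] by simp
      then have "v \<in> lattice_box d L" unfolding v by (rule lattice_box_upd[OF x i(1)])
      moreover have "x = v(i := v i + 1)" unfolding v using i by (auto simp: fun_eq_iff)
      then have "box_adj d x v" using i(1) unfolding box_adj_def by blast
      ultimately show ?thesis by (simp add: nbrs_def)
    qed
  qed
  have "(\<Sum>v\<in>nbrs x. F v) = (\<Sum>v\<in>?up ` ?A. F v) + (\<Sum>v\<in>?dn ` ?B. F v)"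
    unfolding nbrs_eq by (rule sum.union_disjoint[OF _ _ disj]) auto
  also have "\<dots> = (\<Sum>i\<in>?A. F (?up i)) + (\<Sum>i\<in>?B. F (?dn i))"
    by (simp only: sum.reindex[OF up_inj] sum.reindex[OF dn_inj] comp_def)
  also have "\<dots> = (\<Sum>i<d. (if x i + 1 < L then F (?up i) else 0)) + (\<Sum>i<d. if 0 < x i then F (?dn i) else 0)"
    by (simp only: sum.inter_filter finite_lessThan)
  finally show ?thesis by (simp add: sum.distrib)
qed

lemma card_nbrs_le: "x \<in> lattice_box d L \<Longrightarrow> card (nbrs x) \<le> 2 * d"
proof -
  assume x: "x \<in> lattice_box d L"
  have "real (card (nbrs x)) = (\<Sum>v\<in>nbrs x. 1)" by simp
  also have "\<dots> \<le> (\<Sum>i<d. 2)" unfolding sum_nbrs_box[OF x] by (intro sum_mono) auto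
  finally show ?thesis by (simp flip: of_nat_le_iff)
qed

lemma real_card_nbrs_le: "x \<in> lattice_box d L \<Longrightarrow> real (card (nbrs x)) \<le> 2 * real d"
  using card_nbrs_le[of x] by linarith

lemma sum_axis_energy_le:
  "(\<Sum>i<d. axis_energy d L r i f) \<le> (\<Sum>x\<in>lattice_box d L. \<Sum>v\<in>nbrs x. \<bar>f x - f v\<bar> powr r)"
proof -
  have "(\<Sum>i<d. axis_energy d L r i f)
      = (\<Sum>x\<in>lattice_box d L. \<Sum>i<d. if x i + 1 < L then \<bar>f (x(i := x i + 1)) - f x\<bar> powr r else 0)"
    unfolding axis_energy_def by (rule sum.swap)
  also have "\<dots> \<le> (\<Sum>x\<in>lattice_box d L. \<Sum>v\<in>nbrs x. \<bar>f x - f v\<bar> powr r)"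
  proof (intro sum_mono)
    fix x assume x: "x \<in> lattice_box d L"
    show "(\<Sum>i<d. if x i + 1 < L then \<bar>f (x(i := x i + 1)) - f x\<bar> powr r else 0)
        \<le> (\<Sum>v\<in>nbrs x. \<bar>f x - f v\<bar> powr r)"
      unfolding sum_nbrs_box[OF x] by (intro sum_mono) (auto simp: abs_minus_commute)
  qed
  finally show ?thesis .
qed

text \<open>This balance is the optimality condition of the mean with exponent \<open>p / 2 + 1\<close>, so \<open>m\<close> can be
  taken to be that mean. It allows the variance inequality to be used for the signed power.\<close>

lemma centered_power:
  obtains m where "(\<Sum>x\<in>lattice_box d L. signed_powr (p / 2) (m - f x)) = 0"
  using sum_signed_powr_p_mean[of "p / 2 + 1" "lattice_box d L" f] p V_nonempty by auto

lemma efron_stein_centered: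
  assumes "(\<Sum>x\<in>lattice_box d L. signed_powr (p / 2) (m - f x)) = 0"
  shows "(\<Sum>x\<in>lattice_box d L. \<bar>f x - m\<bar> powr p)
    \<le> (\<Sum>i<d. (1 / (2 * real L)) * (\<Sum>x\<in>lattice_box d L. \<Sum>k<L.
        \<bar>signed_powr (p / 2) (m - f x) - signed_powr (p / 2) (m - f (x(i := k)))\<bar> powr 2))"
proof -
  have sq: "(signed_powr (p / 2) (m - f x))\<^sup>2 = \<bar>f x - m\<bar> powr p" for x
  proof -
    have "(signed_powr (p / 2) (m - f x))\<^sup>2 = (\<bar>m - f x\<bar> powr (p / 2))\<^sup>2"
      by (metis abs_signed_powr power2_abs)
    also have "\<dots> = \<bar>m - f x\<bar> powr p"
      by (simp add: power2_eq_square flip: powr_add)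
    finally show ?thesis by (simp add: abs_minus_commute)
  qed
  show ?thesis
    using efron_stein_lattice_box[of L "\<lambda>x. signed_powr (p / 2) (m - f x)" d] L
    unfolding assms sq by simp
qed

text \<open>For \<open>p \<le> 2\<close> the signed power \<open>p / 2\<close> is Hoelder continuous, so its squared differences along lines
  are at most \<open>4\<close> times the \<open>p\<close>-th powers of the differences of \<open>f\<close>. Passing to lines before
  using edges is essential: on edges the same estimate would give \<open>L\<^sup>2\<close> in place of \<open>L powr p\<close>.\<close>

lemma poincare_box_le_2:
  assumes "p \<le> 2"
  shows "poincare ((4 * real d * L powr p) powr (1 / p))"
  unfolding poincare_def
proof
  fix f
  obtain m where m: "(\<Sum>x\<in>lattice_box d L. signed_powr (p / 2) (m - f x)) = 0"
    using centered_power .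
  define S where "S = (\<Sum>x\<in>lattice_box d L. \<bar>f x - m\<bar> powr p)"
  have "S \<le> (\<Sum>i<d. (1 / (2 * real L)) * (\<Sum>x\<in>lattice_box d L. \<Sum>k<L. 4 * \<bar>f x - f (x(i := k))\<bar> powr p))"
    unfolding S_def
  proof (rule order_trans[OF efron_stein_centered[OF m]], intro sum_mono mult_left_mono)
    fix x :: "nat \<Rightarrow> nat" and i k :: nat
    let ?y = "x(i := k)"
    have "\<bar>signed_powr (p / 2) (m - f x) - signed_powr (p / 2) (m - f ?y)\<bar> \<le> 2 * \<bar>f x - f ?y\<bar> powr (p / 2)"
      using signed_powr_holder[of "p / 2" "m - f x" "m - f ?y"] p assms by (simp add: abs_minus_commute)
    then have "\<bar>signed_powr (p / 2) (m - f x) - signed_powr (p / 2) (m - f ?y)\<bar> powr 2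
        \<le> (2 * \<bar>f x - f ?y\<bar> powr (p / 2)) powr 2"
      by (intro powr_mono2) auto
    also have "\<dots> = 4 * \<bar>f x - f ?y\<bar> powr p"
      by (simp add: powr_mult powr_powr)
    finally show "\<bar>signed_powr (p / 2) (m - f x) - signed_powr (p / 2) (m - f ?y)\<bar> powr 2 \<le> 4 * \<bar>f x - f ?y\<bar> powr p" .
  qed simp
  also have "\<dots> = (\<Sum>i<d. (2 / real L) * (\<Sum>x\<in>lattice_box d L. \<Sum>k<L. \<bar>f x - f (x(i := k))\<bar> powr p))"
    by (simp add: sum_distrib_left[symmetric])
  also have "\<dots> \<le> (\<Sum>i<d. (2 / real L) * (L powr (p + 1) * axis_energy d L p i f))"
    using p L by (intro sum_mono mult_left_mono axis_poincare) auto
  also have "\<dots> = 2 * L powr p * (\<Sum>i<d. axis_energy d L p i f)"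
    using L by (simp add: sum_distrib_left powr_add mult.assoc)
  also have "\<dots> \<le> 2 * L powr p * energy f"
    unfolding energy_def by (intro mult_left_mono sum_axis_energy_le) auto
  finally have S: "S \<le> 2 * L powr p * energy f" .
  have "(\<Sum>x\<in>lattice_box d L. real (card (nbrs x)) * \<bar>f x - m\<bar> powr p) \<le> 2 * real d * S"
    unfolding S_def sum_distrib_left by (intro sum_mono mult_right_mono real_card_nbrs_le) auto
  also have "\<dots> \<le> 2 * real d * (2 * L powr p * energy f)" using S by (intro mult_left_mono) auto
  also have "\<dots> = ((4 * real d * L powr p) powr (1 / p)) powr p * energy f"
    using p d L by (simp add: powr_powr)
  finally show "\<exists>m. (\<Sum>x\<in>lattice_box d L. card (nbrs x) * \<bar>f x - m\<bar> powr p)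
      \<le> ((4 * real d * L powr p) powr (1 / p)) powr p * energy f" ..
qed

text \<open>For \<open>p \<ge> 2\<close> the squared edge differences of the signed power are at most a constant times
  \<open>\<bar>f - m\<bar> powr (p - 2)\<close> times the squared differences of \<open>f\<close>. Young's inequality splits this product,
  and at the scale \<open>l = p * L * sqrt d\<close> the part with \<open>f - m\<close> is half of the sum to be bounded.\<close>

lemma poincare_box_ge_2:
  assumes "2 \<le> p"
  shows "poincare (p * real L * sqrt (real d))"
  unfolding poincare_def
proof
  fix f
  obtain m where m: "(\<Sum>x\<in>lattice_box d L. signed_powr (p / 2) (m - f x)) = 0"
    using centered_power .
  define S where "S = (\<Sum>x\<in>lattice_box d L. \<bar>f x - m\<bar> powr p)"
  define g where "g x = signed_powr (p / 2) (m - f x)" for x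
  define l where "l = p * real L * sqrt (real d)"
  have l: "0 < l" using p d L by (simp add: l_def)
  have l2: "l\<^sup>2 = p\<^sup>2 * (real L)\<^sup>2 * real d" by (simp add: l_def power_mult_distrib)
  have deg: "(\<Sum>x\<in>lattice_box d L. real (card (nbrs x)) * \<bar>f x - m\<bar> powr p) \<le> 2 * real d * S"
    unfolding S_def sum_distrib_left by (intro sum_mono mult_right_mono real_card_nbrs_le) auto
  have lip: "\<bar>g x - g v\<bar> powr 2
      \<le> (p\<^sup>2 / 4) * (\<bar>f x - m\<bar> powr (p - 2) * (f x - f v)\<^sup>2 + \<bar>f v - m\<bar> powr (p - 2) * (f v - f x)\<^sup>2)" for x v
  proof -
    let ?c = "max \<bar>f x - m\<bar> \<bar>f v - m\<bar>"
    have "\<bar>g x - g v\<bar> \<le> (p / 2) * ?c powr (p / 2 - 1) * \<bar>(m - f x) - (m - f v)\<bar>"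
      unfolding g_def using assms by (intro signed_powr_lipschitz) (auto simp: abs_minus_commute)
    then have "\<bar>g x - g v\<bar>\<^sup>2 \<le> ((p / 2) * ?c powr (p / 2 - 1) * \<bar>(m - f x) - (m - f v)\<bar>)\<^sup>2"
      by (intro power_mono) auto
    also have "\<dots> = (p\<^sup>2 / 4) * (?c powr (p - 2) * (f x - f v)\<^sup>2)"
    proof -
      have "(?c powr (p / 2 - 1))\<^sup>2 = ?c powr (p - 2)"
        by (simp add: power2_eq_square flip: powr_add)
      then show ?thesis by (simp add: power_mult_distrib power_divide power2_commute)
    qed
    also have "\<dots> \<le> (p\<^sup>2 / 4) * ((\<bar>f x - m\<bar> powr (p - 2) + \<bar>f v - m\<bar> powr (p - 2)) * (f x - f v)\<^sup>2)"
      by (intro mult_left_mono mult_right_mono) (auto simp: max_def)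
    finally show ?thesis by (simp add: distrib_right power2_commute)
  qed
  define Y where "Y = (\<Sum>x\<in>lattice_box d L. \<Sum>v\<in>nbrs x. \<bar>f x - m\<bar> powr (p - 2) * (f x - f v)\<^sup>2)"
  have "S \<le> (\<Sum>i<d. (1 / (2 * real L)) * (\<Sum>x\<in>lattice_box d L. \<Sum>k<L. \<bar>g x - g (x(i := k))\<bar> powr 2))"
    unfolding S_def g_def by (rule efron_stein_centered[OF m])
  also have "\<dots> \<le> (\<Sum>i<d. (1 / (2 * real L)) * (L powr (2 + 1) * axis_energy d L 2 i g))"
    using L by (intro sum_mono mult_left_mono axis_poincare) auto
  also have "\<dots> = (real L)\<^sup>2 / 2 * (\<Sum>i<d. axis_energy d L 2 i g)"
    using L by (simp add: sum_distrib_left power2_eq_square power3_eq_cube mult.assoc)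
  also have "\<dots> \<le> (real L)\<^sup>2 / 2 * (\<Sum>x\<in>lattice_box d L. \<Sum>v\<in>nbrs x. \<bar>g x - g v\<bar> powr 2)"
    by (intro mult_left_mono sum_axis_energy_le) auto
  also have "\<dots> \<le> (real L)\<^sup>2 / 2 * (\<Sum>x\<in>lattice_box d L. \<Sum>v\<in>nbrs x. (p\<^sup>2 / 4)
      * (\<bar>f x - m\<bar> powr (p - 2) * (f x - f v)\<^sup>2 + \<bar>f v - m\<bar> powr (p - 2) * (f v - f x)\<^sup>2))"
    by (intro mult_left_mono sum_mono lip) auto
  also have "\<dots> = (real L)\<^sup>2 / 2 * ((p\<^sup>2 / 4) * (Y
      + (\<Sum>x\<in>lattice_box d L. \<Sum>v\<in>nbrs x. \<bar>f v - m\<bar> powr (p - 2) * (f v - f x)\<^sup>2)))"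
    by (simp only: Y_def sum.distrib sum_distrib_left distrib_left)
  also have "(\<Sum>x\<in>lattice_box d L. \<Sum>v\<in>nbrs x. \<bar>f v - m\<bar> powr (p - 2) * (f v - f x)\<^sup>2) = Y"
    unfolding Y_def by (rule sum_nbrs_swap)
  finally have SY: "S \<le> p\<^sup>2 * (real L)\<^sup>2 / 4 * Y" by (simp add: mult_ac)
  have "Y \<le> (\<Sum>x\<in>lattice_box d L. \<Sum>v\<in>nbrs x. (\<bar>f x - m\<bar> powr p + l powr p * \<bar>f x - f v\<bar> powr p) / l\<^sup>2)"
    unfolding Y_def by (intro sum_mono scaled_young assms l)
  also have "\<dots> = ((\<Sum>x\<in>lattice_box d L. card (nbrs x) * \<bar>f x - m\<bar> powr p) + l powr p * energy f) / l\<^sup>2"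
    unfolding energy_def sum_divide_distrib[symmetric] sum.distrib sum_distrib_left[symmetric]
    by (simp add: mult.commute)
  also have "\<dots> \<le> (2 * real d * S + l powr p * energy f) / l\<^sup>2"
    using deg by (intro divide_right_mono) auto
  finally have Y: "Y \<le> (2 * real d * S + l powr p * energy f) / l\<^sup>2" .
  have "4 * real d * S \<le> 4 * real d * (p\<^sup>2 * (real L)\<^sup>2 / 4 * Y)" using SY by (intro mult_left_mono) auto
  also have "\<dots> = l\<^sup>2 * Y" by (simp add: l2)
  also have "\<dots> \<le> 2 * real d * S + l powr p * energy f" using Y l by (simp add: field_simps)
  finally have "2 * real d * S \<le> l powr p * energy f" by linarith
  with deg have "(\<Sum>x\<in>lattice_box d L. real (card (nbrs x)) * \<bar>f x - m\<bar> powr p) \<le> l powr p * energy f"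
    by linarith
  then show "\<exists>m. (\<Sum>x\<in>lattice_box d L. card (nbrs x) * \<bar>f x - m\<bar> powr p)
      \<le> (p * real L * sqrt (real d)) powr p * energy f" unfolding l_def ..
qed

end

section \<open>Consensus bounds on the box\<close>

context p_graph
begin

lemma energy_profile_le:
  assumes "f \<in> profiles"
  shows "energy f \<le> (real (card V))\<^sup>2 * 2 powr p"
proof -
  have "energy f \<le> (\<Sum>u\<in>V. \<Sum>v\<in>nbrs u. 2 powr p)"
    unfolding energy_def
  proof (intro sum_mono powr_mono2)
    fix u v assume "u \<in> V" "v \<in> nbrs u"
    then have "f u \<in> {-1..1}" "f v \<in> {-1..1}" using assms nbrs_subset by auto
    then show "\<bar>f u - f v\<bar> \<le> 2" by auto
  qed (use p_gt_1 in auto)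
  also have "\<dots> \<le> (\<Sum>u\<in>V. real (card V) * 2 powr p)"
  proof (rule sum_mono)
    fix u
    have "card (nbrs u) \<le> card V" using nbrs_subset by (intro card_mono finite_V) auto
    then show "(\<Sum>v\<in>nbrs u. 2 powr p) \<le> real (card V) * 2 powr p" by simp
  qed
  also have "\<dots> = (real (card V))\<^sup>2 * 2 powr p" by (simp add: power2_eq_square)
  finally show ?thesis .
qed

text \<open>All quantities inside the logarithm, namely the initial energy, the length \<open>X\<close> and \<open>1 / \<epsilon>\<close>, are
  polynomial in \<open>n / \<epsilon>\<close>, hence it is at most a constant times \<open>ln (n / \<epsilon>)\<close>.\<close>

lemma expected_consensus_time_upper_log:
  fixes \<rho> X \<epsilon> M :: real
  assumes X: "poincare X" "1 \<le> X" "X \<le> M * (real (card V))\<^sup>2" and M: "1 \<le> M"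
    and \<rho>: "0 < \<rho>" "\<rho> \<le> 1"
    and contr: "\<And>f. (\<Sum>u\<in>V. energy (step f u)) \<le> (card V - \<rho>) * energy f"
    and n: "4 \<le> card V" and f0: "f0 \<in> profiles" and \<epsilon>: "0 < \<epsilon>" "\<epsilon> \<le> 1"
  shows "expected_consensus_time p V adj \<epsilon> f0
    \<le> ennreal ((p * ln (4 * M) + 2 * p + 4) * (card V * ln (card V / \<epsilon>) / \<rho>))"
proof -
  define N where "N = real (card V)"
  define w where "w = N / \<epsilon>"
  have N: "4 \<le> N" using n by (simp add: N_def)
  have wN: "N \<le> w" using N \<epsilon> by (simp add: w_def field_simps mult_left_le)
  have w: "4 \<le> w" using N wN by linarith
  have "exp 1 \<le> w" using w exp_le by linarith
  then have ln_w: "1 \<le> ln w" using w by (simp add: ln_ge_iff)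
  \<comment> \<open>The energy is at most \<open>n\<^sup>2 * 2 powr p\<close> and \<open>2 * X / \<epsilon>\<close> at most \<open>2 * M * w\<^sup>2\<close>.\<close>
  define A where "A = (4 * M) powr p * w powr (2 * p + 2)"
  have A1: "1 \<le> A"
  proof -
    have "1 * 1 \<le> A" unfolding A_def using M w p_gt_1
      by (intro mult_mono) (auto intro!: ge_one_powr_ge_zero)
    then show ?thesis by simp
  qed
  have "2 * X / \<epsilon> \<le> 2 * (M * N\<^sup>2) / \<epsilon>"
    using X \<epsilon> by (intro divide_right_mono) (auto simp: N_def)
  also have "\<dots> = 2 * M * (N * w)" by (simp add: w_def power2_eq_square)
  also have "\<dots> \<le> 2 * M * (w * w)" using wN M w by (intro mult_left_mono mult_right_mono) auto
  finally have "(2 * X / \<epsilon>) powr p \<le> (2 * M * (w * w)) powr p"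
    using X \<epsilon> p_gt_1 by (intro powr_mono2) auto
  moreover have "energy f0 \<le> w\<^sup>2 * 2 powr p"
    using energy_profile_le[OF f0] wN N
    by (intro order_trans[OF energy_profile_le[OF f0]] mult_right_mono power_mono) (auto simp: N_def)
  ultimately have "energy f0 * (2 * X / \<epsilon>) powr p \<le> (w\<^sup>2 * 2 powr p) * (2 * M * (w * w)) powr p"
    using energy_nonneg by (intro mult_mono) auto
  also have "\<dots> = A"
  proof -
    have "(4 * M) powr p = 2 powr p * (2 * M) powr p" using M by (simp flip: powr_mult)
    moreover have "w powr (2 * p + 2) = w\<^sup>2 * (w * w) powr p"
    proof -
      have "w powr (2 * p) = w powr p * w powr p" by (simp flip: powr_add)
      then show ?thesis using w by (simp add: powr_add powr_mult power2_eq_square)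
    qed
    moreover have "(2 * M * (w * w)) powr p = (2 * M) powr p * (w * w) powr p"
      using w M by (simp add: powr_mult)
    ultimately show ?thesis by (simp add: A_def)
  qed
  finally have A: "energy f0 * (2 * X / \<epsilon>) powr p \<le> A" .
  have "expected_consensus_time p V adj \<epsilon> f0 \<le> ennreal (N * (ln A + 2) / \<rho>)"
    unfolding N_def
    by (rule expected_consensus_time_upper[OF X(1,2) \<epsilon>(1) \<rho>(1) _ contr A A1]) (use \<rho> n in auto)
  also have "\<dots> \<le> ennreal ((p * ln (4 * M) + 2 * p + 4) * (N * ln w / \<rho>))"
  proof (rule ennreal_leI)
    have "ln A = p * ln (4 * M) + (2 * p + 2) * ln w"
      using M w by (simp add: A_def ln_mult ln_powr)
    moreover have "p * ln (4 * M) * 1 \<le> p * ln (4 * M) * ln w"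
      using M p_gt_1 ln_w by (intro mult_left_mono) auto
    ultimately have "ln A + 2 \<le> (p * ln (4 * M) + 2 * p + 4) * ln w"
      using ln_w by (simp add: algebra_simps)
    then have "N * (ln A + 2) / \<rho> \<le> N * ((p * ln (4 * M) + 2 * p + 4) * ln w) / \<rho>"
      using N \<rho> by (intro divide_right_mono mult_left_mono) auto
    then show "N * (ln A + 2) / \<rho> \<le> (p * ln (4 * M) + 2 * p + 4) * (N * ln w / \<rho>)"
      by (simp add: mult_ac)
  qed
  finally show ?thesis by (simp add: N_def w_def)
qed

end

context box_graph
begin

lemma d_le_n: "real d \<le> real (L ^ d)" and L_le_n: "real L \<le> real (L ^ d)" and n_ge_4: "4 \<le> L ^ d"
proof -
  have "d < 2 ^ d" by (rule less_exp)
  also have "2 ^ d \<le> L ^ d" using L by (intro power_mono) auto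
  finally show "real d \<le> real (L ^ d)" by (simp only: of_nat_le_iff)
  have "L ^ 1 \<le> L ^ d" using L d by (intro power_increasing) auto
  then show "real L \<le> real (L ^ d)" by (simp only: of_nat_le_iff power_one_right)
  have "(2::nat) ^ 2 \<le> 2 ^ d" using d by (intro power_increasing) auto
  also have "2 ^ d \<le> L ^ d" using L by (intro power_mono) auto
  finally show "4 \<le> L ^ d" by simp
qed

lemma box_upper_le_2:
  assumes "p \<le> 2" "f0 \<in> profiles" "0 < \<epsilon>" "\<epsilon> \<le> 1"
  shows "expected_consensus_time p (lattice_box d L) (box_adj d) \<epsilon> f0
    \<le> ennreal ((p * ln 16 + 2 * p + 4) * (2 * 32 powr (1 / (p - 1)))
      * (real (L ^ d) * real d powr (1 / (p - 1)) * real L powr (p / (p - 1)) * ln (real (L ^ d) / \<epsilon>)))"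
proof -
  define X where "X = (4 * real d * L powr p) powr (1 / p)"
  define \<rho> where "\<rho> = (8 * X powr p) powr (- 1 / (p - 1)) / 2"
  have dL: "1 \<le> real d" "1 \<le> real L" using d L by auto
  have base: "1 \<le> 4 * real d * L powr p"
  proof -
    have "1 * 1 \<le> (4 * real d) * L powr p"
      using dL p by (intro mult_mono) (auto intro!: ge_one_powr_ge_zero)
    then show ?thesis by simp
  qed
  have X1: "1 \<le> X" unfolding X_def using base p by (intro ge_one_powr_ge_zero) auto
  have Xp: "X powr p = 4 * real d * L powr p" using p dL by (simp add: X_def powr_powr)
  have "X = (4 * real d) powr (1 / p) * L"
    using p dL by (simp add: X_def powr_mult powr_powr)
  also have "(4 * real d) powr (1 / p) \<le> (4 * real d) powr 1"
    using p dL by (intro powr_mono) auto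
  finally have "X \<le> 4 * (real d * real L)" using dL by simp
  also have "real d * real L \<le> (real (L ^ d))\<^sup>2"
    unfolding power2_eq_square using d_le_n L_le_n by (intro mult_mono) auto
  finally have Xn: "X \<le> 4 * (real (card (lattice_box d L)))\<^sup>2"
    by (simp add: card_lattice_box)
  have \<rho>_inv: "1 / \<rho> = 2 * 32 powr (1 / (p - 1)) * (real d powr (1 / (p - 1)) * L powr (p / (p - 1)))"
  proof -
    have "1 / \<rho> = 2 * (8 * X powr p) powr (1 / (p - 1))"
      unfolding \<rho>_def using X1 by (simp add: powr_minus field_simps)
    also have "8 * X powr p = 32 * (real d * L powr p)" unfolding Xp by simp
    also have "(32 * (real d * L powr p)) powr (1 / (p - 1))
        = 32 powr (1 / (p - 1)) * (real d powr (1 / (p - 1)) * L powr (p / (p - 1)))"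
      using dL p by (simp add: powr_mult powr_powr)
    finally show ?thesis by simp
  qed
  have \<rho>: "0 < \<rho>" "\<rho> \<le> 1"
  proof -
    show "0 < \<rho>" using X1 by (simp add: \<rho>_def)
    have "1 \<le> X powr p" using X1 p by (intro ge_one_powr_ge_zero) auto
    then have "(8 * X powr p) powr (- 1 / (p - 1)) \<le> (8 * X powr p) powr 0"
      using p by (intro powr_mono) (auto simp: field_simps)
    then show "\<rho> \<le> 1" using X1 by (simp add: \<rho>_def split: if_splits)
  qed
  have "expected_consensus_time p (lattice_box d L) (box_adj d) \<epsilon> f0
    \<le> ennreal ((p * ln (4 * 4) + 2 * p + 4) * (card (lattice_box d L) * ln (card (lattice_box d L) / \<epsilon>) / \<rho>))"
  proof (rule expected_consensus_time_upper_log[OF _ X1 Xn _ \<rho>])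
    show "poincare X" unfolding X_def by (rule poincare_box_le_2) fact
    show "(\<Sum>u\<in>lattice_box d L. energy (step f u)) \<le> (card (lattice_box d L) - \<rho>) * energy f" for f
      unfolding \<rho>_def by (rule energy_contraction_le_2) (use assms X1 \<open>poincare X\<close> in auto)
  qed (use assms n_ge_4 in \<open>auto simp: card_lattice_box\<close>)
  also have "(p * ln (4 * 4) + 2 * p + 4) * (card (lattice_box d L) * ln (card (lattice_box d L) / \<epsilon>) / \<rho>)
    = (p * ln 16 + 2 * p + 4) * (real (L ^ d) * ln (real (L ^ d) / \<epsilon>) * (1 / \<rho>))"
    by (simp add: card_lattice_box)
  finally show ?thesis unfolding \<rho>_inv by (simp only: mult_ac)
qed

lemma box_upper_ge_2:
  assumes "2 \<le> p" "f0 \<in> profiles" "0 < \<epsilon>" "\<epsilon> \<le> 1"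
  shows "expected_consensus_time p (lattice_box d L) (box_adj d) \<epsilon> f0
    \<le> ennreal ((p * ln (4 * p) + 2 * p + 4) * (6 * (p * (p - 1) * 2 powr (p - 2)) * p\<^sup>2)
      * (real (L ^ d) * real d * real L ^ 2 * ln (real (L ^ d) / \<epsilon>)))"
proof -
  define X where "X = p * real L * sqrt (real d)"
  define C where "C = p * (p - 1) * 2 powr (p - 2)"
  define \<rho> where "\<rho> = 1 / (6 * C * X\<^sup>2)"
  have dL: "1 \<le> real d" "1 \<le> real L" using d L by auto
  have sq: "1 \<le> sqrt (real d)" "sqrt (real d) \<le> real d"
    using dL by (auto simp: real_le_lsqrt power2_eq_square)
  have "1 * 1 * 1 \<le> X" unfolding X_def using assms dL sq by (intro mult_mono) auto
  then have X1: "1 \<le> X" by simp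
  have "X \<le> p * real (L ^ d) * real (L ^ d)"
    unfolding X_def using assms L_le_n order_trans[OF sq(2) d_le_n] by (intro mult_mono) auto
  then have Xn: "X \<le> p * (real (card (lattice_box d L)))\<^sup>2"
    by (simp add: card_lattice_box power2_eq_square mult.assoc)
  have "2 * 1 * 1 \<le> C" unfolding C_def using assms
    by (intro mult_mono) (auto simp: ge_one_powr_ge_zero)
  then have C: "2 \<le> C" by simp
  have \<rho>: "0 < \<rho>" "\<rho> \<le> 1"
  proof -
    show "0 < \<rho>" using X1 C by (simp add: \<rho>_def)
    have "1 * 1 \<le> 6 * C * X\<^sup>2" using C X1 by (intro mult_mono) (auto simp: one_le_power)
    then show "\<rho> \<le> 1" by (simp add: \<rho>_def)
  qed
  have \<rho>_inv: "1 / \<rho> = 6 * C * p\<^sup>2 * (real d * (real L)\<^sup>2)"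
    by (simp add: \<rho>_def X_def power_mult_distrib)
  have "expected_consensus_time p (lattice_box d L) (box_adj d) \<epsilon> f0
    \<le> ennreal ((p * ln (4 * p) + 2 * p + 4) * (card (lattice_box d L) * ln (card (lattice_box d L) / \<epsilon>) / \<rho>))"
  proof (rule expected_consensus_time_upper_log[OF _ X1 Xn _ \<rho>])
    show "poincare X" unfolding X_def by (rule poincare_box_ge_2) fact
    show "(\<Sum>u\<in>lattice_box d L. energy (step f u)) \<le> (card (lattice_box d L) - \<rho>) * energy f" for f
      unfolding \<rho>_def C_def by (rule energy_contraction_ge_2) (use assms X1 \<open>poincare X\<close> in auto)
  qed (use assms n_ge_4 in \<open>auto simp: card_lattice_box\<close>)
  also have "(p * ln (4 * p) + 2 * p + 4) * (card (lattice_box d L) * ln (card (lattice_box d L) / \<epsilon>) / \<rho>)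
    = (p * ln (4 * p) + 2 * p + 4) * (real (L ^ d) * ln (real (L ^ d) / \<epsilon>) * (1 / \<rho>))"
    by (simp add: card_lattice_box)
  finally show ?thesis unfolding \<rho>_inv C_def[symmetric] by (simp only: mult_ac)
qed

end

text \<open>The value at \<open>y\<close> belongs to the edge from \<open>y - 1\<close> to \<open>y\<close> of an axis. It vanishes at \<open>0\<close> and
  at \<open>L\<close>, the positions of the edges that are missing at the two ends.\<close>

definition tent :: "nat \<Rightarrow> nat \<Rightarrow> real" where
  "tent L y = real (min y (L - y))"

definition tent_sum :: "nat \<Rightarrow> real \<Rightarrow> real" where
  "tent_sum L s = (\<Sum>y<L. tent L y powr s)"

text \<open>A profile on an axis that rises from \<open>-1\<close> to \<open>1\<close> with increments proportional to
  \<open>tent L y powr s\<close>. For \<open>s = 1\<close> its second differences are bounded by a constant times \<open>1 / L\<^sup>2\<close>;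
  for \<open>s = 1 / (p - 1)\<close> the powers \<open>p - 1\<close> of successive increments differ by at most a
  constant times \<open>L powr (- p)\<close>.\<close>

definition ramp :: "nat \<Rightarrow> real \<Rightarrow> nat \<Rightarrow> real" where
  "ramp L s x = - 1 + 2 / tent_sum L s * (\<Sum>y\<in>{..x}. tent L y powr s)"

lemma tent_nonneg: "0 \<le> tent L y"
  by (simp add: tent_def)

lemma tent_lipschitz: "x < L \<Longrightarrow> \<bar>tent L (x + 1) - tent L x\<bar> \<le> 1"
  by (auto simp: tent_def min_def)

lemma tent_ends [simp]: "tent L 0 = 0" "tent L L = 0"
  by (simp_all add: tent_def)

text \<open>Near the middle of the axis about a quarter of the positions have a tent value of at least
  \<open>L / 6\<close>.\<close>

lemma tent_sum_ge:
  assumes "2 \<le> L" "0 \<le> s"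
  shows "(real L / 6) powr (s + 1) \<le> tent_sum L s"
proof -
  define m where "m = L div 2"
  have m: "1 \<le> m" "L \<le> 3 * m" "2 * m \<le> L" using assms by (auto simp: m_def)
  have "(real L / 6) powr (s + 1) \<le> (real m / 2) powr (s + 1)"
    using m assms by (intro powr_mono2) auto
  also have "\<dots> = real m / 2 * (real m / 2) powr s" using m by (simp add: powr_add)
  also have "\<dots> \<le> real (card {m - m div 2..m}) * (real m / 2) powr s"
  proof (intro mult_right_mono)
    have "card {m - m div 2..m} = m div 2 + 1" by simp
    moreover have "m \<le> 2 * (m div 2 + 1)" by simp
    ultimately show "real m / 2 \<le> real (card {m - m div 2..m})" by linarith
  qed simp
  also have "\<dots> = (\<Sum>y\<in>{m - m div 2..m}. (real m / 2) powr s)" by simp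
  also have "\<dots> \<le> (\<Sum>y\<in>{m - m div 2..m}. tent L y powr s)"
  proof (intro sum_mono powr_mono2)
    fix y assume "y \<in> {m - m div 2..m}"
    then have "m \<le> 2 * y" "m \<le> 2 * (L - y)" using m by auto
    then show "real m / 2 \<le> tent L y" unfolding tent_def by linarith
  qed (use assms in auto)
  also have "\<dots> \<le> tent_sum L s"
    unfolding tent_sum_def using m by (intro sum_mono2) auto
  finally show ?thesis .
qed

lemma tent_sum_pos: "2 \<le> L \<Longrightarrow> 0 \<le> s \<Longrightarrow> 0 < tent_sum L s"
  by (rule less_le_trans[OF _ tent_sum_ge]) auto

lemma ramp_0: "ramp L s 0 = - 1"
  by (simp add: ramp_def)

lemma ramp_last: "2 \<le> L \<Longrightarrow> 0 \<le> s \<Longrightarrow> ramp L s (L - 1) = 1"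
proof -
  assume L: "2 \<le> L" "0 \<le> s"
  have "{..L - 1} = {..<L}" using L by auto
  then show ?thesis using tent_sum_pos[OF L] by (simp add: ramp_def tent_sum_def)
qed

lemma ramp_Suc: "ramp L s (x + 1) - ramp L s x = 2 / tent_sum L s * tent L (x + 1) powr s"
  by (simp add: ramp_def algebra_simps)

lemma ramp_mono:
  assumes "2 \<le> L" "0 \<le> s" "x \<le> y"
  shows "ramp L s x \<le> ramp L s y"
  using assms(3)
proof (induction y rule: dec_induct)
  case (step y)
  have "0 \<le> 2 / tent_sum L s * tent L (y + 1) powr s" using tent_sum_pos[OF assms(1,2)] by simp
  then show ?case using step ramp_Suc[of L s y] by simp
qed simp

lemma ramp_range: "2 \<le> L \<Longrightarrow> 0 \<le> s \<Longrightarrow> x < L \<Longrightarrow> ramp L s x \<in> {-1..1}"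
  using ramp_mono[of L s 0 x] ramp_mono[of L s x "L - 1"] ramp_0[of L s] ramp_last[of L s] by auto

context box_graph
begin

text \<open>If the increments of \<open>\<phi>\<close> along an axis depend only on the position on that axis, the barrier
  conditions are sums over the axes. The second condition is the first one for \<open>- \<phi>\<close>.\<close>

lemma barrier_separableI:
  fixes \<gamma> :: "nat \<Rightarrow> nat \<Rightarrow> real"
  assumes diff: "\<And>u i. u \<in> lattice_box d L \<Longrightarrow> i < d \<Longrightarrow> u i + 1 < L
      \<Longrightarrow> \<phi> (u(i := u i + 1)) - \<phi> u = \<gamma> i (u i + 1)"
    and above: "\<And>u. u \<in> lattice_box d L \<Longrightarrow> 0 \<le> (\<Sum>i<d.
      (if u i + 1 < L then signed_powr (p - 1) (h - \<gamma> i (u i + 1)) else 0)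
      + (if 0 < u i then signed_powr (p - 1) (h + \<gamma> i (u i)) else 0))"
    and below: "\<And>u. u \<in> lattice_box d L \<Longrightarrow> 0 \<le> (\<Sum>i<d.
      (if u i + 1 < L then signed_powr (p - 1) (h + \<gamma> i (u i + 1)) else 0)
      + (if 0 < u i then signed_powr (p - 1) (h - \<gamma> i (u i)) else 0))"
  shows "barrier h \<phi>"
  unfolding barrier_def
proof (intro ballI conjI)
  fix u assume u: "u \<in> lattice_box d L"
  have up: "\<phi> (u(i := u i + 1)) = \<phi> u + \<gamma> i (u i + 1)" if "i < d" "u i + 1 < L" for i
    using diff[OF u that] by simp
  have down: "\<phi> (u(i := u i - 1)) = \<phi> u - \<gamma> i (u i)" if "i < d" "0 < u i" for i
  proof -
    have "u i < L" using lattice_box_less[OF u that(1)] .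
    then show ?thesis
      using diff[of "u(i := u i - 1)" i] lattice_box_upd[OF u that(1), of "u i - 1"] that by simp
  qed
  show "0 \<le> (\<Sum>v\<in>nbrs u. signed_powr (p - 1) (\<phi> u + h - \<phi> v))"
  proof -
    have "(\<Sum>v\<in>nbrs u. signed_powr (p - 1) (\<phi> u + h - \<phi> v)) = (\<Sum>i<d.
      (if u i + 1 < L then signed_powr (p - 1) (h - \<gamma> i (u i + 1)) else 0)
      + (if 0 < u i then signed_powr (p - 1) (h + \<gamma> i (u i)) else 0))"
      unfolding sum_nbrs_box[OF u]
    proof (intro sum.cong refl arg_cong2[where f = "(+)"] if_cong)
      fix i assume "i \<in> {..<d}"
      then have i: "i < d" by simp
      show "signed_powr (p - 1) (\<phi> u + h - \<phi> (u(i := u i + 1))) = signed_powr (p - 1) (h - \<gamma> i (u i + 1))"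
        if "u i + 1 < L" unfolding up[OF i that] by (simp add: algebra_simps)
      show "signed_powr (p - 1) (\<phi> u + h - \<phi> (u(i := u i - 1))) = signed_powr (p - 1) (h + \<gamma> i (u i))"
        if "0 < u i" unfolding down[OF i that] by (simp add: algebra_simps)
    qed
    then show ?thesis using above[OF u] by simp
  qed
  show "(\<Sum>v\<in>nbrs u. signed_powr (p - 1) (\<phi> u - h - \<phi> v)) \<le> 0"
  proof -
    have "(\<Sum>v\<in>nbrs u. signed_powr (p - 1) (\<phi> u - h - \<phi> v)) = (\<Sum>v\<in>nbrs u. - signed_powr (p - 1) (\<phi> v - \<phi> u + h))"
      by (intro sum.cong refl) (simp flip: signed_powr_minus add: algebra_simps)
    also have "\<dots> = - (\<Sum>v\<in>nbrs u. signed_powr (p - 1) (\<phi> v - \<phi> u + h))" by (rule sum_negf)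
    also have "(\<Sum>v\<in>nbrs u. signed_powr (p - 1) (\<phi> v - \<phi> u + h)) = (\<Sum>i<d.
      (if u i + 1 < L then signed_powr (p - 1) (h + \<gamma> i (u i + 1)) else 0)
      + (if 0 < u i then signed_powr (p - 1) (h - \<gamma> i (u i)) else 0))"
      unfolding sum_nbrs_box[OF u]
    proof (intro sum.cong refl arg_cong2[where f = "(+)"] if_cong)
      fix i assume "i \<in> {..<d}"
      then have i: "i < d" by simp
      show "signed_powr (p - 1) (\<phi> (u(i := u i + 1)) - \<phi> u + h) = signed_powr (p - 1) (h + \<gamma> i (u i + 1))"
        if "u i + 1 < L" unfolding up[OF i that] by (simp add: algebra_simps)
      show "signed_powr (p - 1) (\<phi> (u(i := u i - 1)) - \<phi> u + h) = signed_powr (p - 1) (h - \<gamma> i (u i))"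
        if "0 < u i" unfolding down[OF i that] by (simp add: algebra_simps)
    qed
    finally show ?thesis using below[OF u] by simp
  qed
qed

lemma signed_powr_pair_nonneg:
  assumes "a \<le> b + 2 * h"
  shows "0 \<le> signed_powr (p - 1) (h - a) + signed_powr (p - 1) (h + b)"
proof -
  have "signed_powr (p - 1) (- (h - a)) \<le> signed_powr (p - 1) (h + b)"
    using assms p by (intro signed_powr_mono) auto
  then show ?thesis unfolding signed_powr_minus by simp
qed

lemma signed_powr_nonneg: "0 \<le> a \<Longrightarrow> 0 \<le> signed_powr s a"
  by (simp add: signed_powr_def)

definition axis_ramp :: "real \<Rightarrow> (nat \<Rightarrow> nat) \<Rightarrow> real" where
  "axis_ramp s = restrict (\<lambda>u. ramp L s (u 0)) (lattice_box d L)"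

definition diagonal_ramp :: "(nat \<Rightarrow> nat) \<Rightarrow> real" where
  "diagonal_ramp = restrict (\<lambda>u. (\<Sum>i<d. ramp L 1 (u i)) / d) (lattice_box d L)"

definition bottom_corner :: "nat \<Rightarrow> nat" where
  "bottom_corner = (\<lambda>i\<in>{..<d}. 0)"

definition top_corner :: "nat \<Rightarrow> nat" where
  "top_corner = (\<lambda>i\<in>{..<d}. L - 1)"

lemma corners: "bottom_corner \<in> lattice_box d L" "top_corner \<in> lattice_box d L"
  using L by (auto simp: bottom_corner_def top_corner_def lattice_box_def)

lemma axis_ramp_profile: "0 \<le> s \<Longrightarrow> axis_ramp s \<in> profiles"
  using ramp_range[OF L, of s] lattice_box_less[of _ d L 0] d by (auto simp: axis_ramp_def)

lemma axis_ramp_corners: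
  "0 \<le> s \<Longrightarrow> axis_ramp s top_corner = 1" "axis_ramp s bottom_corner = - 1"
  using corners d L ramp_last[OF L, of s]
  by (auto simp: axis_ramp_def top_corner_def bottom_corner_def ramp_0)

lemma diagonal_ramp_profile: "diagonal_ramp \<in> profiles"
proof -
  have "(\<Sum>i<d. ramp L 1 (u i)) / d \<in> {-1..1}" if u: "u \<in> lattice_box d L" for u
  proof -
    have r: "ramp L 1 (u i) \<in> {-1..1}" if "i < d" for i
      using ramp_range[OF L, of 1] lattice_box_less[OF u that] by simp
    have "(\<Sum>i<d. - 1) \<le> (\<Sum>i<d. ramp L 1 (u i))" "(\<Sum>i<d. ramp L 1 (u i)) \<le> (\<Sum>i<d. 1)"
      by (intro sum_mono; use r in auto)+
    then show ?thesis using d by (simp add: field_simps)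
  qed
  then show ?thesis by (auto simp: diagonal_ramp_def)
qed

lemma diagonal_ramp_corners: "diagonal_ramp top_corner = 1" "diagonal_ramp bottom_corner = - 1"
  using corners d L ramp_last[OF L, of 1]
  by (auto simp: diagonal_ramp_def top_corner_def bottom_corner_def ramp_0)

text \<open>Each axis is in balance separately: the two terms of an axis have a nonnegative sum as soon as
  the increments on both sides of the vertex differ by at most \<open>2 * h\<close>. Averaging over the axes
  gains the factor \<open>1 / d\<close>.\<close>

lemma diagonal_ramp_barrier: "barrier (2 / (d * tent_sum L 1)) diagonal_ramp"
proof -
  define h where "h = 2 / (d * tent_sum L 1)"
  have h: "0 < h" using d tent_sum_pos[OF L, of 1] by (simp add: h_def)
  have diff: "diagonal_ramp (u(i := u i + 1)) - diagonal_ramp u = h * tent L (u i + 1)"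
    if "u \<in> lattice_box d L" "i < d" "u i + 1 < L" for u i
  proof -
    have "(\<Sum>j<d. ramp L 1 ((u(i := u i + 1)) j)) - (\<Sum>j<d. ramp L 1 (u j))
        = ramp L 1 (u i + 1) - ramp L 1 (u i)"
      using that by (simp add: sum.remove[of "{..<d}" i])
    also have "\<dots> = 2 / tent_sum L 1 * tent L (u i + 1)"
      unfolding ramp_Suc by (simp add: tent_nonneg)
    finally show ?thesis
      using that lattice_box_upd[OF that(1,2,3)]
      by (simp add: diagonal_ramp_def h_def diff_divide_distrib[symmetric] field_simps)
  qed
  have t: "tent L (x + 1) \<le> tent L x + 1" "tent L x \<le> tent L (x + 1) + 1" if "x < L" for x
    using tent_lipschitz[OF that] by auto
  have lip: "h * tent L (x + 1) \<le> h * tent L x + 2 * h" "h * tent L x \<le> h * tent L (x + 1) + 2 * h"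
    if "x < L" for x
    using mult_left_mono[OF t(1)[OF that], of h] mult_left_mono[OF t(2)[OF that], of h] h
    by (auto simp: distrib_left)
  have nn: "0 \<le> h * tent L x" for x using h by (simp add: tent_nonneg)
  \<comment> \<open>At an end of the axis one of the two terms is missing; there the other one is nonnegative by itself.\<close>
  have ends: "h * tent L (x + 1) \<le> h" if "x = 0" for x
    using t(1)[of 0] L h that by simp
  have ends': "h * tent L x \<le> h" if "x < L" "\<not> x + 1 < L" for x
  proof -
    have "x + 1 = L" using that by simp
    then show ?thesis using t(2)[OF that(1)] h by simp
  qed
  show ?thesis
    unfolding h_def[symmetric]
  proof (rule barrier_separableI[where \<gamma> = "\<lambda>_ y. h * tent L y"])
    fix u assume u: "u \<in> lattice_box d L"
    show "0 \<le> (\<Sum>i<d. (if u i + 1 < L then signed_powr (p - 1) (h - h * tent L (u i + 1)) else 0)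
      + (if 0 < u i then signed_powr (p - 1) (h + h * tent L (u i)) else 0))"
    proof (rule sum_nonneg)
      fix i assume "i \<in> {..<d}"
      then have x: "u i < L" using lattice_box_less[OF u] by simp
      show "0 \<le> (if u i + 1 < L then signed_powr (p - 1) (h - h * tent L (u i + 1)) else 0)
        + (if 0 < u i then signed_powr (p - 1) (h + h * tent L (u i)) else 0)"
        using signed_powr_pair_nonneg[OF lip(1)[OF x]] ends[of "u i"] nn[of "u i"] h
        by (auto intro!: signed_powr_nonneg)
    qed
    show "0 \<le> (\<Sum>i<d. (if u i + 1 < L then signed_powr (p - 1) (h + h * tent L (u i + 1)) else 0)
      + (if 0 < u i then signed_powr (p - 1) (h - h * tent L (u i)) else 0))"
    proof (rule sum_nonneg)
      fix i assume "i \<in> {..<d}"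
      then have x: "u i < L" using lattice_box_less[OF u] by simp
      show "0 \<le> (if u i + 1 < L then signed_powr (p - 1) (h + h * tent L (u i + 1)) else 0)
        + (if 0 < u i then signed_powr (p - 1) (h - h * tent L (u i)) else 0)"
        using signed_powr_pair_nonneg[OF lip(2)[OF x]] ends'[OF x] nn[of "u i + 1"] h
        by (auto intro!: signed_powr_nonneg)
    qed
  qed (rule diff)
qed

text \<open>Along the first axis the flow through a vertex is unbalanced by at most
  \<open>\<beta> = (2 / Z) powr (p - 1)\<close>, where \<open>Z = tent_sum L s\<close>. Each of the other \<open>d - 1\<close> axes, on which the
  profile is constant, contributes at least one restoring term \<open>signed_powr (p - 1) h\<close>, and \<open>h\<close> is chosen
  such that these terms add up to \<open>\<beta>\<close>.\<close>

lemma axis_ramp_barrier: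
  assumes s: "s = 1 / (p - 1)"
  shows "barrier (2 / tent_sum L s * (real d - 1) powr (- s)) (axis_ramp s)"
proof -
  define Z where "Z = tent_sum L s"
  define h where "h = 2 / Z * (real d - 1) powr (- s)"
  define \<beta> where "\<beta> = (2 / Z) powr (p - 1)"
  have s_pos: "0 < s" and sp: "s * (p - 1) = 1" using p s by auto
  have Z: "0 < Z" unfolding Z_def using L s_pos by (intro tent_sum_pos) auto
  have d1: "1 \<le> real d - 1" using d by simp
  have h: "0 < h" using Z d1 by (simp add: h_def)
  have \<beta>: "0 < \<beta>" using Z by (simp add: \<beta>_def)
  have signed_powr_h: "(real d - 1) * signed_powr (p - 1) h = \<beta>"
  proof -
    have "signed_powr (p - 1) h = h powr (p - 1)" using h by (simp add: signed_powr_nonneg_eq)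
    also have "\<dots> = \<beta> * (real d - 1) powr (- s * (p - 1))"
      unfolding h_def \<beta>_def using Z d1 by (subst powr_mult) (auto simp: powr_powr)
    also have "- s * (p - 1) = - 1" using sp by simp
    finally show ?thesis using d1 by (simp add: powr_minus)
  qed
  define g where "g y = 2 / Z * tent L y powr s" for y
  have g: "0 \<le> g y" for y using Z by (simp add: g_def)
  define \<tau> where "\<tau> y = \<beta> * tent L y" for y
  have \<tau>: "0 \<le> \<tau> y" "\<tau> 0 = 0" for y using \<beta> by (simp_all add: \<tau>_def tent_nonneg)
  have signed_powr_g: "signed_powr (p - 1) (g y) = \<tau> y" for y
  proof -
    have "signed_powr (p - 1) (g y) = g y powr (p - 1)" by (rule signed_powr_nonneg_eq[OF g])
    also have "\<dots> = \<beta> * (tent L y powr s) powr (p - 1)"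
      unfolding g_def \<beta>_def using Z by (subst powr_mult) auto
    finally show ?thesis using sp tent_nonneg[of L y] by (simp add: powr_powr \<tau>_def)
  qed
  have mono: "signed_powr (p - 1) a \<le> signed_powr (p - 1) b" if "a \<le> b" for a b
    using p that by (intro signed_powr_mono) auto
  have plus: "\<tau> y \<le> signed_powr (p - 1) (h + g y)" for y
    using mono[of "g y" "h + g y"] h by (simp add: signed_powr_g)
  have minus: "- \<tau> y \<le> signed_powr (p - 1) (h - g y)" for y
    using mono[of "- g y" "h - g y"] h by (simp add: signed_powr_g)
  have t: "\<tau> (x + 1) \<le> \<tau> x + \<beta>" "\<tau> x \<le> \<tau> (x + 1) + \<beta>" if "x < L" for x
  proof -
    have "tent L (x + 1) \<le> tent L x + 1" "tent L x \<le> tent L (x + 1) + 1"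
      using tent_lipschitz[OF that] by auto
    from this[THEN mult_left_mono, of \<beta>] \<beta>
    show "\<tau> (x + 1) \<le> \<tau> x + \<beta>" "\<tau> x \<le> \<tau> (x + 1) + \<beta>"
      by (auto simp: distrib_left \<tau>_def)
  qed
  have tL: "\<tau> (x + 1) = 0" if "x < L" "\<not> x + 1 < L" for x
  proof -
    have "x + 1 = L" using that by simp
    then show ?thesis by (simp add: \<tau>_def)
  qed
  \<comment> \<open>The transverse axes outweigh the deficit of the first one.\<close>
  have total: "0 \<le> (\<Sum>i<d. T i)"
    if T0: "- \<beta> \<le> T 0" and T: "\<And>i. 0 < i \<Longrightarrow> i < d \<Longrightarrow> signed_powr (p - 1) h \<le> T i" for T :: "nat \<Rightarrow> real"
  proof -
    have "\<beta> = (\<Sum>i\<in>{..<d} - {0}. signed_powr (p - 1) h)"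
      using d signed_powr_h by (simp add: of_nat_diff)
    also have "\<dots> \<le> (\<Sum>i\<in>{..<d} - {0}. T i)" by (intro sum_mono T) auto
    finally have "\<beta> \<le> (\<Sum>i\<in>{..<d} - {0}. T i)" .
    then show ?thesis using T0 d by (simp add: sum.remove[of "{..<d}" 0])
  qed
  have J: "0 < signed_powr (p - 1) h" using h by (simp add: signed_powr_def)
  have "barrier h (axis_ramp s)"
  proof (rule barrier_separableI[where \<gamma> = "\<lambda>i y. if i = 0 then g y else 0"])
    show "axis_ramp s (u(i := u i + 1)) - axis_ramp s u = (if i = 0 then g (u i + 1) else 0)"
      if "u \<in> lattice_box d L" "i < d" "u i + 1 < L" for u i
      using that lattice_box_upd[OF that] ramp_Suc[of L s "u 0"]
      by (auto simp: axis_ramp_def g_def Z_def)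
  next
    fix u assume u: "u \<in> lattice_box d L"
    have x: "u i < L" if "i < d" for i using lattice_box_less[OF u that] .
    have x0: "u 0 < L" using x d by simp
    show "0 \<le> (\<Sum>i<d. (if u i + 1 < L then signed_powr (p - 1) (h - (if i = 0 then g (u i + 1) else 0)) else 0)
      + (if 0 < u i then signed_powr (p - 1) (h + (if i = 0 then g (u i) else 0)) else 0))"
    proof (rule total)
      show "- \<beta> \<le> (if u 0 + 1 < L then signed_powr (p - 1) (h - (if 0 = (0::nat) then g (u 0 + 1) else 0)) else 0)
        + (if 0 < u 0 then signed_powr (p - 1) (h + (if 0 = (0::nat) then g (u 0) else 0)) else 0)"
        using plus[of "u 0"] minus[of "u 0 + 1"] t[OF x0] tL[OF x0] \<beta> \<tau>(1)[of "u 0"] \<tau>(2)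
        by (cases "u 0 = 0"; cases "u 0 + 1 < L") auto
    qed (use x L J in force)
    show "0 \<le> (\<Sum>i<d. (if u i + 1 < L then signed_powr (p - 1) (h + (if i = 0 then g (u i + 1) else 0)) else 0)
      + (if 0 < u i then signed_powr (p - 1) (h - (if i = 0 then g (u i) else 0)) else 0))"
    proof (rule total)
      show "- \<beta> \<le> (if u 0 + 1 < L then signed_powr (p - 1) (h + (if 0 = (0::nat) then g (u 0 + 1) else 0)) else 0)
        + (if 0 < u 0 then signed_powr (p - 1) (h - (if 0 = (0::nat) then g (u 0) else 0)) else 0)"
        using plus[of "u 0 + 1"] minus[of "u 0"] t[OF x0] tL[OF x0] \<beta> \<tau>(1)[of "u 0 + 1"] \<tau>(2)
        by (cases "u 0 = 0"; cases "u 0 + 1 < L") auto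
    qed (use x L J in force)
  qed
  then show ?thesis by (simp add: h_def Z_def)
qed

end

context box_graph
begin

abbreviation worst_time :: ennreal where
  "worst_time \<equiv> SUP f0\<in>profiles. expected_consensus_time p (lattice_box d L) (box_adj d) (1 / 2) f0"

lemma worst_time_ge_coupon: "ennreal (1 / 8192 * real (L ^ d) * (real d * ln (real L))) \<le> worst_time"
proof -
  have "real (L ^ d) * ln (real (L ^ d)) / 8192 = 1 / 8192 * real (L ^ d) * (real d * ln (real L))"
    using L by (simp add: ln_realpow)
  moreover have "2 \<le> card (lattice_box d L)" using n_ge_4 by (simp add: card_lattice_box)
  ultimately show ?thesis using coupon_collector_lower unfolding card_lattice_box by metis
qed

lemma worst_time_ge_square: "ennreal (1 / 14400000 * real (L ^ d) * real L ^ 2) \<le> worst_time"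
proof -
  define Z where "Z = tent_sum L 1"
  have Z: "(real L / 6) powr 2 \<le> Z" unfolding Z_def using tent_sum_ge[OF L, of 1] by simp
  have Z0: "0 < Z" unfolding Z_def using L by (intro tent_sum_pos) auto
  have h: "0 < 2 / (real d * Z)" using d Z0 by simp
  have "1 / 14400000 * real (L ^ d) * real L ^ 2 = real (L ^ d) * (real L / 6) powr 2 / 400000"
    using L by (simp add: power_divide)
  also have "\<dots> \<le> real (L ^ d) * Z / 400000"
    using Z by (intro divide_right_mono mult_left_mono) auto
  also have "\<dots> = card (lattice_box d L) / (100000 * real (2 * d) * (2 / (d * Z)))"
    using d Z0 by (simp add: card_lattice_box field_simps)
  finally have "ennreal (1 / 14400000 * real (L ^ d) * real L ^ 2)
      \<le> ennreal (card (lattice_box d L) / (100000 * real (2 * d) * (2 / (d * Z))))" by (rule ennreal_leI)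
  also have "\<dots> \<le> worst_time"
  proof (rule barrier_consensus_lower)
    show "barrier (2 / (d * Z)) diagonal_ramp" unfolding Z_def by (rule diagonal_ramp_barrier)
    show "0 < 2 / (d * Z)" by (rule h)
    show "diagonal_ramp \<in> profiles" by (rule diagonal_ramp_profile)
    show "top_corner \<in> lattice_box d L" "bottom_corner \<in> lattice_box d L" by (rule corners)+
    show "diagonal_ramp top_corner = 1" "diagonal_ramp bottom_corner = - 1" by (rule diagonal_ramp_corners)+
    show "card (nbrs u) \<le> 2 * d" if "u \<in> lattice_box d L" for u using that by (rule card_nbrs_le)
  qed
  finally show ?thesis .
qed

lemma worst_time_ge_2:
  assumes "p = 2"
  shows "ennreal (1 / 432 * real (L ^ d) * (real d * real L ^ 2)) \<le> worst_time"
proof -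
  define Z where "Z = tent_sum L 1"
  have Z: "(real L / 6) powr 2 \<le> Z" unfolding Z_def using tent_sum_ge[OF L, of 1] by simp
  have Z0: "0 < Z" unfolding Z_def using L by (intro tent_sum_pos) auto
  have h: "0 < 2 / (real d * Z)" using d Z0 by simp
  have "1 / 432 * real (L ^ d) * (real d * real L ^ 2) = real (L ^ d) * real d * (real L / 6) powr 2 / 12"
    using L by (simp add: power_divide)
  also have "\<dots> \<le> real (L ^ d) * real d * Z / 12"
    using Z by (intro divide_right_mono mult_left_mono) auto
  also have "\<dots> = card (lattice_box d L) / (6 * (2 / (d * Z)))"
    using d Z0 by (simp add: card_lattice_box field_simps)
  finally have "ennreal (1 / 432 * real (L ^ d) * (real d * real L ^ 2))
      \<le> ennreal (card (lattice_box d L) / (6 * (2 / (d * Z))))" by (rule ennreal_leI)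
  also have "\<dots> \<le> worst_time"
  proof (rule barrier_consensus_lower_2)
    show "p = 2" by (rule assms)
    show "barrier (2 / (d * Z)) diagonal_ramp" unfolding Z_def by (rule diagonal_ramp_barrier)
    show "0 < 2 / (d * Z)" by (rule h)
    show "diagonal_ramp \<in> profiles" by (rule diagonal_ramp_profile)
    show "top_corner \<in> lattice_box d L" "bottom_corner \<in> lattice_box d L" by (rule corners)+
    show "diagonal_ramp top_corner = 1" "diagonal_ramp bottom_corner = - 1" by (rule diagonal_ramp_corners)+
  qed
  finally show ?thesis .
qed

lemma worst_time_ge_power:
  assumes s: "s = 1 / (p - 1)"
  shows "ennreal (1 / (400000 * 6 powr (s + 1) * 2 powr s) * real (L ^ d)
    * (real d powr (s - 1) * real L powr (s + 1))) \<le> worst_time"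
proof -
  define Z where "Z = tent_sum L s"
  define h where "h = 2 / Z * (real d - 1) powr (- s)"
  have s0: "0 < s" using p s by simp
  have Z: "(real L / 6) powr (s + 1) \<le> Z" unfolding Z_def using tent_sum_ge[OF L, of s] s0 by simp
  have Z0: "0 < Z" unfolding Z_def using L s0 by (intro tent_sum_pos) auto
  have d1: "1 \<le> real d - 1" "real d / 2 \<le> real d - 1" using d by auto
  have h: "0 < h" using Z0 d1 by (simp add: h_def)
  have inv_h: "1 / h = Z * (real d - 1) powr s / 2"
    using Z0 d1 by (simp add: h_def powr_minus field_simps)
  have "1 / (400000 * 6 powr (s + 1) * 2 powr s) * real (L ^ d) * (real d powr (s - 1) * real L powr (s + 1))
      = real (L ^ d) * ((real L / 6) powr (s + 1) * (real d / 2) powr s) / (400000 * real d)"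
    using d L by (simp add: powr_divide powr_diff field_simps)
  also have "\<dots> \<le> real (L ^ d) * (Z * (real d - 1) powr s) / (400000 * real d)"
    using Z Z0 d1 s0 by (intro divide_right_mono mult_left_mono mult_mono powr_mono2) auto
  also have "\<dots> = card (lattice_box d L) / (100000 * real (2 * d)) * (1 / h)"
    unfolding inv_h using d by (simp add: card_lattice_box field_simps)
  also have "\<dots> = card (lattice_box d L) / (100000 * real (2 * d) * h)" by simp
  finally have "ennreal (1 / (400000 * 6 powr (s + 1) * 2 powr s) * real (L ^ d)
      * (real d powr (s - 1) * real L powr (s + 1)))
      \<le> ennreal (card (lattice_box d L) / (100000 * real (2 * d) * h))" by (rule ennreal_leI)
  also have "\<dots> \<le> worst_time"
  proof (rule barrier_consensus_lower)
    show "barrier h (axis_ramp s)" unfolding h_def Z_def by (rule axis_ramp_barrier[OF s])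
    show "0 < h" by (rule h)
    show "axis_ramp s \<in> profiles" using s0 by (intro axis_ramp_profile) simp
    show "top_corner \<in> lattice_box d L" "bottom_corner \<in> lattice_box d L" by (rule corners)+
    show "axis_ramp s top_corner = 1" "axis_ramp s bottom_corner = - 1"
      using s0 by (auto simp: axis_ramp_corners)
    show "card (nbrs u) \<le> 2 * d" if "u \<in> lattice_box d L" for u using that by (rule card_nbrs_le)
  qed
  finally show ?thesis .
qed

end

lemma ennreal_max_le:
  assumes "ennreal (c1 * n * a) \<le> S" "ennreal (c2 * n * b) \<le> S"
    and "0 \<le> a" "0 \<le> b" "0 \<le> n" "0 \<le> c1" "0 \<le> c2"
  shows "ennreal (min c1 c2 * n * max a b) \<le> S"
proof (cases "a \<le> b")
  case True
  have "min c1 c2 * n * b \<le> c2 * n * b" using assms by (intro mult_right_mono) auto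
  then show ?thesis using True assms(2) by (simp add: max_def) (meson ennreal_leI order_trans)
next
  case False
  have "min c1 c2 * n * a \<le> c1 * n * a" using assms by (intro mult_right_mono) auto
  then show ?thesis using False assms(1) by (simp add: max_def) (meson ennreal_leI order_trans)
qed

theorem theorem6p3:
  fixes p q :: real
  assumes "1 < p" and "q = p / (p - 1)"
  shows "\<exists>c C :: real. 0 < c \<and> 0 < C \<and>
    (\<forall>d L n :: nat. 2 \<le> d \<longrightarrow> 2 \<le> L \<longrightarrow> n = L ^ d \<longrightarrow>
      (\<forall>\<epsilon>::real. \<forall>f0 \<in> lattice_box d L \<rightarrow>\<^sub>E {-1..1::real}. 0 < \<epsilon> \<longrightarrow> \<epsilon> \<le> 1 \<longrightarrow>
        expected_consensus_time p (lattice_box d L) (box_adj d) \<epsilon> f0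
          \<le> ennreal (C *
              (if p < 2
               then real n * real d powr (1 / (p - 1)) * real L powr (p / (p - 1)) * ln (real n / \<epsilon>)
               else real n * real d * real L ^ 2 * ln (real n / \<epsilon>)))) \<and>
      (SUP f0 \<in> lattice_box d L \<rightarrow>\<^sub>E {-1..1::real}.
          expected_consensus_time p (lattice_box d L) (box_adj d) (1 / 2) f0)
        \<ge> ennreal (c * real n *
              (if p < 2 then max (real d powr (1 / (p - 1) - 1) * real L powr q) (real d * ln (real L))
               else if p = 2 then real d * real L ^ 2
               else max (real d * ln (real L)) (real L ^ 2))))"
proof -
  define C where "C = (if p < 2 then (p * ln 16 + 2 * p + 4) * (2 * 32 powr (1 / (p - 1)))
    else (p * ln (4 * p) + 2 * p + 4) * (6 * (p * (p - 1) * 2 powr (p - 2)) * p\<^sup>2))"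
  define c where "c = (if p < 2
      then min (1 / (400000 * 6 powr (1 / (p - 1) + 1) * 2 powr (1 / (p - 1)))) (1 / 8192)
    else if p = 2 then 1 / 432 else min (1 / 8192) (1 / 14400000 :: real))"
  have q: "q = 1 / (p - 1) + 1" using assms by (simp add: field_simps)
  have "0 \<le> p * ln 16" "0 \<le> p * ln (4 * p)" using assms by auto
  then have "0 < p * ln 16 + 2 * p + 4" "0 < p * ln (4 * p) + 2 * p + 4" using assms by linarith+
  then have "0 < C" using assms by (simp add: C_def)
  moreover have "0 < c" by (simp add: c_def)
  moreover have "expected_consensus_time p (lattice_box d L) (box_adj d) \<epsilon> f0
      \<le> ennreal (C *
          (if p < 2
           then real (L ^ d) * real d powr (1 / (p - 1)) * real L powr (p / (p - 1)) * ln (real (L ^ d) / \<epsilon>)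
           else real (L ^ d) * real d * real L ^ 2 * ln (real (L ^ d) / \<epsilon>)))"
    if dL: "2 \<le> d" "2 \<le> L" and f0: "f0 \<in> lattice_box d L \<rightarrow>\<^sub>E {-1..1}" and \<epsilon>: "0 < \<epsilon>" "\<epsilon> \<le> 1"
    for d L \<epsilon> f0
  proof -
    interpret box_graph p d L using assms dL by unfold_locales
    show ?thesis
    proof (cases "p < 2")
      case True
      then show ?thesis using box_upper_le_2[OF _ f0 \<epsilon>] by (simp only: C_def if_True less_imp_le)
    next
      case False
      then have "2 \<le> p" by simp
      from False box_upper_ge_2[OF this f0 \<epsilon>] show ?thesis by (simp only: C_def if_False)
    qed
  qed
  moreover have "ennreal (c * real (L ^ d) *
        (if p < 2 then max (real d powr (1 / (p - 1) - 1) * real L powr q) (real d * ln (real L))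
         else if p = 2 then real d * real L ^ 2
         else max (real d * ln (real L)) (real L ^ 2)))
      \<le> (SUP f0 \<in> lattice_box d L \<rightarrow>\<^sub>E {-1..1}.
          expected_consensus_time p (lattice_box d L) (box_adj d) (1 / 2) f0)"
    if dL: "2 \<le> d" "2 \<le> L" for d L
  proof -
    interpret box_graph p d L using assms dL by unfold_locales
    have ln: "0 \<le> real d * ln (real L)" using dL by simp
    consider "p < 2" | "p = 2" | "2 < p" by linarith
    then show ?thesis
    proof cases
      case 1
      have "ennreal (c * real (L ^ d) * max (real d powr (1 / (p - 1) - 1) * real L powr q) (real d * ln (real L))) \<le> worst_time"
        using 1 ln unfolding c_def q
        by (simp only: if_True) (rule ennreal_max_le[OF worst_time_ge_power[OF refl] worst_time_ge_coupon], auto)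
      then show ?thesis using 1 by simp
    next
      case 2
      then show ?thesis using worst_time_ge_2[OF 2] by (simp add: c_def)
    next
      case 3
      have "ennreal (min (1 / 8192) (1 / 14400000) * real (L ^ d) * max (real d * ln (real L)) (real L ^ 2)) \<le> worst_time"
        by (rule ennreal_max_le[OF worst_time_ge_coupon worst_time_ge_square ln]) auto
      then show ?thesis using 3 by (simp add: c_def)
    qed
  qed
  ultimately show ?thesis by blast
qed

end
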